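(* Let $N\ge1$ be the number of independent scalar channels and $a>0$ the plate separation. In the large-area parallel-plate limit, using the standard scalar finite-part subtraction and the reference normalization $\mathcal{Q}=\hbar c$, the comparison coefficient $\overline{\Theta}^{(N)}_\alpha$ of the plate-compatible rectangular aspect-ratio family satisfies, for every $\alpha>0$, $$\overline{\Theta}_{\alpha}^{(N)}=\frac{N\pi^2}{1440\,\Delta(\alpha)}.$$ Consequently, writing $\overline{\Theta}^{(N)}_\Delta:=\overline{\Theta}^{(N)}_1$ and $\Delta_3(-1):=\Delta(1)$, $$\overline{\Theta}_{\alpha}^{(N)}\ge\overline{\Theta}_{\Delta}^{(N)}=\frac{N\pi^2}{1440\,\Delta_3(-1)},$$ with equality if and only if $\alpha=1$. In particular, for two scalar channels, $$\overline{\Theta}_{\Delta}^{(2)}=\frac{\pi^2}{720\,\Delta_3(-1)}.$$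
   Context: For $\alpha>0$, $D_\alpha=[0,\alpha]\times[0,\alpha^{-1}]\times[0,1]$ and $\Delta(\alpha)=\int_{D_\alpha}\int_{D_\alpha}|x-y|^{-1}\,d^3x\,d^3y$. Constants $\hbar,c,g>0$ are fixed. Plate geometry: for $L>0$ let $B_{L,a}=\mathbb{T}^2_L\times[0,a]$, with $\mathbb{T}^2_L$ the flat torus of side $L$ and area $A=L^2$, and let $L_B=-\Delta_{\mathbb{T}^2_L}-\partial_z^2$ with Dirichlet conditions at $z=0$ and $z=a$; its eigenvalues are $\lambda_{\mathbf m,r}=(2\pi/L)^2|\mathbf m|^2+(\pi r/a)^2$, $\mathbf m\in\mathbb{Z}^2$, $r\in\{1,2,\dots\}$. The area is written $A=n^2a^2$ (so $L=na$), $n$ a positive integer, and the large-area limit is $n\to\infty$ with $a$ fixed. Stochastic energy: for one channel, $U_\tau=\frac12\langle\sigma_\tau,gL_B^{-1}\sigma_\tau\rangle$ with $\sigma_\tau=(\hbar c/g)^{1/2}L_B^{3/4}e^{-\tau L_B/2}\xi$, $\tau>0$, where $\xi$ is Gaussian white noise on $L^2(B_{L,a})$ (formally $\xi=\sum_j\xi_ju_j$ for an orthonormal eigenbasis $(u_j)$ of $L_B$ and independent centered Gaussians with $\mathbb{E}[\xi_i\overline{\xi_j}]=\delta_{ij}$). For $N$ channels, $U^{(N)}_\tau$ is the sum of $N$ independent copies of $U_\tau$. Reference energy: $n^2$ identical cells of shape $aD_\alpha$, with normalization $\mathcal{Q}$, have reference energy $U_\alpha(\mathcal{Q},n,a):=-\frac{n^2}{a}\mathcal{Q}\,\Delta(\alpha)$.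 Comparison coefficient: $\Theta^{(N)}_{\alpha,\tau}:=U^{(N)}_\tau/U_\alpha(\hbar c,n,a)=-\frac{a}{n^2\hbar c\,\Delta(\alpha)}U^{(N)}_\tau$, and $\overline{\Theta}^{(N)}_\alpha:=\lim_{n\to\infty}\operatorname{FP}_{\mathcal{R},\tau\to0^+}\mathbb{E}[\Theta^{(N)}_{\alpha,\tau}]$. Here $\operatorname{FP}_{\mathcal{R},\tau\to0^+}$ is the standard parallel-plate subtraction: from the $\tau\to0^+$ asymptotic expansion of the expectation one removes the divergent bulk term (a multiple of $\tau^{-2}$, proportional to the volume $Aa$) and the divergent one-plate self-energy term (a multiple of $\tau^{-3/2}$, proportional to $A$), and takes the limit $\tau\to0^+$ of the remainder; no additional finite counterterm is added. *)

theory Defs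
  imports "HOL-Probability.Probability"
begin

section \<open>The boxes and their self-energy integral\<close>

definition box_D :: "real \<Rightarrow> (real ^ 3) set" where
  "box_D \<alpha> = {x. 0 \<le> x $ 1 \<and> x $ 1 \<le> \<alpha> \<and> 0 \<le> x $ 2 \<and> x $ 2 \<le> inverse \<alpha> \<and> 0 \<le> x $ 3 \<and> x $ 3 \<le> 1}"

text \<open>The value 0 that Isabelle gives to the integrand on the diagonal is irrelevant (null set).\<close>

definition Delta :: "real \<Rightarrow> real" where
  "Delta \<alpha> = (LINT x:box_D \<alpha>|lborel. (LINT y:box_D \<alpha>|lborel. 1 / norm (x - y)))"

section \<open>The plate geometry\<close>

text \<open>A function on the product of the flat torus of side L with the interval from 0 to a is
  represented by a function on the slab that is L-periodic in the first two coordinates.  Its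
  L2 theory is that of the fundamental cell.\<close>

definition slab :: "real \<Rightarrow> (real ^ 3) set" where
  "slab a = {x. 0 \<le> x $ 3 \<and> x $ 3 \<le> a}"

definition open_slab :: "real \<Rightarrow> (real ^ 3) set" where
  "open_slab a = {x. 0 < x $ 3 \<and> x $ 3 < a}"

definition periodic_slab :: "real \<Rightarrow> real \<Rightarrow> (real ^ 3 \<Rightarrow> complex) \<Rightarrow> bool" where
  "periodic_slab L a f \<longleftrightarrow>
     (\<forall>x\<in>slab a. f (x + L *\<^sub>R axis 1 1) = f x \<and> f (x + L *\<^sub>R axis 2 1) = f x)"

definition cell :: "real \<Rightarrow> real \<Rightarrow> (real ^ 3) set" where
  "cell L a = {x. 0 \<le> x $ 1 \<and> x $ 1 \<le> L \<and> 0 \<le> x $ 2 \<and> x $ 2 \<le> L \<and> 0 \<le> x $ 3 \<and> x $ 3 \<le> a}"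

abbreviation vol :: "real \<Rightarrow> real \<Rightarrow> (real ^ 3) measure" where
  "vol L a \<equiv> restrict_space lborel (cell L a)"

definition square_integrable :: "real \<Rightarrow> real \<Rightarrow> (real ^ 3 \<Rightarrow> complex) \<Rightarrow> bool" where
  "square_integrable L a f \<longleftrightarrow>
     f \<in> borel_measurable (vol L a) \<and> integrable (vol L a) (\<lambda>x. (norm (f x))\<^sup>2)"

definition L2_inner :: "real \<Rightarrow> real \<Rightarrow> (real ^ 3 \<Rightarrow> complex) \<Rightarrow> (real ^ 3 \<Rightarrow> complex) \<Rightarrow> complex" where
  "L2_inner L a f h = (\<integral>x. cnj (f x) * h x \<partial>vol L a)"

section \<open>The operator \<open>L\<^sub>B\<close> and its eigenbases\<close>

definition partial_deriv :: "3 \<Rightarrow> (real ^ 3 \<Rightarrow> complex) \<Rightarrow> real ^ 3 \<Rightarrow> complex" where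
  "partial_deriv i f x = vector_derivative (\<lambda>t. f (x + t *\<^sub>R axis i 1)) (at 0)"

definition C1_on :: "(real ^ 3) set \<Rightarrow> (real ^ 3 \<Rightarrow> complex) \<Rightarrow> bool" where
  "C1_on S f \<longleftrightarrow>
     (\<forall>i. (\<forall>x\<in>S. (\<lambda>t. f (x + t *\<^sub>R axis i 1)) differentiable (at 0)) \<and>
          continuous_on S (partial_deriv i f))"

definition C2_on :: "(real ^ 3) set \<Rightarrow> (real ^ 3 \<Rightarrow> complex) \<Rightarrow> bool" where
  "C2_on S f \<longleftrightarrow> C1_on S f \<and> (\<forall>i. C1_on S (partial_deriv i f))"

definition laplacian :: "(real ^ 3 \<Rightarrow> complex) \<Rightarrow> real ^ 3 \<Rightarrow> complex" where
  "laplacian f x = (\<Sum>i\<in>UNIV. partial_deriv i (partial_deriv i f) x)"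

definition LB_eigenfunction :: "real \<Rightarrow> real \<Rightarrow> real \<Rightarrow> (real ^ 3 \<Rightarrow> complex) \<Rightarrow> bool" where
  "LB_eigenfunction L a \<mu> f \<longleftrightarrow>
     periodic_slab L a f \<and> continuous_on (slab a) f \<and> C2_on (open_slab a) f \<and>
     (\<forall>x. x $ 3 = 0 \<or> x $ 3 = a \<longrightarrow> f x = 0) \<and>
     (\<forall>x\<in>open_slab a. - laplacian f x = of_real \<mu> * f x)"

type_synonym mode = "(int \<times> int) \<times> nat"

definition modes :: "mode set" where
  "modes = UNIV \<times> {1..}"

definition eigval :: "real \<Rightarrow> real \<Rightarrow> mode \<Rightarrow> real" where
  "eigval L a = (\<lambda>((m1, m2), r).
     (2 * pi / L)\<^sup>2 * ((of_int m1)\<^sup>2 + (of_int m2)\<^sup>2) + (pi * of_nat r / a)\<^sup>2)"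

text \<open>Completeness is stated as totality: only the zero class is orthogonal to all \<open>u j\<close>.\<close>

definition orthonormal_eigenbasis :: "real \<Rightarrow> real \<Rightarrow> (mode \<Rightarrow> real ^ 3 \<Rightarrow> complex) \<Rightarrow> bool" where
  "orthonormal_eigenbasis L a u \<longleftrightarrow>
     (\<forall>j\<in>modes. LB_eigenfunction L a (eigval L a j) (u j)) \<and>
     (\<forall>i\<in>modes. \<forall>j\<in>modes. L2_inner L a (u i) (u j) = of_bool (i = j)) \<and>
     (\<forall>f. square_integrable L a f \<longrightarrow> (\<forall>j\<in>modes. L2_inner L a (u j) f = 0) \<longrightarrow>
          (AE x in vol L a. f x = 0))"

text \<open>The sum of the series of the \<open>b j * u j\<close> in the L2 norm.  It is determined only up to a
  null set, hence the choice operator; only its L2 inner products are used.\<close>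

definition L2_sum ::
  "real \<Rightarrow> real \<Rightarrow> (mode \<Rightarrow> real ^ 3 \<Rightarrow> complex) \<Rightarrow> (mode \<Rightarrow> complex) \<Rightarrow> (real ^ 3 \<Rightarrow> complex)" where
  "L2_sum L a u b = (SOME f. square_integrable L a f \<and>
     ((\<lambda>F. \<integral>x. (norm (f x - (\<Sum>j\<in>F. b j * u j x)))\<^sup>2 \<partial>vol L a) \<longlongrightarrow> 0)
       (finite_subsets_at_top modes))"

text \<open>Functional calculus: \<open>\<phi>(L\<^sub>B)\<close> applied to the possibly only formal series of the
  \<open>b j * u j\<close>, which is how it acts on white noise.\<close>

definition LB_apply ::
  "real \<Rightarrow> real \<Rightarrow> (mode \<Rightarrow> real ^ 3 \<Rightarrow> complex) \<Rightarrow> (real \<Rightarrow> real) \<Rightarrow> (mode \<Rightarrow> complex)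
     \<Rightarrow> (real ^ 3 \<Rightarrow> complex)" where
  "LB_apply L a u \<phi> b = L2_sum L a u (\<lambda>j. of_real (\<phi> (eigval L a j)) * b j)"

definition LB_inverse ::
  "real \<Rightarrow> real \<Rightarrow> (mode \<Rightarrow> real ^ 3 \<Rightarrow> complex) \<Rightarrow> (real ^ 3 \<Rightarrow> complex) \<Rightarrow> (real ^ 3 \<Rightarrow> complex)" where
  "LB_inverse L a u f = LB_apply L a u inverse (\<lambda>j. L2_inner L a (u j) f)"

section \<open>Gaussian white noise in independent channels\<close>

definition centered_normal :: "'w measure \<Rightarrow> ('w \<Rightarrow> real) \<Rightarrow> bool" where
  "centered_normal M X \<longleftrightarrow> X \<in> borel_measurable M \<and>
     ((AE \<omega> in M. X \<omega> = 0) \<or> (\<exists>s>0. distributed M lborel X (normal_density 0 s)))"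

text \<open>Real and imaginary part are jointly normal, degenerate laws being allowed, so that both
  real noise and circularly symmetric complex noise are covered.\<close>

definition centered_gaussian :: "'w measure \<Rightarrow> ('w \<Rightarrow> complex) \<Rightarrow> bool" where
  "centered_gaussian M Z \<longleftrightarrow> Z \<in> borel_measurable M \<and> (\<forall>w. centered_normal M (\<lambda>\<omega>. Re (w * Z \<omega>)))"

text \<open>\<open>\<xi> k j\<close> is the coefficient of the \<open>k\<close>-th noise at the \<open>j\<close>-th eigenfunction.  Joint
  independence over all pairs \<open>(k, j)\<close> together with equal laws in \<open>k\<close> makes the channels
  independent copies of each other.\<close>

definition white_noise_channels :: "'w measure \<Rightarrow> nat \<Rightarrow> (nat \<Rightarrow> mode \<Rightarrow> 'w \<Rightarrow> complex) \<Rightarrow> bool" where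
  "white_noise_channels M N \<xi> \<longleftrightarrow>
     prob_space M \<and>
     (\<forall>k<N. \<forall>j\<in>modes. centered_gaussian M (\<xi> k j)) \<and>
     prob_space.indep_vars M (\<lambda>_. borel) (\<lambda>(k, j). \<xi> k j) ({..<N} \<times> modes) \<and>
     (\<forall>k<N. \<forall>i\<in>modes. \<forall>j\<in>modes.
        prob_space.expectation M (\<lambda>\<omega>. \<xi> k i \<omega> * cnj (\<xi> k j \<omega>)) = of_bool (i = j)) \<and>
     (\<forall>k<N. \<forall>l<N. \<forall>j\<in>modes. distr M borel (\<xi> k j) = distr M borel (\<xi> l j))"

section \<open>Stochastic energy and comparison coefficient\<close>

text \<open>Below, \<open>b\<close> is the family of noise coefficients at one sample point.\<close>

definition sigma_field ::
  "real \<Rightarrow> real \<Rightarrow> real \<Rightarrow> real \<Rightarrow> real \<Rightarrow> (mode \<Rightarrow> real ^ 3 \<Rightarrow> complex) \<Rightarrow> real \<Rightarrow> (mode \<Rightarrow> complex)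
     \<Rightarrow> (real ^ 3 \<Rightarrow> complex)" where
  "sigma_field hbar c g L a u \<tau> b =
     LB_apply L a u
       (\<lambda>\<mu>. (hbar * c / g) powr (1/2) * (\<mu> powr (3/4) * exp (- \<tau> * \<mu> / 2))) b"

text \<open>The inner product is almost surely real (and nonnegative), so taking \<open>Re\<close> only adjusts the type.\<close>

definition channel_energy ::
  "real \<Rightarrow> real \<Rightarrow> real \<Rightarrow> real \<Rightarrow> real \<Rightarrow> (mode \<Rightarrow> real ^ 3 \<Rightarrow> complex) \<Rightarrow> real \<Rightarrow> (mode \<Rightarrow> complex)
     \<Rightarrow> real" where
  "channel_energy hbar c g L a u \<tau> b =
     (let \<sigma> = sigma_field hbar c g L a u \<tau> b
      in 1/2 * Re (L2_inner L a \<sigma> (\<lambda>x. of_real g * LB_inverse L a u \<sigma> x)))"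

definition stochastic_energy ::
  "real \<Rightarrow> real \<Rightarrow> real \<Rightarrow> real \<Rightarrow> real \<Rightarrow> nat \<Rightarrow> (mode \<Rightarrow> real ^ 3 \<Rightarrow> complex)
     \<Rightarrow> (nat \<Rightarrow> mode \<Rightarrow> 'w \<Rightarrow> complex) \<Rightarrow> real \<Rightarrow> 'w \<Rightarrow> real" where
  "stochastic_energy hbar c g L a N u \<xi> \<tau> \<omega> =
     (\<Sum>k<N. channel_energy hbar c g L a u \<tau> (\<lambda>j. \<xi> k j \<omega>))"

definition reference_energy :: "real \<Rightarrow> real \<Rightarrow> nat \<Rightarrow> real \<Rightarrow> real" where
  "reference_energy \<alpha> Q n a = - (of_nat n)\<^sup>2 / a * Q * Delta \<alpha>"

text \<open>Here \<open>L = n a\<close>.  The eigenbasis, the probability space and the noise depend on \<open>n\<close>.\<close>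

definition Theta ::
  "real \<Rightarrow> real \<Rightarrow> real \<Rightarrow> real \<Rightarrow> nat \<Rightarrow> (nat \<Rightarrow> mode \<Rightarrow> real ^ 3 \<Rightarrow> complex)
     \<Rightarrow> (nat \<Rightarrow> nat \<Rightarrow> mode \<Rightarrow> 'w \<Rightarrow> complex) \<Rightarrow> real \<Rightarrow> nat \<Rightarrow> real \<Rightarrow> 'w \<Rightarrow> real" where
  "Theta hbar c g a N u \<xi> \<alpha> n \<tau> \<omega> =
     stochastic_energy hbar c g (of_nat n * a) a N (u n) (\<xi> n) \<tau> \<omega> /
     reference_energy \<alpha> (hbar * c) n a"

definition mean_Theta ::
  "real \<Rightarrow> real \<Rightarrow> real \<Rightarrow> real \<Rightarrow> nat \<Rightarrow> (nat \<Rightarrow> 'w measure)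
     \<Rightarrow> (nat \<Rightarrow> mode \<Rightarrow> real ^ 3 \<Rightarrow> complex)
     \<Rightarrow> (nat \<Rightarrow> nat \<Rightarrow> mode \<Rightarrow> 'w \<Rightarrow> complex) \<Rightarrow> real \<Rightarrow> nat \<Rightarrow> real \<Rightarrow> real" where
  "mean_Theta hbar c g a N M u \<xi> \<alpha> n \<tau> =
     prob_space.expectation (M n) (Theta hbar c g a N u \<xi> \<alpha> n \<tau>)"

text \<open>\<open>V\<close> is the volume and \<open>A\<close> the plate area.  The value \<open>F\<close> is unique when it exists, because
  no nontrivial combination of the two divergent powers converges as \<open>\<tau>\<close> tends to 0.\<close>

definition has_finite_part :: "real \<Rightarrow> real \<Rightarrow> (real \<Rightarrow> real) \<Rightarrow> real \<Rightarrow> bool" where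
  "has_finite_part V A f F \<longleftrightarrow>
     (\<exists>p q. ((\<lambda>\<tau>. f \<tau> - p * V * \<tau> powr (- 2) - q * A * \<tau> powr (- 3/2)) \<longlongrightarrow> F) (at_right 0))"

definition finite_part :: "real \<Rightarrow> real \<Rightarrow> (real \<Rightarrow> real) \<Rightarrow> real" where
  "finite_part V A f = (THE F. has_finite_part V A f F)"

abbreviation plate_area :: "nat \<Rightarrow> real \<Rightarrow> real" where
  "plate_area n a \<equiv> (of_nat n)\<^sup>2 * a\<^sup>2"

definition finite_mean_Theta ::
  "real \<Rightarrow> real \<Rightarrow> real \<Rightarrow> real \<Rightarrow> nat \<Rightarrow> (nat \<Rightarrow> 'w measure)
     \<Rightarrow> (nat \<Rightarrow> mode \<Rightarrow> real ^ 3 \<Rightarrow> complex)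
     \<Rightarrow> (nat \<Rightarrow> nat \<Rightarrow> mode \<Rightarrow> 'w \<Rightarrow> complex) \<Rightarrow> real \<Rightarrow> nat \<Rightarrow> real" where
  "finite_mean_Theta hbar c g a N M u \<xi> \<alpha> n =
     finite_part (plate_area n a * a) (plate_area n a) (mean_Theta hbar c g a N M u \<xi> \<alpha> n)"

definition Theta_bar ::
  "real \<Rightarrow> real \<Rightarrow> real \<Rightarrow> real \<Rightarrow> nat \<Rightarrow> (nat \<Rightarrow> 'w measure)
     \<Rightarrow> (nat \<Rightarrow> mode \<Rightarrow> real ^ 3 \<Rightarrow> complex)
     \<Rightarrow> (nat \<Rightarrow> nat \<Rightarrow> mode \<Rightarrow> 'w \<Rightarrow> complex) \<Rightarrow> real \<Rightarrow> real" where
  "Theta_bar hbar c g a N M u \<xi> \<alpha> = lim (finite_mean_Theta hbar c g a N M u \<xi> \<alpha>)"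

end

theory Submission
  imports Defs
begin

text \<open>
  The mean energy of a channel is a spectral sum. The \<open>j\<close>-th coefficient of the field is
  \<open>(hbar * c / g) powr (1/2) * \<lambda> powr (3/4) * exp (- \<tau> * \<lambda> / 2) * \<xi> j\<close>, where \<open>\<lambda>\<close> is the \<open>j\<close>-th
  eigenvalue. By Parseval's identity the energy is half of \<open>hbar * c\<close> times the sum of
  \<open>sqrt \<lambda> * exp (- \<tau> * \<lambda>) * (norm (\<xi> j))\<^sup>2\<close>, and as the coefficients of the noise have variance
  \<open>1\<close>, its expectation is half of \<open>hbar * c\<close> times \<open>S \<tau>\<close>, the sum of all
  \<open>sqrt \<lambda> * exp (- \<tau> * \<lambda>)\<close> (\<open>channel_energy_expectation\<close>). The expectations of the channels add
  up.

  The finite part of \<open>S\<close> is found by subordination to the heat trace \<open>K t\<close>, the sum of all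
  \<open>exp (- t * \<lambda>)\<close>. Since \<open>sqrt \<lambda>\<close> is, up to the factor \<open>2 * sqrt pi\<close>, the integral of
  \<open>1 - exp (- \<lambda> / x\<^sup>2)\<close> over the real line, \<open>S \<tau>\<close> is the integral of \<open>K \<tau> - K (\<tau> + 1 / x\<^sup>2)\<close>
  divided by \<open>2 * sqrt pi\<close>. The heat trace is a product of theta functions, and their
  transformation formula (\<open>theta_transformation\<close>) splits it into \<open>K = P + E\<close>: the main part \<open>P\<close>
  is a volume term \<open>t powr (- 3/2)\<close> and a plate term \<open>1 / t\<close>, and \<open>E\<close> vanishes faster than every
  power as \<open>t\<close> tends to \<open>0\<close>. By scaling, \<open>P\<close> contributes exact multiples of \<open>\<tau> powr (- 2)\<close> and
  \<open>\<tau> powr (- 3/2)\<close>, which are the two terms that the finite part removes. What is left tends to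
  minus the integral of \<open>E (1 / x\<^sup>2)\<close> divided by \<open>2 * sqrt pi\<close> (\<open>spectral_sum_finite_part\<close>).

  Per unit area, \<open>E\<close> tends to the contribution of the images across the plates as the area
  grows, a series of Gaussians in \<open>x\<close> whose integrals are multiples of \<open>1 / k ^ 4\<close>. Their sum
  \<open>pi ^ 4 / 90\<close> gives the Casimir constant (\<open>heat_error_integral_limit\<close>).

  It remains to compare the self-energies \<open>Delta \<alpha>\<close>. Writing the Coulomb kernel as a
  superposition of Gaussians makes \<open>Delta \<alpha>\<close> an integral over \<open>s\<close> of a product of three
  one-dimensional energies \<open>2 * H (s * l) / s\<^sup>2\<close>, one for each edge length \<open>l\<close>, where \<open>H\<close> is the
  twice iterated integral of \<open>exp (- x\<^sup>2)\<close>. As \<open>ln (H x)\<close> is strictly concave in \<open>ln x\<close>, the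
  edges \<open>\<alpha>\<close> and \<open>inverse \<alpha>\<close> give less than two edges of length \<open>1\<close>, for every \<open>s\<close>. So the cube
  has the largest self-energy (\<open>Delta_less_cube\<close>), and therefore the smallest comparison
  coefficient.
\<close>

section \<open>Logarithmic concavity of the Gaussian edge energy\<close>

text \<open>
  The monotone form of l'Hospital's rule. By Cauchy's mean value theorem the quotient at \<open>x\<close> and
  the slope of \<open>f\<close> against \<open>g\<close> over \<open>[x, y]\<close> are values of \<open>f' / g'\<close> at points left and right of
  \<open>x\<close>; continuing beyond \<open>x\<close> with a smaller slope lowers the quotient.
\<close>

lemma monotone_quotient:
  fixes f g f' g' :: "real \<Rightarrow> real"
  assumes f: "\<And>x. DERIV f x :> f' x" and g: "\<And>x. DERIV g x :> g' x"
    and zero: "f 0 = 0" "g 0 = 0" and pos: "\<And>x. x > 0 \<Longrightarrow> g' x > 0"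
    and decr: "\<And>x y. 0 < x \<Longrightarrow> x < y \<Longrightarrow> f' y / g' y < f' x / g' x"
    and xy: "0 < x" "x < y"
  shows "f y / g y < f x / g x"
proof -
  have cont: "isCont f z" "isCont g z" for z using f g DERIV_isCont by blast+
  obtain p where p: "0 < p" "p < x" "(f x - f 0) * g' p = (g x - g 0) * f' p"
    using GMVT'[of 0 x f g g' f'] cont f g xy by blast
  obtain q where q: "x < q" "q < y" "(f y - f x) * g' q = (g y - g x) * f' q"
    using GMVT'[of x y f g g' f'] cont f g xy by blast
  have gx: "g x > 0" and gxy: "g y > g x"
    using DERIV_pos_imp_increasing_open[of 0 x g] DERIV_pos_imp_increasing_open[of x y g] g pos xy
      zero cont
    by (metis continuous_at_imp_continuous_on order.strict_trans)+
  have "f x / g x = f' p / g' p"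
    using p gx pos[of p] zero by (simp add: field_simps)
  moreover have "(f y - f x) / (g y - g x) = f' q / g' q"
    using q gxy pos[of q] xy by (simp add: field_simps)
  moreover have "f' q / g' q < f' p / g' p" using decr[of p q] p q by simp
  ultimately have "(f y - f x) / (g y - g x) < f x / g x" by simp
  then have "(f y - f x) * g x < f x * (g y - g x)"
    using gx gxy by (simp add: divide_simps)
  then have "f y * g x < f x * g y" by (simp add: algebra_simps)
  then show ?thesis using gx gxy by (simp add: divide_simps)
qed

lemma ex_antiderivative:
  fixes f :: "real \<Rightarrow> real"
  assumes "continuous_on UNIV f"
  shows "\<exists>F. F 0 = 0 \<and> (\<forall>x. DERIV F x :> f x)"
proof -
  obtain F where F: "\<And>x. (F has_vector_derivative f x) (at x)"
    using einterval_antiderivative[of "-\<infinity>" "\<infinity>" f] assms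
    by (auto simp: continuous_on_eq_continuous_at)
  show ?thesis
    by (rule exI[of _ "\<lambda>x. F x - F 0"])
      (auto intro!: derivative_eq_intros F simp: has_real_derivative_iff_has_vector_derivative)
qed

text \<open>
  The integral of \<open>exp (- t\<^sup>2)\<close> from \<open>0\<close> to \<open>x\<close> (the error function up to a constant factor)
  and, in \<open>gauss_int2\<close>, its own integral from \<open>0\<close>. Both are characterized by their derivatives,
  which is the form in which the fundamental theorem of calculus and \<open>monotone_quotient\<close> consume
  them.
\<close>

definition gauss_int :: "real \<Rightarrow> real" where
  "gauss_int = (SOME F. F 0 = 0 \<and> (\<forall>x. DERIV F x :> exp (- x\<^sup>2)))"

definition gauss_int2 :: "real \<Rightarrow> real" where
  "gauss_int2 = (SOME F. F 0 = 0 \<and> (\<forall>x. DERIV F x :> gauss_int x))"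

lemma gauss_int_0 [simp]: "gauss_int 0 = 0"
  and DERIV_gauss_int: "DERIV gauss_int x :> exp (- x\<^sup>2)"
proof -
  have "\<exists>F. F 0 = 0 \<and> (\<forall>x::real. DERIV F x :> exp (- x\<^sup>2))"
    by (intro ex_antiderivative continuous_intros)
  from someI_ex[OF this, folded gauss_int_def]
  show "gauss_int 0 = 0" "DERIV gauss_int x :> exp (- x\<^sup>2)" by auto
qed

lemma continuous_gauss_int: "continuous_on UNIV gauss_int"
  using DERIV_gauss_int DERIV_isCont by (intro continuous_at_imp_continuous_on) blast

lemma gauss_int2_0 [simp]: "gauss_int2 0 = 0"
  and DERIV_gauss_int2: "DERIV gauss_int2 x :> gauss_int x"
proof -
  have "\<exists>F. F 0 = 0 \<and> (\<forall>x::real. DERIV F x :> gauss_int x)"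
    by (intro ex_antiderivative continuous_gauss_int)
  from someI_ex[OF this, folded gauss_int2_def]
  show "gauss_int2 0 = 0" "DERIV gauss_int2 x :> gauss_int x" by auto
qed

lemma gauss_int_minus: "gauss_int (- x) = - gauss_int x"
proof -
  have "DERIV (\<lambda>x. gauss_int x + gauss_int (- x)) x :> 0" for x
    by (auto intro!: derivative_eq_intros DERIV_chain2[OF DERIV_gauss_int] DERIV_gauss_int)
  then have "gauss_int x + gauss_int (- x) = gauss_int 0 + gauss_int (- 0)"
    using DERIV_isconst_all[of "\<lambda>x. gauss_int x + gauss_int (- x)" x 0] by simp
  then show ?thesis by simp
qed

lemma gauss_int2_minus: "gauss_int2 (- x) = gauss_int2 x"
proof -
  have "DERIV (\<lambda>x. gauss_int2 x - gauss_int2 (- x)) x :> 0" for x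
    by (auto intro!: derivative_eq_intros DERIV_chain2[OF DERIV_gauss_int2] DERIV_gauss_int2 simp:
      gauss_int_minus)
  then have "gauss_int2 x - gauss_int2 (- x) = gauss_int2 0 - gauss_int2 (- 0)"
    using DERIV_isconst_all[of "\<lambda>x. gauss_int2 x - gauss_int2 (- x)" x 0] by simp
  then show ?thesis by simp
qed

lemma gauss_int_pos: "x > 0 \<Longrightarrow> gauss_int x > 0"
  using DERIV_pos_imp_increasing[of 0 x gauss_int] DERIV_gauss_int by force

lemma gauss_int_mono: "x \<le> y \<Longrightarrow> gauss_int x \<le> gauss_int y"
  using DERIV_nonneg_imp_nondecreasing[of x y gauss_int] DERIV_gauss_int by force

lemma nonneg_if_DERIV_nonneg:
  fixes f :: "real \<Rightarrow> real"
  assumes "\<And>x. DERIV f x :> f' x" "\<And>x. 0 \<le> x \<Longrightarrow> 0 \<le> f' x" "f 0 = 0" "0 \<le> x"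
  shows "0 \<le> f x"
  using DERIV_nonneg_imp_nondecreasing[of 0 x f] assms by metis

text \<open>
  The first bound controls the edge energies for wide Gaussians, the second one for narrow
  Gaussians; it comes from comparison with the arctangent.
\<close>

lemma gauss_int_le:
  assumes "x \<ge> 0" shows "gauss_int x \<le> x" "gauss_int x \<le> 2"
proof -
  have "0 \<le> x - gauss_int x"
  proof (rule nonneg_if_DERIV_nonneg[of "\<lambda>x. x - gauss_int x" _ x])
    show "DERIV (\<lambda>x. x - gauss_int x) x :> 1 - exp (- x\<^sup>2)" for x
      by (intro DERIV_diff DERIV_ident DERIV_gauss_int)
  qed (use assms in auto)
  then show "gauss_int x \<le> x" by simp
  have "0 \<le> arctan x - gauss_int x"
  proof (rule nonneg_if_DERIV_nonneg[of "\<lambda>x. arctan x - gauss_int x" _ x])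
    show "DERIV (\<lambda>x. arctan x - gauss_int x) x :> inverse (1 + x\<^sup>2) - exp (- x\<^sup>2)" for x
      by (intro DERIV_diff DERIV_arctan DERIV_gauss_int)
    have "inverse (exp (x\<^sup>2)) \<le> inverse (1 + x\<^sup>2)" for x :: real
      using exp_ge_add_one_self[of "x\<^sup>2"] by (intro le_imp_inverse_le) (auto simp: add_pos_nonneg)
    then show "0 \<le> inverse (1 + x\<^sup>2) - exp (- x\<^sup>2)" for x :: real
      by (simp add: exp_minus)
  qed (use assms in auto)
  then have "gauss_int x \<le> arctan x" by simp
  also have "\<dots> \<le> 2" using arctan_ubound[of x] pi_less_4 by linarith
  finally show "gauss_int x \<le> 2" .
qed

lemma gauss_int2_pos: "x \<noteq> 0 \<Longrightarrow> gauss_int2 x > 0"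
proof -
  have *: "gauss_int2 x > 0" if "x > 0" for x
    using DERIV_pos_imp_increasing_open[of 0 x gauss_int2] DERIV_gauss_int2 gauss_int_pos that
      DERIV_isCont by (metis continuous_at_imp_continuous_on gauss_int2_0)
  assume "x \<noteq> 0"
  then show ?thesis using *[of x] *[of "- x"] by (cases "x > 0") (auto simp: gauss_int2_minus)
qed

lemma gauss_int2_le: 
  shows "gauss_int2 x \<le> x\<^sup>2 / 2" "gauss_int2 x \<le> 2 * \<bar>x\<bar>"
proof -
  have *: "gauss_int2 x \<le> x\<^sup>2 / 2" "gauss_int2 x \<le> 2 * x" if "x \<ge> 0" for x
  proof -
    have "0 \<le> x\<^sup>2 / 2 - gauss_int2 x"
    proof (rule nonneg_if_DERIV_nonneg[of "\<lambda>x. x\<^sup>2 / 2 - gauss_int2 x" _ x])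
      show "DERIV (\<lambda>x. x\<^sup>2 / 2 - gauss_int2 x) x :> x - gauss_int x" for x
        by (auto intro!: derivative_eq_intros DERIV_gauss_int2)
    qed (use that gauss_int_le in auto)
    then show "gauss_int2 x \<le> x\<^sup>2 / 2" by simp
    have "0 \<le> 2 * x - gauss_int2 x"
    proof (rule nonneg_if_DERIV_nonneg[of "\<lambda>x. 2 * x - gauss_int2 x" _ x])
      show "DERIV (\<lambda>x. 2 * x - gauss_int2 x) x :> 2 - gauss_int x" for x
        by (auto intro!: derivative_eq_intros DERIV_gauss_int2)
    qed (use that gauss_int_le in auto)
    then show "gauss_int2 x \<le> 2 * x" by simp
  qed
  show "gauss_int2 x \<le> x\<^sup>2 / 2" "gauss_int2 x \<le> 2 * \<bar>x\<bar>"
    using *[of x] *[of "- x"] by (cases "x \<ge> 0"; simp add: gauss_int2_minus)+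
qed

text \<open>
  The quotient of the derivatives is \<open>1 - 2 * x\<^sup>2\<close>, which decreases.
\<close>

lemma gauss_quotient1:
  assumes "0 < x" "x < y"
  shows "y * exp (- y\<^sup>2) / gauss_int y < x * exp (- x\<^sup>2) / gauss_int x"
proof (rule monotone_quotient[OF _ DERIV_gauss_int _ _ _ _ assms])
  show "DERIV (\<lambda>x. x * exp (- x\<^sup>2)) x :> (1 - 2 * x\<^sup>2) * exp (- x\<^sup>2)" for x :: real
    by (auto intro!: derivative_eq_intros simp: power2_eq_square algebra_simps)
  show "(1 - 2 * y\<^sup>2) * exp (- y\<^sup>2) / exp (- y\<^sup>2) < (1 - 2 * x\<^sup>2) * exp (- x\<^sup>2) / exp (- x\<^sup>2)"
    if "0 < x" "x < y" for x y :: real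
    using that by (simp add: power_strict_mono)
qed auto

text \<open>
  The quotient of the derivatives is \<open>1\<close> plus the quotient of \<open>gauss_quotient1\<close>. The left-hand
  function is the derivative of \<open>ln (gauss_int2 x)\<close> with respect to \<open>ln x\<close>, so its decrease says
  that \<open>gauss_int2\<close> is strictly logarithmically concave in the logarithmic variable.
\<close>

lemma gauss_quotient2:
  assumes "0 < x" "x < y"
  shows "y * gauss_int y / gauss_int2 y < x * gauss_int x / gauss_int2 x"
proof (rule monotone_quotient[OF _ DERIV_gauss_int2 _ _ _ _ assms])
  show "DERIV (\<lambda>x. x * gauss_int x) x :> gauss_int x + x * exp (- x\<^sup>2)" for x :: real
    by (auto intro!: derivative_eq_intros DERIV_gauss_int)
  show "(gauss_int y + y * exp (- y\<^sup>2)) / gauss_int y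
    < (gauss_int x + x * exp (- x\<^sup>2)) / gauss_int x"
    if "0 < x" "x < y" for x y :: real
    using gauss_quotient1[OF that] gauss_int_pos[of x] gauss_int_pos[of y] that
    by (simp add: add_divide_distrib)
qed (auto simp: gauss_int_pos)

text \<open>
  Strict concavity of \<open>ln (gauss_int2 x)\<close> in \<open>ln x\<close>, at two points placed symmetrically about
  \<open>s\<close> on the logarithmic scale. It is proved by differentiating along \<open>\<alpha>\<close>.
\<close>

lemma gauss_int2_log_concave:
  assumes s: "s \<noteq> 0" and \<alpha>: "\<alpha> > 0" "\<alpha> \<noteq> 1"
  shows "gauss_int2 (s * \<alpha>) * gauss_int2 (s * inverse \<alpha>) < gauss_int2 s * gauss_int2 s"
proof -
  have main: "gauss_int2 (s * \<alpha>) * gauss_int2 (s * inverse \<alpha>) < gauss_int2 s * gauss_int2 s"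
    if s: "s > 0" and \<alpha>: "\<alpha> > 1" for s \<alpha>
  proof -
    define D where "D x = ln (gauss_int2 (s * x)) + ln (gauss_int2 (s * inverse x))" for x
      have dD: "DERIV D x :> (s * x * gauss_int (s * x) / gauss_int2 (s * x)
          - s * inverse x * gauss_int (s * inverse x) / gauss_int2 (s * inverse x)) / x" if "x >
            0" for x
        unfolding D_def using that s gauss_int2_pos[of "s * x"] gauss_int2_pos[of "s * inverse x"]
        by (auto intro!: derivative_eq_intros DERIV_chain2[OF DERIV_gauss_int2])
          (simp add: field_simps)
    have "D \<alpha> < D 1"
    proof (rule DERIV_neg_imp_decreasing_open[OF \<alpha>])
      fix x assume x: "1 < x" "x < \<alpha>"
      have "inverse x < x" using x by (meson inverse_less_1_iff less_trans)
      then have "s * x * gauss_int (s * x) / gauss_int2 (s * x)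
          < s * inverse x * gauss_int (s * inverse x) / gauss_int2 (s * inverse x)"
        using x s by (intro gauss_quotient2) auto
      then show "\<exists>y. DERIV D x :> y \<and> y < 0"
        using x dD[of x] by (intro exI conjI) (auto intro!: divide_neg_pos)
    next
      show "continuous_on {1..\<alpha>} D"
        by (intro continuous_at_imp_continuous_on ballI DERIV_isCont[OF dD]) auto
    qed
    moreover have p: "gauss_int2 (s * \<alpha>) > 0" "gauss_int2 (s * inverse \<alpha>) > 0" "gauss_int2 s > 0"
      using s \<alpha> by (auto intro!: gauss_int2_pos)
    ultimately have "ln (gauss_int2 (s * \<alpha>) * gauss_int2 (s * inverse \<alpha>))
      < ln (gauss_int2 s * gauss_int2 s)"
      unfolding D_def ln_mult_pos[OF p(1,2)] ln_mult_pos[OF p(3,3)] by simp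
    then show ?thesis using p by (subst (asm) ln_less_cancel_iff) (auto intro!: mult_pos_pos)
  qed
  have main': "gauss_int2 (s * \<alpha>) * gauss_int2 (s * inverse \<alpha>) < gauss_int2 s * gauss_int2 s"
    if s: "s > 0" for s
  proof (cases "\<alpha> > 1")
    case True
    then show ?thesis using main[OF s] by simp
  next
    case False
    then have "inverse \<alpha> > 1" using \<alpha> by (simp add: one_less_inverse)
    then show ?thesis using main[OF s, of "inverse \<alpha>"] by (simp add: mult.commute)
  qed
  show ?thesis
  proof (cases "s > 0")
    case False
    then show ?thesis using main'[of "- s"] s by (simp add: gauss_int2_minus)
  qed (rule main')
qed

section \<open>The self-energy as a superposition of Gaussians\<close>

text \<open>
  Each of the two integrations is an application of the fundamental theorem of calculus;
  evenness of \<open>gauss_int2\<close> merges the two boundary terms that survive.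
\<close>

lemma Gaussian_edge_self_energy:
  fixes l s :: real
  assumes "l \<ge> 0" "s \<noteq> 0"
  shows "(\<integral>\<^sup>+x. \<integral>\<^sup>+y. ennreal (indicator {0..l} x * indicator {0..l} y * exp (- s\<^sup>2 * (x - y)\<^sup>2))
    \<partial>lborel \<partial>lborel)
    = ennreal (2 * gauss_int2 (s * l) / s\<^sup>2)"
proof -
  define Q where "Q x = (gauss_int (s * x) - gauss_int (s * (x - l))) / s" for x
  have Q_nonneg: "Q x \<ge> 0" for x
  proof (cases "s > 0")
    case True
    then have "gauss_int (s * (x - l)) \<le> gauss_int (s * x)" using assms
      by (intro gauss_int_mono) auto
    then show ?thesis using True by (simp add: Q_def)
  next
    case False
    then have "gauss_int (s * x) \<le> gauss_int (s * (x - l))" using assms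
      by (intro gauss_int_mono) (auto intro!: mult_left_mono_neg)
    then show ?thesis using False assms by (simp add: Q_def divide_nonpos_neg)
  qed
  have Q_meas [measurable]: "Q \<in> borel_measurable borel"
    unfolding Q_def by (intro borel_measurable_continuous_onI continuous_intros
      continuous_on_compose2[OF continuous_gauss_int]) (use assms in auto)
  have inner: "(\<integral>\<^sup>+y. ennreal (indicator {0..l} x * indicator {0..l} y * exp (- s\<^sup>2 * (x - y)\<^sup>2))
    \<partial>lborel)
      = ennreal (Q x) * indicator {0..l} x" for x
  proof -
    have "(\<integral>\<^sup>+y. ennreal (indicator {0..l} x * indicator {0..l} y * exp (- s\<^sup>2 * (x - y)\<^sup>2))
      \<partial>lborel)
      = (\<integral>\<^sup>+y. indicator {0..l} x * (ennreal (exp (- s\<^sup>2 * (x - y)\<^sup>2)) * indicator {0..l} y)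
        \<partial>lborel)"
      by (intro nn_integral_cong) (auto simp: indicator_def)
    also have "\<dots> = indicator {0..l} x * (\<integral>\<^sup>+y. ennreal (exp (- s\<^sup>2 * (x - y)\<^sup>2)) * indicator {0..l}
      y \<partial>lborel)"
      by (intro nn_integral_cmult) auto
    also have "(\<integral>\<^sup>+y. ennreal (exp (- s\<^sup>2 * (x - y)\<^sup>2)) * indicator {0..l} y \<partial>lborel)
        = ennreal (- gauss_int (s * (x - l)) / s - - gauss_int (s * (x - 0)) / s)"
      using assms
      by (intro nn_integral_FTC_Icc)
        (auto intro!: derivative_eq_intros DERIV_chain2[OF DERIV_gauss_int] simp:
          power_mult_distrib)
    finally show ?thesis by (simp add: Q_def diff_divide_distrib mult.commute)
  qed
  have "(\<integral>\<^sup>+x. ennreal (Q x) * indicator {0..l} x \<partial>lborel)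
      = ennreal ((gauss_int2 (s * l) - gauss_int2 (s * (l - l))) / s\<^sup>2 -
        (gauss_int2 (s * 0) - gauss_int2 (s * (0 - l))) / s\<^sup>2)"
  proof (rule nn_integral_FTC_Icc)
    show "DERIV (\<lambda>x. (gauss_int2 (s * x) - gauss_int2 (s * (x - l))) / s\<^sup>2) x :> Q x" for x
      using assms by (auto intro!: derivative_eq_intros DERIV_chain2[OF DERIV_gauss_int2]
        simp: Q_def field_simps power2_eq_square)
  qed (use assms Q_nonneg in auto)
  then show ?thesis
    unfolding inner using gauss_int2_minus[of "s * l"]
      by (simp add: diff_divide_distrib add_divide_distrib)
qed

text \<open>
  The Coulomb kernel is a superposition of Gaussians. This is what decouples the three
  coordinates.
\<close>

lemma inverse_norm_eq_Gaussian_integral: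
  fixes r :: real
  assumes "r > 0"
  shows "(\<integral>\<^sup>+s. ennreal (exp (- s\<^sup>2 * r\<^sup>2) / sqrt pi) \<partial>lborel) = ennreal (1 / r)"
proof -
  have "exp (- s\<^sup>2 * r\<^sup>2) / sqrt pi = (1 / r) * normal_density 0 (1 / (sqrt 2 * r)) s" for s
    using assms by (simp add: normal_density_def power_divide power_mult_distrib real_sqrt_divide)
  then have "(\<integral>\<^sup>+s. ennreal (exp (- s\<^sup>2 * r\<^sup>2) / sqrt pi) \<partial>lborel)
      = (\<integral>\<^sup>+s. ennreal ((1 / r) * normal_density 0 (1 / (sqrt 2 * r)) s) \<partial>lborel)"
    by simp
  also have "\<dots> = ennreal (\<integral>s. (1 / r) * normal_density 0 (1 / (sqrt 2 * r)) s \<partial>lborel)"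
    using assms by (intro nn_integral_eq_integral integrable_mult_right integrable_normal_density)
      auto
  also have "(\<integral>s. (1 / r) * normal_density 0 (1 / (sqrt 2 * r)) s \<partial>lborel) = 1 / r"
    using assms by simp
  finally show ?thesis .
qed

text \<open>
  The part of the self-energy of \<open>box_D \<alpha>\<close> carried by the Gaussian with parameter \<open>s\<close>: one
  factor for each edge, of lengths \<open>\<alpha>\<close>, \<open>inverse \<alpha>\<close> and \<open>1\<close>. As \<open>s\<close> runs over all reals and not
  only over the positive ones, the density is \<open>1 / sqrt pi\<close> and not twice that.
\<close>

definition box_profile :: "real \<Rightarrow> real \<Rightarrow> real" where
  "box_profile \<alpha> s = (2 * gauss_int2 (s * \<alpha>) / s\<^sup>2) * (2 * gauss_int2 (s * inverse \<alpha>) / s\<^sup>2)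
     * (2 * gauss_int2 s / s\<^sup>2) / sqrt pi"

lemma Basis_real3: "(Basis :: (real ^ 3) set) = (\<lambda>i. axis i 1) ` UNIV"
  by (auto simp: Basis_vec_def)

lemma inj_axis_1: "inj (\<lambda>i. axis i (1::real))"
  by (auto simp: inj_def axis_eq_axis)

lemma prod_Basis_real3:
  fixes f :: "real ^ 3 \<Rightarrow> 'a::comm_monoid_mult"
  shows "(\<Prod>b\<in>Basis. f b) = f (axis 1 1) * f (axis 2 1) * f (axis 3 1)"
proof -
  have "(\<Prod>b\<in>Basis. f b) = (\<Prod>i\<in>UNIV. f (axis i 1))"
    unfolding Basis_real3 by (subst prod.reindex[OF inj_axis_1]) (simp add: o_def)
  also have "\<dots> = (\<Prod>i\<in>{1, 2, 3::3}. f (axis i 1))" by (simp only: UNIV_3)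
  also have "\<dots> = f (axis 1 1) * (f (axis 2 1) * f (axis 3 1))" by (simp del: UNIV_3)
  finally show ?thesis by (simp only: mult.assoc)
qed

lemma box_Gaussian_self_energy:
  assumes "\<alpha> > 0" "s \<noteq> 0"
  shows "(\<integral>\<^sup>+x. \<integral>\<^sup>+y. ennreal (indicator (box_D \<alpha>) x * indicator (box_D \<alpha>) y * exp
    (- s\<^sup>2 * (norm (x - y))\<^sup>2) / sqrt pi) \<partial>lborel \<partial>lborel)
    = ennreal (box_profile \<alpha> s)"
proof -
  define l :: "real ^ 3" where "l = vector [\<alpha>, inverse \<alpha>, 1]"
  define E where "E b x y = ennreal (indicator {0..l \<bullet> b} x * indicator {0..l \<bullet> b} y * exp
    (- s\<^sup>2 * (x - y)\<^sup>2))" for b x y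
  have l: "l \<bullet> axis 1 1 = \<alpha>" "l \<bullet> axis 2 1 = inverse \<alpha>" "l \<bullet> axis 3 1 = 1"
    by (simp_all add: l_def inner_axis)
  have E_meas [measurable]: "(\<lambda>(x, y). E b x y) \<in> borel_measurable (borel \<Otimes>\<^sub>M borel)" for b
    unfolding E_def by measurable
  have E_meas' [measurable]: "(\<lambda>y. E b x y) \<in> borel_measurable borel" for b x
    unfolding E_def by measurable
  have E_int [measurable]: "(\<lambda>x. \<integral>\<^sup>+y. E b x y \<partial>lborel) \<in> borel_measurable borel" for b
    by measurable
  have point: "ennreal (indicator (box_D \<alpha>) x * indicator (box_D \<alpha>) y * exp
    (- s\<^sup>2 * (norm (x - y))\<^sup>2) / sqrt pi)
      = ennreal (1 / sqrt pi) * (\<Prod>b\<in>Basis. E b (x \<bullet> b) (y \<bullet> b))" for x y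
  proof -
    have ind: "indicator (box_D \<alpha>) z
      = (indicator {0..\<alpha>} (z $ 1) * indicator {0..inverse \<alpha>} (z $ 2) * indicator {0..1} (z $ 3) ::
      real)" for z
      by (auto simp: box_D_def indicator_def)
    have "(norm (x - y))\<^sup>2 = (x $ 1 - y $ 1)\<^sup>2 + (x $ 2 - y $ 2)\<^sup>2 + (x $ 3 - y $ 3)\<^sup>2"
      unfolding power2_norm_eq_inner by (simp add: inner_vec_def sum_3 power2_eq_square)
    then have "exp (- s\<^sup>2 * (norm (x - y))\<^sup>2)
      = exp (- s\<^sup>2 * (x $ 1 - y $ 1)\<^sup>2) * exp (- s\<^sup>2 * (x $ 2 - y $ 2)\<^sup>2) * exp
      (- s\<^sup>2 * (x $ 3 - y $ 3)\<^sup>2)"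
      by (simp add: exp_add[symmetric] algebra_simps)
    then show ?thesis
      unfolding ind prod_Basis_real3 E_def l
      by (simp add: inner_axis ennreal_mult[symmetric] mult_ac divide_inverse)
  qed
  have "(\<integral>\<^sup>+x. \<integral>\<^sup>+y. ennreal (indicator (box_D \<alpha>) x * indicator (box_D \<alpha>) y * exp
    (- s\<^sup>2 * (norm (x - y))\<^sup>2) / sqrt pi) \<partial>lborel \<partial>lborel)
     = (\<integral>\<^sup>+x. ennreal (1 / sqrt pi) * (\<Prod>b\<in>Basis. \<integral>\<^sup>+y. E b (x \<bullet> b) y \<partial>lborel) \<partial>lborel)"
    unfolding point
  proof (intro nn_integral_cong)
    fix x :: "real ^ 3"
    have "(\<integral>\<^sup>+y. ennreal (1 / sqrt pi) * (\<Prod>b\<in>Basis. E b (x \<bullet> b) (y \<bullet> b)) \<partial>lborel)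
       = ennreal (1 / sqrt pi) * (\<integral>\<^sup>+y. (\<Prod>b\<in>Basis. E b (x \<bullet> b) (y \<bullet> b)) \<partial>lborel)"
      by (intro nn_integral_cmult) (auto intro!: borel_measurable_prod_ennreal
        measurable_compose[OF _ E_meas'])
    also have "(\<integral>\<^sup>+y. (\<Prod>b\<in>Basis. E b (x \<bullet> b) (y \<bullet> b)) \<partial>lborel)
      = (\<Prod>b\<in>Basis. \<integral>\<^sup>+y. E b (x \<bullet> b) y \<partial>lborel)"
      by (rule nn_integral_lborel_prod) auto
    finally show "(\<integral>\<^sup>+y. ennreal (1 / sqrt pi) * (\<Prod>b\<in>Basis. E b (x \<bullet> b) (y \<bullet> b)) \<partial>lborel)
       = ennreal (1 / sqrt pi) * (\<Prod>b\<in>Basis. \<integral>\<^sup>+y. E b (x \<bullet> b) y \<partial>lborel)" .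
  qed
  also have "\<dots> = ennreal (1 / sqrt pi) * (\<integral>\<^sup>+x. (\<Prod>b\<in>Basis. \<integral>\<^sup>+y. E b (x \<bullet> b) y \<partial>lborel) \<partial>lborel)"
    by (intro nn_integral_cmult) (auto intro!: borel_measurable_prod_ennreal
      measurable_compose[OF _ E_int])
  also have "(\<integral>\<^sup>+x. (\<Prod>b\<in>Basis. \<integral>\<^sup>+y. E b (x \<bullet> b) y \<partial>lborel) \<partial>lborel)
    = (\<Prod>b\<in>Basis. \<integral>\<^sup>+x. \<integral>\<^sup>+y. E b x y \<partial>lborel \<partial>lborel)"
    by (rule nn_integral_lborel_prod) auto
  also have "\<dots> = ennreal (2 * gauss_int2 (s * \<alpha>) / s\<^sup>2) * ennreal
    (2 * gauss_int2 (s * inverse \<alpha>) / s\<^sup>2) * ennreal (2 * gauss_int2 (s * 1) / s\<^sup>2)"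
    unfolding prod_Basis_real3 E_def l using assms by (subst (1 2 3) Gaussian_edge_self_energy) auto
  also have "ennreal (1 / sqrt pi) * \<dots> = ennreal (box_profile \<alpha> s)"
    using assms gauss_int2_pos[of "s * \<alpha>"] gauss_int2_pos[of "s * inverse \<alpha>"] gauss_int2_pos[of s]
    by (simp add: box_profile_def ennreal_mult[symmetric] less_imp_le mult_ac)
  finally show ?thesis .
qed

lemma integrable_inverse_1_plus_square_UNIV: "integrable lborel (\<lambda>x::real. 1 / (1 + x\<^sup>2))"
  using integrable_inverse_1_plus_square by (simp add: set_integrable_def inverse_eq_divide)

lemma box_profile_measurable [measurable]: "box_profile \<alpha> \<in> borel_measurable borel"
proof -
  have [measurable]: "gauss_int2 \<in> borel_measurable borel"
    by (intro borel_measurable_continuous_onI continuous_at_imp_continuous_on ballI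
      DERIV_isCont[OF DERIV_gauss_int2])
  show ?thesis unfolding box_profile_def by measurable
qed

lemma box_profile_nonneg: "\<alpha> > 0 \<Longrightarrow> 0 \<le> box_profile \<alpha> s"
  using gauss_int2_pos[of "s * \<alpha>"] gauss_int2_pos[of "s * inverse \<alpha>"] gauss_int2_pos[of s]
  by (cases "s = 0") (auto simp: box_profile_def less_imp_le)

lemma box_profile_pos: "\<alpha> > 0 \<Longrightarrow> s \<noteq> 0 \<Longrightarrow> 0 < box_profile \<alpha> s"
  using gauss_int2_pos[of "s * \<alpha>"] gauss_int2_pos[of "s * inverse \<alpha>"] gauss_int2_pos[of s]
  by (auto simp: box_profile_def)

text \<open>
  For every Gaussian parameter the cube has the largest energy; the case \<open>s = 0\<close> is a null set.
\<close>

lemma box_profile_less: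
  assumes "\<alpha> > 0" "\<alpha> \<noteq> 1" "s \<noteq> 0"
  shows "box_profile \<alpha> s < box_profile 1 s"
proof -
  have "(gauss_int2 (s * \<alpha>) * gauss_int2 (s * inverse \<alpha>)) * (8 * gauss_int2 s / s^6 / sqrt pi)
      < (gauss_int2 s * gauss_int2 s) * (8 * gauss_int2 s / s^6 / sqrt pi)"
    using assms gauss_int2_pos[of s] by (intro mult_strict_right_mono gauss_int2_log_concave) auto
  moreover have "box_profile \<beta> s = (gauss_int2 (s * \<beta>) * gauss_int2 (s * inverse \<beta>)) *
    (8 * gauss_int2 s / s^6 / sqrt pi)" for \<beta>
    by (simp add: box_profile_def eval_nat_numeral mult_ac)
  ultimately show ?thesis by simp
qed

text \<open>
  An edge of length \<open>l\<close> contributes at most \<open>l\<^sup>2\<close> and at most \<open>4 * l / \<bar>s\<bar>\<close>. As the box has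
  volume \<open>1\<close>, the product is at most \<open>1\<close> and at most \<open>64 / \<bar>s\<bar> ^ 3\<close>.
\<close>

lemma integrable_box_profile:
  assumes "\<alpha> > 0"
  shows "integrable lborel (box_profile \<alpha>)"
proof (rule Bochner_Integration.integrable_bound)
  show "integrable lborel (\<lambda>s::real. 128 * (1 / (1 + s\<^sup>2)))"
    by (intro integrable_mult_right integrable_inverse_1_plus_square_UNIV)
  have "box_profile \<alpha> s \<le> 128 * (1 / (1 + s\<^sup>2))" for s
  proof (cases "s = 0")
    case True
    then show ?thesis by (simp add: box_profile_def)
  next
    case False
    let ?g = "\<lambda>l. 2 * gauss_int2 (s * l) / s\<^sup>2"
    have g1: "?g l \<le> l\<^sup>2" for l
      using gauss_int2_le(1)[of "s * l"] False by (simp add: field_simps power_mult_distrib)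
    have g2: "?g l \<le> 4 * l / \<bar>s\<bar>" if "l > 0" for l
    proof -
      have "2 * gauss_int2 (s * l) / s\<^sup>2 \<le> (4 * (\<bar>s\<bar> * l)) / s\<^sup>2"
        using gauss_int2_le(2)[of "s * l"] that
          by (intro divide_right_mono) (auto simp: abs_mult mult.commute)
      also have "\<dots> = 4 * l / \<bar>s\<bar>"
        using False by (cases "s > 0") (auto simp: power2_eq_square)
      finally show ?thesis .
    qed
    have g0: "0 \<le> ?g l" for l using gauss_int2_pos[of "s * l"] by (cases "s * l = 0") auto
    have pi1: "1 / sqrt pi \<le> 1" using pi_ge_two by simp
    have eq: "box_profile \<alpha> s = (?g \<alpha> * ?g (inverse \<alpha>) * ?g 1) * (1 / sqrt pi)"
      by (simp add: box_profile_def)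
    have le: "box_profile \<alpha> s \<le> ?g \<alpha> * ?g (inverse \<alpha>) * ?g 1"
      unfolding eq using g0 g0[of 1] pi1 by (intro mult_left_le mult_nonneg_nonneg) auto
    show ?thesis
    proof (cases "\<bar>s\<bar> \<le> 1")
      case True
      have "?g \<alpha> * ?g (inverse \<alpha>) * ?g 1 \<le> \<alpha>\<^sup>2 * (inverse \<alpha>)\<^sup>2 * 1\<^sup>2"
        using g0 g1 g0[of 1] g1[of 1] by (intro mult_mono mult_nonneg_nonneg) auto
      also have "\<dots> = 1" using assms by (simp add: power_mult_distrib[symmetric])
      also have "1 \<le> 128 * (1 / (1 + s\<^sup>2))"
        using True abs_square_le_1[of s] by (simp add: field_simps add_pos_nonneg)
      finally show ?thesis using le by linarith
    next
      case s1: False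
      have "?g \<alpha> * ?g (inverse \<alpha>) * ?g 1 \<le> (4 * \<alpha> / \<bar>s\<bar>) * (4 * inverse \<alpha> / \<bar>s\<bar>) * (4 * 1 / \<bar>s\<bar>)"
        using g0 g2 g0[of 1] g2[of 1] assms by (intro mult_mono mult_nonneg_nonneg) auto
      also have "\<dots> = 64 / (\<bar>s\<bar> * s\<^sup>2)"
        using assms False by (simp add: field_simps power2_eq_square)
      also have "\<dots> \<le> 64 / (1 * s\<^sup>2)"
        using s1 False by (intro divide_left_mono mult_right_mono) auto
      also have "\<dots> \<le> 128 * (1 / (1 + s\<^sup>2))"
      proof -
        have "1 \<le> s\<^sup>2" using s1 abs_square_le_1[of s] by linarith
        then show ?thesis using False by (simp add: field_simps add_pos_nonneg)
      qed
      finally show ?thesis using le by linarith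
    qed
  qed
  then show "AE s in lborel. norm (box_profile \<alpha> s) \<le> norm (128 * (1 / (1 + s\<^sup>2)))"
    using box_profile_nonneg[OF assms] by (intro AE_I2) (simp add: abs_of_nonneg)
qed measurable

lemma box_D_borel [measurable]: "box_D \<alpha> \<in> sets borel"
  unfolding box_D_def by measurable

text \<open>
  Tonelli's theorem for nonnegative functions. The diagonal, where \<open>1 / norm (x - y)\<close> takes the
  value \<open>0\<close> but the Gaussian superposition diverges, is a null set in \<open>y\<close> for each \<open>x\<close>;
  finiteness of the result makes the inner integral finite for almost every \<open>x\<close>, so that the
  iterated Bochner integrals in the definition agree with the nonnegative ones.
\<close>

lemma Delta_eq_integral:
  assumes "\<alpha> > 0"
  shows "Delta \<alpha> = (\<integral>s. box_profile \<alpha> s \<partial>lborel)"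
proof -
  let ?B = "indicator (box_D \<alpha>) :: real ^ 3 \<Rightarrow> real"
  let ?K = "\<lambda>x y (s :: real). ennreal (?B x * ?B y * exp (- s\<^sup>2 * (norm (x - y))\<^sup>2) / sqrt pi)"
  define I where "I x = (\<integral>\<^sup>+y. ennreal (?B x * ?B y * (1 / norm (x - y))) \<partial>lborel)"
    for x :: "real ^ 3"
  have [measurable]: "I \<in> borel_measurable borel" unfolding I_def by measurable
  have "I x = (\<integral>\<^sup>+y. \<integral>\<^sup>+s. (?K x y s) \<partial>lborel \<partial>lborel)" for x
    unfolding I_def
  proof (intro nn_integral_cong_AE)
    have "AE y in lborel. y \<noteq> x" by (rule AE_lborel_singleton)
    then show "AE y in lborel. ennreal (?B x * ?B y * (1 / norm (x - y)))
        = (\<integral>\<^sup>+s. (?K x y s) \<partial>lborel)"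
    proof eventually_elim
      case (elim y)
      have "(\<integral>\<^sup>+s. (?K x y s) \<partial>lborel)
        = (\<integral>\<^sup>+s. ennreal (?B x * ?B y) * ennreal (exp (- s\<^sup>2 * (norm (x - y))\<^sup>2) / sqrt pi)
          \<partial>lborel)"
        by (intro nn_integral_cong) (simp add: ennreal_mult[symmetric])
      also have "\<dots> = ennreal (?B x * ?B y) * (\<integral>\<^sup>+s. ennreal
        (exp (- s\<^sup>2 * (norm (x - y))\<^sup>2) / sqrt pi) \<partial>lborel)"
        by (intro nn_integral_cmult) auto
      also have "\<dots> = ennreal (?B x * ?B y * (1 / norm (x - y)))"
        using elim by (subst inverse_norm_eq_Gaussian_integral) (auto simp: ennreal_mult[symmetric])
      finally show ?case by simp
    qed
  qed
  then have "(\<integral>\<^sup>+x. I x \<partial>lborel) = (\<integral>\<^sup>+x. \<integral>\<^sup>+y. \<integral>\<^sup>+s. (?K x y s) \<partial>lborel \<partial>lborel \<partial>lborel)"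
    by simp
  also have "\<dots> = (\<integral>\<^sup>+x. \<integral>\<^sup>+s. \<integral>\<^sup>+y. (?K x y s) \<partial>lborel \<partial>lborel \<partial>lborel)"
    by (intro nn_integral_cong lborel_pair.Fubini') measurable
  also have "\<dots> = (\<integral>\<^sup>+s. \<integral>\<^sup>+x. \<integral>\<^sup>+y. (?K x y s) \<partial>lborel \<partial>lborel \<partial>lborel)"
    by (intro lborel_pair.Fubini') measurable
  also have "\<dots> = (\<integral>\<^sup>+s. ennreal (box_profile \<alpha> s) \<partial>lborel)"
  proof (rule nn_integral_cong_AE)
    show "AE s in lborel. (\<integral>\<^sup>+x. \<integral>\<^sup>+y. (?K x y s) \<partial>lborel \<partial>lborel)
        = ennreal (box_profile \<alpha> s)"
      using AE_lborel_singleton[of "0::real"]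
      by eventually_elim (rule box_Gaussian_self_energy[OF assms])
  qed
  also have "\<dots> = ennreal (\<integral>s. box_profile \<alpha> s \<partial>lborel)"
    using integrable_box_profile[OF assms] box_profile_nonneg[OF assms]
      by (intro nn_integral_eq_integral) auto
  finally have J: "(\<integral>\<^sup>+x. I x \<partial>lborel) = ennreal (\<integral>s. box_profile \<alpha> s \<partial>lborel)" .
  define F where "F x = (\<integral>y. ?B x * ?B y * (1 / norm (x - y)) \<partial>lborel)" for x
  have F: "F x = enn2real (I x)" for x
    unfolding F_def I_def by (intro integral_eq_nn_integral) auto
  have "AE x in lborel. I x \<noteq> \<infinity>"
    by (rule nn_integral_PInf_AE) (simp_all add: J)
  then have "(\<integral>\<^sup>+x. ennreal (F x) \<partial>lborel) = (\<integral>\<^sup>+x. I x \<partial>lborel)"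
    by (intro nn_integral_cong_AE) (auto elim!: eventually_mono simp: F top.not_eq_extremum)
  moreover have "Delta \<alpha> = (\<integral>x. F x \<partial>lborel)"
  proof -
    have "F x = ?B x * (\<integral>y. ?B y * (1 / norm (x - y)) \<partial>lborel)" for x
      unfolding F_def mult.assoc by (rule Bochner_Integration.integral_mult_right_zero)
    then show ?thesis by (simp add: Delta_def set_lebesgue_integral_def)
  qed
  moreover have "(\<integral>x. F x \<partial>lborel) = enn2real (\<integral>\<^sup>+x. ennreal (F x) \<partial>lborel)"
    unfolding F by (intro integral_eq_nn_integral) auto
  ultimately show ?thesis
    using J box_profile_nonneg[OF assms] by (simp add: enn2real_ennreal)
qed

lemma integral_pos_AE:
  fixes f :: "real \<Rightarrow> real"
  assumes "integrable lborel f" "\<And>s. s \<noteq> 0 \<Longrightarrow> 0 < f s"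
  shows "0 < (\<integral>s. f s \<partial>lborel)"
proof -
  have nz: "AE s in lborel. s \<noteq> (0::real)" by (rule AE_lborel_singleton)
  have nn: "AE s in lborel. 0 \<le> f s" using nz
    by eventually_elim (use assms in \<open>auto intro: less_imp_le\<close>)
  have "(\<integral>s. f s \<partial>lborel) \<noteq> 0"
  proof
    assume "(\<integral>s. f s \<partial>lborel) = 0"
    then have "AE s in lborel. f s = 0" using integral_nonneg_eq_0_iff_AE[OF assms(1) nn] by simp
    with nz have "AE s in (lborel :: real measure). False"
      by eventually_elim (metis assms(2) less_irrefl)
    then show False using AE_iff_measurable[of UNIV "lborel :: real measure" "\<lambda>_. False"] by simp
  qed
  moreover have "0 \<le> (\<integral>s. f s \<partial>lborel)" using nn by (rule integral_nonneg_AE)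
  ultimately show ?thesis by simp
qed

lemma Delta_pos: "\<alpha> > 0 \<Longrightarrow> 0 < Delta \<alpha>"
  unfolding Delta_eq_integral by (intro integral_pos_AE integrable_box_profile box_profile_pos)

lemma Delta_less_cube:
  assumes "\<alpha> > 0" "\<alpha> \<noteq> 1"
  shows "Delta \<alpha> < Delta 1"
proof -
  have "0 < (\<integral>s. box_profile 1 s - box_profile \<alpha> s \<partial>lborel)"
    using assms box_profile_less[OF assms]
    by (intro integral_pos_AE Bochner_Integration.integrable_diff integrable_box_profile) auto
  then show ?thesis
    using assms by (simp add: Delta_eq_integral Bochner_Integration.integral_diff
      integrable_box_profile)
qed

section \<open>Orthonormal series of square-integrable functions\<close>

definition L2_function :: "'a measure \<Rightarrow> ('a \<Rightarrow> complex) \<Rightarrow> bool" where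
  "L2_function M f \<longleftrightarrow> f \<in> borel_measurable M \<and> integrable M (\<lambda>x. (norm (f x))\<^sup>2)"

text \<open>
  Linear in the second argument, in agreement with \<open>L2_inner\<close>.
\<close>

definition L2_ip :: "'a measure \<Rightarrow> ('a \<Rightarrow> complex) \<Rightarrow> ('a \<Rightarrow> complex) \<Rightarrow> complex" where
  "L2_ip M f h = (\<integral>x. cnj (f x) * h x \<partial>M)"

abbreviation sqnorm :: "'a measure \<Rightarrow> ('a \<Rightarrow> complex) \<Rightarrow> real" where
  "sqnorm M f \<equiv> (\<integral>x. (norm (f x))\<^sup>2 \<partial>M)"

lemma L2_function_measurable [measurable_dest]: "L2_function M f \<Longrightarrow> f \<in> borel_measurable M"
  by (simp add: L2_function_def)

lemma L2_function_integrable: "L2_function M f \<Longrightarrow> integrable M (\<lambda>x. (norm (f x))\<^sup>2)"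
  by (simp add: L2_function_def)

lemma integrable_L2_ip:
  assumes "L2_function M f" "L2_function M h"
  shows "integrable M (\<lambda>x. cnj (f x) * h x)"
proof (rule Bochner_Integration.integrable_bound)
  show "integrable M (\<lambda>x. (norm (f x))\<^sup>2 + (norm (h x))\<^sup>2)"
    using assms by (simp add: L2_function_integrable)
  have [measurable]: "f \<in> borel_measurable M" "h \<in> borel_measurable M"
    using assms by (auto simp: L2_function_def)
  show "(\<lambda>x. cnj (f x) * h x) \<in> borel_measurable M"
    by (intro borel_measurable_times borel_measurable_continuous_on[of cnj] continuous_intros) auto
  show "AE x in M. norm (cnj (f x) * h x) \<le> norm ((norm (f x))\<^sup>2 + (norm (h x))\<^sup>2)"
  proof (intro AE_I2)
    fix x
    have "2 * norm (f x) * norm (h x) \<le> (norm (f x))\<^sup>2 + (norm (h x))\<^sup>2"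
      by (rule sum_squares_bound)
    moreover have "0 \<le> norm (f x) * norm (h x)" by simp
    ultimately have "norm (f x) * norm (h x) \<le> (norm (f x))\<^sup>2 + (norm (h x))\<^sup>2" by linarith
    then show "norm (cnj (f x) * h x) \<le> norm ((norm (f x))\<^sup>2 + (norm (h x))\<^sup>2)"
      by (simp add: norm_mult)
  qed
qed

lemma L2_function_add:
  assumes "L2_function M f" "L2_function M h"
  shows "L2_function M (\<lambda>x. f x + h x)"
  unfolding L2_function_def
proof
  show "(\<lambda>x. f x + h x) \<in> borel_measurable M" using assms by measurable
  show "integrable M (\<lambda>x. (norm (f x + h x))\<^sup>2)"
  proof (rule Bochner_Integration.integrable_bound)
    show "integrable M (\<lambda>x. 2 * (norm (f x))\<^sup>2 + 2 * (norm (h x))\<^sup>2)"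
      using assms by (simp add: L2_function_integrable)
    show "(\<lambda>x. (norm (f x + h x))\<^sup>2) \<in> borel_measurable M"
      using assms by measurable
    show "AE x in M. norm ((norm (f x + h x))\<^sup>2) \<le> norm (2 * (norm (f x))\<^sup>2 + 2 * (norm (h x))\<^sup>2)"
    proof (intro AE_I2)
      fix x
      have "(norm (f x + h x))\<^sup>2 \<le> (norm (f x) + norm (h x))\<^sup>2"
        by (intro power_mono norm_triangle_ineq) auto
      also have "\<dots> \<le> 2 * (norm (f x))\<^sup>2 + 2 * (norm (h x))\<^sup>2"
        using sum_squares_bound[of "norm (f x)" "norm (h x)"] by (simp add: power2_sum)
      finally show "norm ((norm (f x + h x))\<^sup>2) \<le> norm (2 * (norm (f x))\<^sup>2 + 2 * (norm (h x))\<^sup>2)"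
        by simp
    qed
  qed
qed

lemma L2_function_scale: "L2_function M f \<Longrightarrow> L2_function M (\<lambda>x. c * f x)"
  by (auto simp: L2_function_def norm_mult power_mult_distrib)

lemma L2_function_diff:
  assumes "L2_function M f" "L2_function M h"
  shows "L2_function M (\<lambda>x. f x - h x)"
  using L2_function_add[OF assms(1) L2_function_scale[OF assms(2), of "-1"]] by simp

lemma L2_function_sum:
  "finite F \<Longrightarrow> (\<And>j. j \<in> F \<Longrightarrow> L2_function M (u j)) \<Longrightarrow> L2_function M (\<lambda>x. \<Sum>j\<in>F. b j * u j x)"
proof (induction F rule: finite_induct)
  case empty
  then show ?case by (simp add: L2_function_def)
next
  case (insert j F)
  then show ?case by (auto intro!: L2_function_add L2_function_scale)
qed

lemma L2_ip_self: "L2_ip M f f = of_real (sqnorm M f)"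
proof -
  have "L2_ip M f f = (\<integral>x. complex_of_real ((norm (f x))\<^sup>2) \<partial>M)"
    unfolding L2_ip_def by (intro Bochner_Integration.integral_cong refl)
      (metis complex_norm_square mult.commute)
  then show ?thesis by (simp only: integral_complex_of_real)
qed

lemma L2_ip_diff_left:
  assumes "L2_function M f" "L2_function M g" "L2_function M h"
  shows "L2_ip M (\<lambda>x. f x - g x) h = L2_ip M f h - L2_ip M g h"
  using integrable_L2_ip[OF assms(1,3)] integrable_L2_ip[OF assms(2,3)]
  by (simp add: L2_ip_def algebra_simps)

lemma L2_ip_scale_right: "L2_ip M f (\<lambda>x. c * h x) = c * L2_ip M f h"
  by (simp add: L2_ip_def mult.left_commute)

lemma L2_ip_sum_left:
  assumes "finite F" "\<And>j. j \<in> F \<Longrightarrow> L2_function M (u j)" "L2_function M h"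
  shows "L2_ip M (\<lambda>x. \<Sum>j\<in>F. b j * u j x) h = (\<Sum>j\<in>F. cnj (b j) * L2_ip M (u j) h)"
proof -
  have "L2_ip M (\<lambda>x. \<Sum>j\<in>F. b j * u j x) h = (\<integral>x. (\<Sum>j\<in>F. cnj (b j) * (cnj (u j x) * h x)) \<partial>M)"
    unfolding L2_ip_def by (intro Bochner_Integration.integral_cong refl)
      (simp add: sum_distrib_right mult.assoc)
  also have "\<dots> = (\<Sum>j\<in>F. \<integral>x. cnj (b j) * (cnj (u j x) * h x) \<partial>M)"
    using assms by (intro Bochner_Integration.integral_sum integrable_mult_right integrable_L2_ip)
      auto
  finally show ?thesis by (simp add: L2_ip_def)
qed

lemma L2_ip_commute: "L2_ip M f h = cnj (L2_ip M h f)"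
proof -
  have "cnj (L2_ip M h f) = (\<integral>x. cnj (cnj (h x) * f x) \<partial>M)"
    unfolding L2_ip_def by (rule Bochner_Integration.integral_cnj[symmetric])
  then show ?thesis by (simp add: L2_ip_def mult.commute)
qed

text \<open>
  From the Cauchy--Schwarz inequality for nonnegative functions, applied to the absolute values.
\<close>

lemma L2_ip_Cauchy_Schwarz:
  assumes "L2_function M f" "L2_function M h"
  shows "(norm (L2_ip M f h))\<^sup>2 \<le> sqnorm M f * sqnorm M h"
proof -
  have [measurable]: "f \<in> borel_measurable M" "h \<in> borel_measurable M"
    using assms by auto
  have i: "integrable M (\<lambda>x. norm (f x) * norm (h x))"
    using integrable_norm[OF integrable_L2_ip[OF assms]] by (simp add: norm_mult)
  have n: "norm (L2_ip M f h) \<le> (\<integral>x. norm (f x) * norm (h x) \<partial>M)"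
    unfolding L2_ip_def using integral_norm_bound[of M "\<lambda>x. cnj (f x) * h x"]
      by (simp add: norm_mult)
  have "ennreal ((\<integral>x. norm (f x) * norm (h x) \<partial>M)\<^sup>2)
      = (\<integral>\<^sup>+x. ennreal (norm (f x)) * ennreal (norm (h x)) \<partial>M)\<^sup>2"
    using nn_integral_eq_integral[OF i] by (simp add: ennreal_power ennreal_mult'')
  also have "\<dots> \<le> (\<integral>\<^sup>+x. (ennreal (norm (f x)))\<^sup>2 \<partial>M) * (\<integral>\<^sup>+x. (ennreal (norm (h x)))\<^sup>2 \<partial>M)"
    by (rule Cauchy_Schwarz_nn_integral) auto
  also have "\<dots> = ennreal (sqnorm M f) * ennreal (sqnorm M h)"
    using assms by (simp add: ennreal_power nn_integral_eq_integral L2_function_integrable)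
  also have "\<dots> = ennreal (sqnorm M f * sqnorm M h)"
    by (simp add: ennreal_mult'')
  finally have "(\<integral>x. norm (f x) * norm (h x) \<partial>M)\<^sup>2 \<le> sqnorm M f * sqnorm M h"
    by (subst (asm) ennreal_le_iff) auto
  moreover have "(norm (L2_ip M f h))\<^sup>2 \<le> (\<integral>x. norm (f x) * norm (h x) \<partial>M)\<^sup>2"
    using n by (intro power_mono) auto
  ultimately show ?thesis by linarith
qed

lemma sqnorm_diff:
  assumes "L2_function M f" "L2_function M h"
  shows "sqnorm M (\<lambda>x. f x - h x) = sqnorm M f + sqnorm M h - 2 * Re (L2_ip M h f)"
proof -
  have e: "(norm (f x - h x))\<^sup>2 = (norm (f x))\<^sup>2 + (norm (h x))\<^sup>2 - 2 * Re (cnj (h x) * f x)" for x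
    unfolding cmod_power2 by (simp add: power2_eq_square algebra_simps)
  have "integrable M (\<lambda>x. Re (cnj (h x) * f x))"
    using integrable_L2_ip[OF assms(2,1)] by (rule integrable_Re)
  then show ?thesis
    unfolding e using assms integrable_L2_ip[OF assms(2,1)]
    by (simp add: L2_function_integrable L2_ip_def del: complex_cnj_mult times_complex.sel)
qed

definition orthonormal :: "'a measure \<Rightarrow> ('i \<Rightarrow> 'a \<Rightarrow> complex) \<Rightarrow> 'i set \<Rightarrow> bool" where
  "orthonormal M u J \<longleftrightarrow> (\<forall>j\<in>J. L2_function M (u j)) \<and>
     (\<forall>i\<in>J. \<forall>j\<in>J. L2_ip M (u i) (u j) = of_bool (i = j))"

lemma orthonormal_sqnorm_sum:
  assumes "orthonormal M u J" "finite F" "F \<subseteq> J"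
  shows "sqnorm M (\<lambda>x. \<Sum>j\<in>F. b j * u j x) = (\<Sum>j\<in>F. (norm (b j))\<^sup>2)"
proof -
  let ?g = "\<lambda>x. \<Sum>j\<in>F. b j * u j x"
  have L: "L2_function M (u j)" if "j \<in> F" for j
    using assms that by (auto simp: orthonormal_def)
  have Lg: "L2_function M ?g"
    using assms L by (intro L2_function_sum) auto
  have ug: "L2_ip M (u j) ?g = b j" if "j \<in> F" for j
  proof -
    have "L2_ip M ?g (u j) = (\<Sum>i\<in>F. cnj (b i) * L2_ip M (u i) (u j))"
      using assms L that by (intro L2_ip_sum_left) auto
    also have "\<dots> = (\<Sum>i\<in>F. if i = j then cnj (b i) else 0)"
      using assms that by (intro sum.cong refl) (auto simp: orthonormal_def subset_eq)
    also have "\<dots> = cnj (b j)" using assms that by simp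
    finally show ?thesis by (subst L2_ip_commute) simp
  qed
  have "complex_of_real (sqnorm M ?g) = (\<Sum>j\<in>F. cnj (b j) * L2_ip M (u j) ?g)"
    unfolding L2_ip_self[symmetric] using assms L Lg by (intro L2_ip_sum_left) auto
  also have "\<dots> = (\<Sum>j\<in>F. of_real ((norm (b j))\<^sup>2))"
    by (intro sum.cong refl) (metis ug complex_norm_square mult.commute)
  also have "\<dots> = of_real (\<Sum>j\<in>F. (norm (b j))\<^sup>2)" by simp
  finally show ?thesis by (simp only: of_real_eq_iff)
qed

text \<open>
  The squared distance of \<open>f\<close> to its projection on the span of the \<open>u j\<close> with \<open>j \<in> F\<close> is
  nonnegative.
\<close>

lemma Bessel_inequality:
  assumes "orthonormal M u J" "finite F" "F \<subseteq> J" "L2_function M f"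
  shows "(\<Sum>j\<in>F. (norm (L2_ip M (u j) f))\<^sup>2) \<le> sqnorm M f"
proof -
  define c where "c = (\<lambda>j. L2_ip M (u j) f)"
  let ?g = "\<lambda>x. \<Sum>j\<in>F. c j * u j x"
  have L: "L2_function M (u j)" if "j \<in> F" for j
    using assms that by (auto simp: orthonormal_def)
  have Lg: "L2_function M ?g"
    using assms L by (intro L2_function_sum) auto
  have "L2_ip M ?g f = (\<Sum>j\<in>F. cnj (c j) * c j)"
    using assms L unfolding c_def by (intro L2_ip_sum_left[where h=f]) auto
  also have "\<dots> = (\<Sum>j\<in>F. of_real ((norm (c j))\<^sup>2))"
    by (intro sum.cong refl) (metis complex_norm_square mult.commute)
  also have "\<dots> = of_real (\<Sum>j\<in>F. (norm (c j))\<^sup>2)" by simp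
  finally have "Re (L2_ip M ?g f) = (\<Sum>j\<in>F. (norm (c j))\<^sup>2)" by simp
  moreover have "sqnorm M ?g = (\<Sum>j\<in>F. (norm (c j))\<^sup>2)"
    using assms(1-3) by (rule orthonormal_sqnorm_sum)
  moreover have "0 \<le> sqnorm M (\<lambda>x. f x - ?g x)" by simp
  ultimately show ?thesis
    using sqnorm_diff[OF assms(4) Lg] unfolding c_def by linarith
qed

lemma Bessel_summable:
  assumes "orthonormal M u J" "L2_function M f"
  shows "(\<lambda>j. (norm (L2_ip M (u j) f))\<^sup>2) summable_on J"
  using Bessel_inequality[OF assms(1) _ _ assms(2)]
  by (intro nonneg_bdd_above_summable_on) (auto simp: bdd_above_def)

text \<open>
  The function \<open>f\<close> is the sum of the \<open>b j * u j\<close> in quadratic mean, along the net of finite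
  subsets of \<open>J\<close>.
\<close>

definition L2_series :: "'a measure \<Rightarrow> ('i \<Rightarrow> 'a \<Rightarrow> complex) \<Rightarrow> 'i set \<Rightarrow> ('i \<Rightarrow> complex) \<Rightarrow> ('a \<Rightarrow> complex)
  \<Rightarrow> bool" where
  "L2_series M u J b f \<longleftrightarrow> L2_function M f \<and>
     ((\<lambda>F. sqnorm M (\<lambda>x. f x - (\<Sum>j\<in>F. b j * u j x))) \<longlongrightarrow> 0) (finite_subsets_at_top J)"

text \<open>
  By the Cauchy--Schwarz inequality the inner product with \<open>h\<close> is continuous in quadratic mean,
  so it may be taken term by term. With \<open>h = u i\<close> this identifies the coefficients, and with
  another series for \<open>h\<close> it is Parseval's identity.
\<close>

lemma L2_series_ip:
  assumes "orthonormal M u J" "L2_series M u J b f" "L2_function M h"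
  shows "((\<lambda>j. cnj (b j) * L2_ip M (u j) h) has_sum L2_ip M f h) J"
proof -
  let ?g = "\<lambda>F x. \<Sum>j\<in>F. b j * u j x"
  have Lf: "L2_function M f"
    and lim: "((\<lambda>F. sqnorm M (\<lambda>x. f x - ?g F x)) \<longlongrightarrow> 0) (finite_subsets_at_top J)"
    using assms(2) by (auto simp: L2_series_def)
  have L: "L2_function M (u j)" if "j \<in> J" for j
    using assms that by (auto simp: orthonormal_def)
  have Lg: "L2_function M (?g F)" if "finite F" "F \<subseteq> J" for F
    using that L by (intro L2_function_sum) auto
  have "((\<lambda>F. (norm ((\<Sum>j\<in>F. cnj (b j) * L2_ip M (u j) h) - L2_ip M f h))\<^sup>2) \<longlongrightarrow> 0)
    (finite_subsets_at_top J)"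
  proof (rule tendsto_sandwich[OF _ _ tendsto_const])
    show "((\<lambda>F. sqnorm M (\<lambda>x. f x - ?g F x) * sqnorm M h) \<longlongrightarrow> 0) (finite_subsets_at_top J)"
      using tendsto_mult_right[OF lim, of "sqnorm M h"] by simp
    show "\<forall>\<^sub>F F in finite_subsets_at_top J. (norm
      ((\<Sum>j\<in>F. cnj (b j) * L2_ip M (u j) h) - L2_ip M f h))\<^sup>2
        \<le> sqnorm M (\<lambda>x. f x - ?g F x) * sqnorm M h"
    proof (intro eventually_finite_subsets_at_top_weakI)
      fix F assume F: "finite F" "F \<subseteq> J"
      have "L2_ip M (?g F) h = (\<Sum>j\<in>F. cnj (b j) * L2_ip M (u j) h)"
        using F L assms(3) by (intro L2_ip_sum_left) auto
      then have "norm ((\<Sum>j\<in>F. cnj (b j) * L2_ip M (u j) h) - L2_ip M f h)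
        = norm (L2_ip M (\<lambda>x. f x - ?g F x) h)"
        using L2_ip_diff_left[OF Lf Lg[OF F] assms(3)] by (simp add: norm_minus_commute)
      then show "(norm ((\<Sum>j\<in>F. cnj (b j) * L2_ip M (u j) h) - L2_ip M f h))\<^sup>2
        \<le> sqnorm M (\<lambda>x. f x - ?g F x) * sqnorm M h"
        using L2_ip_Cauchy_Schwarz[OF L2_function_diff[OF Lf Lg[OF F]] assms(3)] by simp
    qed
  qed simp
  then have "((\<lambda>F. sqrt ((norm ((\<Sum>j\<in>F. cnj (b j) * L2_ip M (u j) h) - L2_ip M f h))\<^sup>2)) \<longlongrightarrow> sqrt 0)
     (finite_subsets_at_top J)"
    by (rule tendsto_real_sqrt)
  then show ?thesis
    unfolding has_sum_def by (subst LIM_zero_iff[symmetric], subst tendsto_norm_zero_iff[symmetric])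
      simp
qed

lemma L2_series_coefficient:
  assumes "orthonormal M u J" "L2_series M u J b f" "i \<in> J"
  shows "L2_ip M (u i) f = b i"
proof -
  have "((\<lambda>j. cnj (b j) * L2_ip M (u j) (u i)) has_sum L2_ip M f (u i)) J"
    using assms by (intro L2_series_ip) (auto simp: orthonormal_def)
  also have "?this \<longleftrightarrow> ((\<lambda>j. if j = i then cnj (b i) else 0) has_sum L2_ip M f (u i)) J"
    using assms by (intro has_sum_cong) (auto simp: orthonormal_def)
  finally have "((\<lambda>j. if j = i then cnj (b i) else 0) has_sum L2_ip M f (u i)) J" .
  moreover have "((\<lambda>j. if j = i then cnj (b i) else 0) has_sum cnj (b i)) J"
    using assms(3) by (intro has_sum_finite_neutralI[of "{i}"]) auto
  ultimately have "L2_ip M f (u i) = cnj (b i)" by (rule has_sum_unique)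
  then show ?thesis by (subst L2_ip_commute) simp
qed

lemma L2_series_square_summable:
  assumes "orthonormal M u J" "L2_series M u J b f"
  shows "(\<lambda>j. (norm (b j))\<^sup>2) summable_on J"
proof -
  have "(\<lambda>j. (norm (L2_ip M (u j) f))\<^sup>2) summable_on J"
    using assms by (intro Bessel_summable) (auto simp: L2_series_def)
  then show ?thesis
    by (rule summable_on_cong[THEN iffD1, rotated]) (simp add: L2_series_coefficient[OF assms])
qed

lemma summable_on_small_tail:
  fixes f :: "'i \<Rightarrow> real"
  assumes "f summable_on J" "\<And>j. j \<in> J \<Longrightarrow> 0 \<le> f j" "e > 0"
  shows "\<exists>F. finite F \<and> F \<subseteq> J \<and> (\<forall>G. finite G \<longrightarrow> G \<subseteq> J \<longrightarrow> G \<inter> F = {} \<longrightarrow> sum f G \<le> e)"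
proof -
  have s: "(f has_sum infsum f J) J" using assms by simp
  then have "\<forall>\<^sub>F F in finite_subsets_at_top J. infsum f J - e < sum f F"
    unfolding has_sum_def using assms(3) by (intro order_tendstoD(1)) auto
  then obtain F where F: "finite F" "F \<subseteq> J" "infsum f J - e < sum f F"
    unfolding eventually_finite_subsets_at_top by blast
  have "sum f G \<le> e" if G: "finite G" "G \<subseteq> J" "G \<inter> F = {}" for G
  proof -
    have "sum f (F \<union> G) \<le> infsum f J"
      using F G assms by (intro finite_sum_le_infsum) auto
    moreover have "sum f (F \<union> G) = sum f F + sum f G"
      using F G by (intro sum.union_disjoint) auto
    ultimately show ?thesis using F by linarith
  qed
  then show ?thesis using F by blast
qed

text \<open>
  Finite index sets \<open>H k\<close> are chosen with tails so small that the partial sums over them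
  converge almost everywhere; Fatou's lemma then bounds the distance of the pointwise limit to
  any larger partial sum by the tail.
\<close>

lemma Riesz_Fischer:
  assumes on: "orthonormal M u J" and b: "(\<lambda>j. (norm (b j))\<^sup>2) summable_on J"
  shows "\<exists>f. L2_series M u J b f"
proof -
  let ?g = "\<lambda>F x. \<Sum>j\<in>F. b j * u j x"
  have L: "L2_function M (u j)" if "j \<in> J" for j
    using on that by (auto simp: orthonormal_def)
  have Lg: "L2_function M (?g F)" if "finite F" "F \<subseteq> J" for F
    using that L by (intro L2_function_sum) auto
  \<comment> \<open>Tails of size \<open>(1/8)^k\<close> remain summable after multiplication by the weights \<open>2^k\<close> used
    below.\<close>
  have "\<forall>k. \<exists>F. finite F \<and> F \<subseteq> J \<and>
      (\<forall>G. finite G \<longrightarrow> G \<subseteq> J \<longrightarrow> G \<inter> F = {} \<longrightarrow> (\<Sum>j\<in>G. (norm (b j))\<^sup>2) \<le> (1/8)^k)"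
    using summable_on_small_tail[OF b] by simp
  then obtain F where F: "\<And>k. finite (F k)" "\<And>k. F k \<subseteq> J"
    "\<And>k G. finite G \<Longrightarrow> G \<subseteq> J \<Longrightarrow> G \<inter> F k = {} \<Longrightarrow> (\<Sum>j\<in>G. (norm (b j))\<^sup>2) \<le> (1/8)^k"
    by metis
  define H where "H k = (\<Union>i\<le>k. F i)" for k :: nat
  have H: "finite (H k)" "H k \<subseteq> J" "m \<le> k \<Longrightarrow> H m \<subseteq> H k" "F k \<subseteq> H k" for k m
    using F unfolding H_def by (auto intro: order_trans)
  define S where "S k = ?g (H k)" for k
  have LS: "L2_function M (S k)" for k unfolding S_def by (rule Lg) (rule H)+
  \<comment> \<open>Two partial sums differ by a sum over the symmetric difference of their index sets, which
    avoids \<open>H m\<close>.\<close>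
  have near: "sqnorm M (\<lambda>x. ?g A x - ?g B x) \<le> (1/8)^m"
    if A: "finite A" "A \<subseteq> J" "H m \<subseteq> A" and B: "finite B" "B \<subseteq> J" "H m \<subseteq> B" for A B m
  proof -
    define D where "D = (A - B) \<union> (B - A)"
    define b' where "b' j = (if j \<in> A then b j else - b j)" for j
    have "?g A x - ?g B x = (\<Sum>j\<in>D. b' j * u j x)" for x
    proof -
      have "?g A x = ?g (A - B) x + ?g (A \<inter> B) x"
        using A by (subst sum.union_disjoint[symmetric]) (auto intro!: sum.cong)
      moreover have "?g B x = ?g (B - A) x + ?g (A \<inter> B) x"
        using B by (subst sum.union_disjoint[symmetric]) (auto intro!: sum.cong)
      moreover have "(\<Sum>j\<in>D. b' j * u j x) = (\<Sum>j\<in>A - B. b' j * u j x) + (\<Sum>j\<in>B - A. b' j * u j x)"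
        unfolding D_def using A B by (intro sum.union_disjoint) auto
      moreover have "(\<Sum>j\<in>A - B. b' j * u j x) = ?g (A - B) x"
        by (intro sum.cong) (auto simp: b'_def)
      moreover have "(\<Sum>j\<in>B - A. b' j * u j x) = - ?g (B - A) x"
        by (subst sum_negf[symmetric], intro sum.cong) (auto simp: b'_def)
      ultimately show ?thesis by simp
    qed
    then have "sqnorm M (\<lambda>x. ?g A x - ?g B x) = (\<Sum>j\<in>D. (norm (b' j))\<^sup>2)"
      using orthonormal_sqnorm_sum[OF on, of D b'] A B by (simp add: D_def Un_least subset_iff)
    also have "\<dots> = (\<Sum>j\<in>D. (norm (b j))\<^sup>2)"
      by (intro sum.cong) (auto simp: b'_def)
    also have "\<dots> \<le> (1/8)^m"
      using A B H(4)[of m] by (intro F) (auto simp: D_def)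
    finally show ?thesis .
  qed
  define d where "d k x = S (Suc k) x - S k x" for k x
  have Ld: "L2_function M (d k)" for k
    unfolding d_def by (intro L2_function_diff LS)
  have d_meas [measurable]: "d k \<in> borel_measurable M" for k using Ld
    by (auto simp: L2_function_def)
  have S_meas [measurable]: "S k \<in> borel_measurable M" for k using LS
    by (auto simp: L2_function_def)
  have d_small: "sqnorm M (d k) \<le> (1/8)^k" for k
    unfolding d_def S_def using H by (intro near) auto
  have "(\<integral>\<^sup>+x. (\<Sum>k. ennreal (2^k * (norm (d k x))\<^sup>2)) \<partial>M)
    = (\<Sum>k. \<integral>\<^sup>+x. ennreal (2^k * (norm (d k x))\<^sup>2) \<partial>M)"
    by (intro nn_integral_suminf) measurable
  also have "\<dots> \<le> (\<Sum>k. ennreal ((1/4)^k))"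
  proof (intro suminf_le)
    fix k
    have "(\<integral>\<^sup>+x. ennreal (2^k * (norm (d k x))\<^sup>2) \<partial>M) = ennreal (2^k * sqnorm M (d k))"
      using Ld[of k] by (subst nn_integral_eq_integral) (auto simp: L2_function_def)
    also have "\<dots> \<le> ennreal (2^k * (1/8)^k)"
      by (intro ennreal_leI mult_left_mono d_small) auto
    also have "2^k * (1/8::real)^k = (1/4)^k"
      by (simp flip: power_mult_distrib)
    finally show "(\<integral>\<^sup>+x. ennreal (2^k * (norm (d k x))\<^sup>2) \<partial>M) \<le> ennreal ((1/4)^k)" .
  qed auto
  also have "\<dots> = ennreal (\<Sum>k. (1/4)^k)"
    by (intro suminf_ennreal2 summable_geometric) auto
  finally have fin: "(\<integral>\<^sup>+x. (\<Sum>k. ennreal (2^k * (norm (d k x))\<^sup>2)) \<partial>M) \<noteq> \<infinity>"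
    by (auto simp: top_unique)
  have "AE x in M. (\<Sum>k. ennreal (2^k * (norm (d k x))\<^sup>2)) \<noteq> \<infinity>"
    by (rule nn_integral_PInf_AE[OF _ fin]) measurable
  then have conv: "AE x in M. convergent (\<lambda>k. S k x)"
  proof eventually_elim
    case (elim x)
    have sq: "summable (\<lambda>k. 2^k * (norm (d k x))\<^sup>2)"
      using elim by (intro summable_suminf_not_top) auto
    have "summable (\<lambda>k. norm (d k x))"
    proof (rule summable_comparison_test)
      show "summable (\<lambda>k. (1/2)^k + 2^k * (norm (d k x))\<^sup>2)"
        by (intro summable_add sq summable_geometric) auto
      \<comment> \<open>Summability of the weighted squares passes to the absolute values: either
        \<open>norm (d k x) \<le> (1/2)^k\<close> or the weighted square dominates.\<close>
      have "norm (d k x) \<le> (1/2)^k + 2^k * (norm (d k x))\<^sup>2" for k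
      proof (cases "norm (d k x) \<le> (1/2)^k")
        case False
        then have "norm (d k x) * 1 \<le> norm (d k x) * (2^k * norm (d k x))"
          by (intro mult_left_mono) (auto simp: power_divide field_simps)
        moreover have "(0::real) \<le> (1/2)^k" by simp
        ultimately have "norm (d k x) \<le> (1/2)^k + norm (d k x) * (2^k * norm (d k x))" by linarith
        moreover have "2^k * (norm (d k x))\<^sup>2 = norm (d k x) * (2^k * norm (d k x))"
          unfolding power2_eq_square by (rule mult.left_commute)
        ultimately show ?thesis by linarith
      qed (simp add: add_increasing2)
      then show "\<exists>N. \<forall>n\<ge>N. norm (norm (d n x)) \<le> (1/2)^n + 2^n * (norm (d n x))\<^sup>2"
        by simp
    qed
    then have "summable (\<lambda>k. d k x)" by (rule summable_norm_cancel)
    then have "convergent (\<lambda>n. \<Sum>k<n. d k x)" by (simp add: summable_iff_convergent)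
    moreover have "(\<Sum>k<n. d k x) = S n x - S 0 x" for n
      unfolding d_def by (rule sum_lessThan_telescope)
    ultimately have "convergent (\<lambda>n. (S n x - S 0 x) + S 0 x)"
      by (intro convergent_add convergent_const) simp
    then show ?case by simp
  qed
  define f where "f x = lim (\<lambda>k. S k x)" for x
  have [measurable]: "f \<in> borel_measurable M"
    unfolding f_def by (rule borel_measurable_lim_metric) measurable
  have bound: "(\<integral>\<^sup>+x. ennreal ((norm (f x - ?g A x))\<^sup>2) \<partial>M) \<le> ennreal ((1/8)^m)"
    if A: "finite A" "A \<subseteq> J" "H m \<subseteq> A" for A m
  proof -
    have [measurable]: "?g A \<in> borel_measurable M" using Lg[OF A(1,2)]
      by (simp add: L2_function_def)
    have "(\<integral>\<^sup>+x. ennreal ((norm (f x - ?g A x))\<^sup>2) \<partial>M)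
        = (\<integral>\<^sup>+x. liminf (\<lambda>k. ennreal ((norm (S k x - ?g A x))\<^sup>2)) \<partial>M)"
    proof (rule nn_integral_cong_AE, use conv in eventually_elim)
      case (elim x)
      then have "(\<lambda>k. S k x) \<longlonglongrightarrow> f x" by (simp add: f_def convergent_LIMSEQ_iff)
      then have "(\<lambda>k. ennreal ((norm (S k x - ?g A x))\<^sup>2)) \<longlonglongrightarrow> ennreal ((norm (f x - ?g A x))\<^sup>2)"
        by (intro tendsto_ennrealI tendsto_intros)
      then show ?case by (intro lim_imp_Liminf[symmetric]) auto
    qed
    also have "\<dots> \<le> liminf (\<lambda>k. \<integral>\<^sup>+x. ennreal ((norm (S k x - ?g A x))\<^sup>2) \<partial>M)"
      by (rule nn_integral_liminf) measurable
    also have "\<dots> \<le> ennreal ((1/8)^m)"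
    proof (rule Liminf_le)
      have "(\<integral>\<^sup>+x. ennreal ((norm (S k x - ?g A x))\<^sup>2) \<partial>M) \<le> ennreal ((1/8)^m)" if "k \<ge> m" for k
      proof -
        have "(\<integral>\<^sup>+x. ennreal ((norm (S k x - ?g A x))\<^sup>2) \<partial>M)
          = ennreal (sqnorm M (\<lambda>x. S k x - ?g A x))"
          using L2_function_diff[OF LS Lg[OF A(1,2)], of k]
          by (subst nn_integral_eq_integral) (auto simp: L2_function_def)
        also have "\<dots> \<le> ennreal ((1/8)^m)"
          unfolding S_def using A H that by (intro ennreal_leI near) auto
        finally show ?thesis .
      qed
      then show "\<forall>\<^sub>F k in sequentially. (\<integral>\<^sup>+x. ennreal ((norm (S k x - ?g A x))\<^sup>2) \<partial>M)
        \<le> ennreal ((1/8)^m)"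
        by (auto simp: eventually_sequentially)
    qed simp
    finally show ?thesis .
  qed
  have Lfg: "L2_function M (\<lambda>x. f x - ?g A x)" and sq_small: "sqnorm M (\<lambda>x. f x - ?g A x) \<le> (1/8)^m"
    if A: "finite A" "A \<subseteq> J" "H m \<subseteq> A" for A m
  proof -
    have [measurable]: "?g A \<in> borel_measurable M" using Lg[OF A(1,2)]
      by (simp add: L2_function_def)
    have i: "integrable M (\<lambda>x. (norm (f x - ?g A x))\<^sup>2)"
      using bound[OF A] by (intro integrableI_bounded) (auto intro: le_less_trans)
    then show "L2_function M (\<lambda>x. f x - ?g A x)" by (simp add: L2_function_def)
    show "sqnorm M (\<lambda>x. f x - ?g A x) \<le> (1/8)^m"
      using bound[OF A] nn_integral_eq_integral[OF i] by simp
  qed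
  have "L2_function M f"
    using L2_function_add[OF Lfg[of "H 0" 0] Lg[of "H 0"]] H by simp
  moreover have "((\<lambda>A. sqnorm M (\<lambda>x. f x - ?g A x)) \<longlongrightarrow> 0) (finite_subsets_at_top J)"
  proof (rule order_tendstoI)
    fix e :: real assume "e > 0"
    then obtain m where m: "(1/8::real)^m < e"
      using real_arch_pow_inv[of e "1/8"] by auto
    have "sqnorm M (\<lambda>x. f x - ?g A x) < e" if "finite A" "A \<subseteq> J" "H m \<subseteq> A" for A
      using sq_small[OF that] m by linarith
    then show "\<forall>\<^sub>F A in finite_subsets_at_top J. sqnorm M (\<lambda>x. f x - ?g A x) < e"
      unfolding eventually_finite_subsets_at_top by (intro exI[of _ "H m"]) (simp add: H(1,2))
  qed (simp add: less_le_trans[OF _ Bochner_Integration.integral_nonneg])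
  ultimately show ?thesis unfolding L2_series_def by blast
qed

section \<open>Pointwise convergence of Fourier series\<close>

text \<open>
  The circle of circumference \<open>1\<close>. The half-open interval makes the translates by integers
  partition the line.
\<close>

definition unit_cell :: "real measure" where
  "unit_cell = restrict_space lborel {0..<1}"

definition fourier_mode :: "int \<Rightarrow> real \<Rightarrow> complex" where
  "fourier_mode k x = exp (\<i> * of_real (2 * pi * of_int k * x))"

lemma integral_unit_cell:
  fixes f :: "real \<Rightarrow> 'b::{banach, second_countable_topology}"
  shows "(\<integral>x. f x \<partial>unit_cell) = (\<integral>x. indicator {0..<1} x *\<^sub>R f x \<partial>lborel)"
  unfolding unit_cell_def by (subst integral_restrict_space) auto

lemma integrable_unit_cell:
  fixes f :: "real \<Rightarrow> 'b::{banach, second_countable_topology}"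
  shows "integrable unit_cell f \<longleftrightarrow> integrable lborel (\<lambda>x. indicator {0..<1} x *\<^sub>R f x)"
  unfolding unit_cell_def by (subst integrable_restrict_space) auto

lemma space_unit_cell: "space unit_cell = {0..<1}"
  by (simp add: unit_cell_def space_restrict_space)

lemma measurable_unit_cell: "f \<in> borel_measurable borel \<Longrightarrow> f \<in> borel_measurable unit_cell"
  unfolding unit_cell_def by (intro measurable_restrict_space1) auto

lemma finite_measure_unit_cell: "finite_measure unit_cell"
  by (rule finite_measureI)
    (simp add: space_unit_cell, simp add: unit_cell_def emeasure_restrict_space)

lemma measure_unit_cell [simp]: "measure unit_cell (space unit_cell) = 1"
  by (simp add: space_unit_cell) (simp add: unit_cell_def measure_def emeasure_restrict_space)

lemma integral_unit_cell_FTC: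
  fixes f F :: "real \<Rightarrow> complex"
  assumes "\<And>x. (F has_vector_derivative f x) (at x)" "continuous_on UNIV f"
  shows "(\<integral>x. f x \<partial>unit_cell) = F 1 - F 0"
proof -
  have "(\<integral>x. f x \<partial>unit_cell) = (\<integral>x. indicator {0..1} x *\<^sub>R f x \<partial>lborel)"
  proof -
    have [measurable]: "f \<in> borel_measurable borel"
      by (rule borel_measurable_continuous_onI) fact
    show ?thesis
      unfolding integral_unit_cell using AE_lborel_singleton[of "1::real"]
      by (intro integral_cong_AE) (measurable, auto elim!: eventually_mono split: split_indicator)
  qed
  also have "\<dots> = F 1 - F 0"
    using assms by (intro integral_FTC_atLeastAtMost)
      (auto intro: has_vector_derivative_at_within continuous_on_subset)
  finally show ?thesis .
qed

lemma fourier_mode_measurable [measurable]: "fourier_mode k \<in> borel_measurable borel"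
  unfolding fourier_mode_def by (intro borel_measurable_continuous_onI continuous_intros)

lemma norm_fourier_mode [simp]: "norm (fourier_mode k x) = 1"
  by (simp add: fourier_mode_def)

lemma fourier_mode_mult: "fourier_mode j x * fourier_mode k x = fourier_mode (j + k) x"
  by (simp add: fourier_mode_def exp_add[symmetric] algebra_simps)

lemma cnj_fourier_mode: "cnj (fourier_mode k x) = fourier_mode (- k) x"
  by (simp add: fourier_mode_def exp_cnj)

lemma fourier_mode_0 [simp]: "fourier_mode 0 x = 1"
  by (simp add: fourier_mode_def)

lemma fourier_mode_at_int: "fourier_mode k (of_int m) = 1"
proof -
  have "fourier_mode k (of_int m) = exp (2 * of_int (k * m) * of_real pi * \<i>)"
    by (simp add: fourier_mode_def mult_ac)
  then show ?thesis using exp_integer_2pi[OF Ints_of_int, of "k * m"] by simp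
qed

lemma fourier_mode_add_int: "fourier_mode k (x + of_int m) = fourier_mode k x"
proof -
  have "fourier_mode k (x + of_int m) = fourier_mode k x * fourier_mode k (of_int m)"
    by (simp add: fourier_mode_def exp_add[symmetric] algebra_simps)
  then show ?thesis by (simp add: fourier_mode_at_int)
qed

lemma L2_function_bounded:
  assumes "f \<in> borel_measurable unit_cell" "\<And>x. x \<in> {0..<1} \<Longrightarrow> norm (f x) \<le> B"
  shows "L2_function unit_cell f"
  unfolding L2_function_def
proof
  interpret finite_measure unit_cell by (rule finite_measure_unit_cell)
  show "integrable unit_cell (\<lambda>x. (norm (f x))\<^sup>2)"
    using assms by (intro integrable_const_bound[where B="B\<^sup>2"] AE_I2)
      (auto simp: space_unit_cell intro!: power_mono)
qed fact

lemma fourier_mode_deriv: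
  assumes "k \<noteq> 0"
  shows "((\<lambda>x. fourier_mode k x / (2 * pi * of_int k * \<i>)) has_vector_derivative fourier_mode k x)
    (at x)"
  unfolding fourier_mode_def using assms
  by (auto intro!: derivative_eq_intros has_vector_derivative_real_field simp: divide_simps)

lemma integral_fourier_mode: "(\<integral>x. fourier_mode k x \<partial>unit_cell) = of_bool (k = 0)"
proof (cases "k = 0")
  case True
  have "((\<lambda>x. complex_of_real x) has_vector_derivative 1) (at x)" for x
    by (rule has_vector_derivative_real_field) (rule DERIV_ident)
  then have "(\<integral>x. 1 \<partial>unit_cell) = complex_of_real 1 - complex_of_real 0"
    by (rule integral_unit_cell_FTC) simp
  moreover have "(\<integral>x. fourier_mode k x \<partial>unit_cell) = (\<integral>x. 1 \<partial>unit_cell)"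
    using True by (intro Bochner_Integration.integral_cong) auto
  ultimately show ?thesis using True by simp
next
  case False
  have "continuous_on UNIV (fourier_mode k)" unfolding fourier_mode_def by (intro continuous_intros)
  then show ?thesis
    using False fourier_mode_at_int[of k 1] fourier_mode_at_int[of k 0]
    by (subst integral_unit_cell_FTC[OF fourier_mode_deriv[OF False]]) auto
qed

lemma orthonormal_fourier_mode: "orthonormal unit_cell fourier_mode UNIV"
  unfolding orthonormal_def
proof (intro conjI ballI)
  show "L2_function unit_cell (fourier_mode j)" for j
    by (rule L2_function_bounded[where B=1]) (auto intro: measurable_unit_cell)
  show "L2_ip unit_cell (fourier_mode i) (fourier_mode j) = of_bool (i = j)" for i j
    by (simp add: L2_ip_def cnj_fourier_mode fourier_mode_mult integral_fourier_mode)
qed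

lemma sin_ge_third: "0 \<le> y \<Longrightarrow> y \<le> pi / 2 \<Longrightarrow> y / 3 \<le> sin y"
proof -
  assume y: "0 \<le> y" "y \<le> pi / 2"
  have "\<bar>sin y - (\<Sum>m<3. sin_coeff m * y ^ m)\<bar> \<le> inverse (fact 3) * \<bar>y\<bar> ^ 3"
    by (rule Maclaurin_sin_bound)
  then have "\<bar>sin y - y\<bar> \<le> y ^ 3 / 6"
    using y by (simp add: eval_nat_numeral sin_coeff_def)
  moreover have "y ^ 3 / 6 \<le> 2 * y / 3"
  proof -
    have "y * y \<le> 2 * 2" using y pi_less_4 by (intro mult_mono) auto
    then have "y * (y * y) \<le> y * 4" using y by (intro mult_left_mono) auto
    then show ?thesis by (simp add: power3_eq_cube)
  qed
  ultimately show ?thesis by linarith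
qed

text \<open>
  At the ends of the cell \<open>fourier_mode 1 - 1\<close> vanishes only to first order, so it can be
  divided out of a Lipschitz function.
\<close>

lemma norm_fourier_mode_minus_1:
  assumes "x \<in> {0..<1}"
  shows "2/3 * min x (1 - x) \<le> norm (fourier_mode 1 x - 1)"
proof -
  have "norm (fourier_mode 1 x - 1) = 2 * \<bar>sin (pi * x)\<bar>"
    using dist_exp_i_1[of "2 * pi * x"] by (simp add: fourier_mode_def)
  moreover have "min x (1 - x) / 3 \<le> sin (pi * x)"
  proof (cases "x \<le> 1/2")
    case True
    then have "pi * x / 3 \<le> sin (pi * x)" using assms by (intro sin_ge_third) auto
    moreover have "3 * x \<le> pi * x" using pi_gt3 assms by (intro mult_right_mono) auto
    ultimately show ?thesis using assms by (simp add: min_def split: if_splits)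
  next
    case False
    then have "pi * (1 - x) / 3 \<le> sin (pi * (1 - x))"
      using assms by (intro sin_ge_third) (auto simp: algebra_simps)
    moreover have "sin (pi * (1 - x)) = sin (pi * x)"
      by (simp add: algebra_simps sin_diff)
    moreover have "3 * (1 - x) \<le> pi * (1 - x)" using pi_gt3 assms by (intro mult_right_mono) auto
    ultimately show ?thesis using assms False by (simp add: min_def split: if_splits)
  qed
  ultimately show ?thesis by linarith
qed

text \<open>
  The Riemann--Lebesgue lemma for square-integrable functions, from Bessel's inequality.
\<close>

lemma Fourier_coefficients_tendsto_0:
  assumes "L2_function unit_cell h" "inj (g :: nat \<Rightarrow> int)"
  shows "(\<lambda>K. L2_ip unit_cell (fourier_mode (g K)) h) \<longlonglongrightarrow> 0"
proof -
  have "(\<lambda>k. (norm (L2_ip unit_cell (fourier_mode k) h))\<^sup>2) summable_on range g"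
    using Bessel_summable[OF orthonormal_fourier_mode assms(1)] by (rule summable_on_subset) auto
  then have "(\<lambda>K. (norm (L2_ip unit_cell (fourier_mode (g K)) h))\<^sup>2) summable_on UNIV"
    using summable_on_reindex[OF assms(2), of "\<lambda>k. (norm (L2_ip unit_cell (fourier_mode k) h))\<^sup>2"]
      by (simp add: o_def)
  then have "(\<lambda>K. (norm (L2_ip unit_cell (fourier_mode (g K)) h))\<^sup>2) \<longlonglongrightarrow> 0"
    by (intro summable_LIMSEQ_zero summable_on_imp_summable)
  then have "(\<lambda>K. sqrt ((norm (L2_ip unit_cell (fourier_mode (g K)) h))\<^sup>2)) \<longlonglongrightarrow> sqrt 0"
    by (rule tendsto_real_sqrt)
  then show ?thesis by (simp add: tendsto_norm_zero_iff)
qed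

lemma sum_symmetric_telescope:
  fixes g :: "int \<Rightarrow> complex"
  shows "(\<Sum>k\<in>{- int K..int K}. g (k - 1) - g k) = g (- int K - 1) - g (int K)"
proof (induction K)
  case (Suc K)
  have "{- int (Suc K)..int (Suc K)} = insert (- int (Suc K))
    (insert (int (Suc K)) {- int K..int K})"
    by auto
  then show ?case using Suc by (auto simp: algebra_simps intro: arg_cong[where f=g])
qed simp

text \<open>
  Chernoff's argument. Write \<open>f = c + (fourier_mode 1 - 1) * h\<close> with \<open>h\<close> bounded. The
  coefficients of \<open>f - c\<close> are then differences of consecutive coefficients of \<open>h\<close>, so the
  symmetric partial sums telescope, and the two remaining coefficients of \<open>h\<close> tend to \<open>0\<close>.
\<close>

theorem Fourier_series_at_0:
  assumes f: "f \<in> borel_measurable borel"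
    and bound: "\<And>x. x \<in> {0..<1} \<Longrightarrow> norm (f x - c) \<le> C * min x (1 - x)"
  shows "(\<lambda>K. \<Sum>k\<in>{- int K..int K}. L2_ip unit_cell (fourier_mode k) f) \<longlonglongrightarrow> c"
proof -
  define h where "h x = (f x - c) / (fourier_mode 1 x - 1)" for x
  have "0 \<le> norm (f (1/2) - c)" by simp
  also have "\<dots> \<le> C * min (1/2) (1 - 1/2)" by (rule bound) auto
  finally have C: "C \<ge> 0" by simp
  have [measurable]: "f \<in> borel_measurable borel" by fact
  have hm: "h \<in> borel_measurable borel" unfolding h_def by measurable
  have Lh: "L2_function unit_cell h"
  proof (rule L2_function_bounded)
    fix x :: real assume x: "x \<in> {0..<1}"
    show "norm (h x) \<le> 3/2 * C"
    proof (cases "fourier_mode 1 x = 1")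
      case False
      have "norm (f x - c) \<le> C * min x (1 - x)" by (rule bound[OF x])
      also have "\<dots> \<le> C * (3/2 * norm (fourier_mode 1 x - 1))"
        using norm_fourier_mode_minus_1[OF x] C by (intro mult_left_mono) auto
      finally show ?thesis using False by (simp add: h_def norm_divide divide_simps)
    qed (use C in \<open>simp add: h_def\<close>)
  qed (intro measurable_unit_cell hm)
  have L: "L2_function unit_cell (fourier_mode k)" for k
    using orthonormal_fourier_mode by (auto simp: orthonormal_def)
  have f_eq: "f x = c * fourier_mode 0 x + (fourier_mode 1 x * h x - h x)" if x: "x \<in> {0..<1}" for x
  proof (cases "fourier_mode 1 x = 1")
    case True
    then have "min x (1 - x) \<le> 0" using norm_fourier_mode_minus_1[OF x] by simp
    then have "norm (f x - c) \<le> 0"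
      using bound[OF x] C by (meson mult_nonneg_nonpos order_trans)
    then show ?thesis using True by simp
  next
    case False
    then have "f x = c + h x * (fourier_mode 1 x - 1)" by (simp add: h_def)
    then show ?thesis by (simp add: algebra_simps)
  qed
  have coeff: "L2_ip unit_cell (fourier_mode k) f = c * of_bool (k = 0)
      + (L2_ip unit_cell (fourier_mode (k - 1)) h - L2_ip unit_cell (fourier_mode k) h)" for k
  proof -
    have "L2_ip unit_cell (fourier_mode k) f
        = (\<integral>x. c * fourier_mode (- k) x + (cnj (fourier_mode (k - 1) x) * h x - cnj
          (fourier_mode k x) * h x) \<partial>unit_cell)"
      unfolding L2_ip_def
    proof (intro Bochner_Integration.integral_cong refl)
      fix x assume "x \<in> space unit_cell"
      then have "cnj (fourier_mode k x) * f x
          = c * fourier_mode (- k) x + (fourier_mode (- k) x * fourier_mode 1 x * h x - fourier_mode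
            (- k) x * h x)"
        by (simp add: space_unit_cell f_eq cnj_fourier_mode algebra_simps)
      then show "cnj (fourier_mode k x) * f x
          = c * fourier_mode (- k) x + (cnj (fourier_mode (k - 1) x) * h x - cnj (fourier_mode k x)
            * h x)"
        by (simp add: fourier_mode_mult cnj_fourier_mode)
    qed
    also have "\<dots> = (\<integral>x. c * fourier_mode (- k) x \<partial>unit_cell) +
        ((\<integral>x. cnj (fourier_mode (k - 1) x) * h x \<partial>unit_cell) -
          (\<integral>x. cnj (fourier_mode k x) * h x \<partial>unit_cell))"
      using integrable_L2_ip[OF L[of k] Lh] integrable_L2_ip[OF L[of "k - 1"] Lh]
        integrable_L2_ip[OF L[of k] L[of 0]]
      by (subst Bochner_Integration.integral_add)
        (auto simp: cnj_fourier_mode intro!: Bochner_Integration.integral_diff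
          Bochner_Integration.integrable_diff)
    finally show ?thesis by (simp add: L2_ip_def integral_fourier_mode)
  qed
  have "(\<Sum>k\<in>{- int K..int K}. L2_ip unit_cell (fourier_mode k) f)
      = c + (L2_ip unit_cell (fourier_mode (- int K - 1)) h - L2_ip unit_cell (fourier_mode (int K))
        h)" for K
  proof -
    have "(\<Sum>k\<in>{- int K..int K}. c * of_bool (k = 0))
      = (\<Sum>k\<in>{- int K..int K}. if k = 0 then c else 0)"
      by (intro sum.cong) auto
    then have "(\<Sum>k\<in>{- int K..int K}. c * of_bool (k = 0)) = c" by simp
    then show ?thesis
      unfolding coeff sum.distrib
      using sum_symmetric_telescope[of "\<lambda>k. L2_ip unit_cell (fourier_mode k) h" K] by simp
  qed
  moreover have "(\<lambda>K. c + (L2_ip unit_cell (fourier_mode (- int K - 1)) h - L2_ip unit_cell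
    (fourier_mode (int K)) h))
      \<longlonglongrightarrow> c + (0 - 0)"
    by (intro tendsto_add tendsto_diff tendsto_const Fourier_coefficients_tendsto_0[OF Lh])
      (auto simp: inj_def)
  ultimately show ?thesis by simp
qed

lemma sum_symmetric_even:
  fixes g :: "int \<Rightarrow> 'b::comm_ring_1"
  assumes "\<And>k. g (- k) = g k"
  shows "(\<Sum>k\<in>{- int K..int K}. g k) = g 0 + 2 * (\<Sum>n<K. g (int (Suc n)))"
proof (induction K)
  case (Suc K)
  have "{- int (Suc K)..int (Suc K)} = insert (- int (Suc K))
    (insert (int (Suc K)) {- int K..int K})"
    by auto
  then show ?case using Suc assms[of "int (Suc K)"] by (simp add: algebra_simps)
qed simp

section \<open>The sum of the inverse fourth powers\<close>

text \<open>
  The value of the zeta function at \<open>4\<close>, from the Fourier series of \<open>x\<^sup>2 * (1 - x)\<^sup>2\<close> at \<open>0\<close>.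
  Periodically extended, this polynomial has a jump only in its third derivative, so its
  coefficients are \<open>- 24 / (2 * pi * k) ^ 4\<close> for \<open>k \<noteq> 0\<close>, and the constant one is \<open>1/30\<close>.
\<close>

lemma sums_inverse_fourth_powers: "(\<lambda>n. 1 / real (Suc n) ^ 4) sums (pi ^ 4 / 90)"
proof -
  define f :: "real \<Rightarrow> complex" where "f x = of_real (x\<^sup>2 * (1 - x)\<^sup>2)" for x
  have "(\<lambda>K. \<Sum>k\<in>{- int K..int K}. L2_ip unit_cell (fourier_mode k) f) \<longlonglongrightarrow> 0"
  proof (rule Fourier_series_at_0[where C=1])
    show "f \<in> borel_measurable borel"
      unfolding f_def by (intro borel_measurable_continuous_onI continuous_intros)
    fix x :: real assume x: "x \<in> {0..<1}"
    have "x\<^sup>2 \<le> x" "(1 - x)\<^sup>2 \<le> 1 - x" 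
      using x by (auto simp: power2_eq_square mult_left_le)
    moreover have "x\<^sup>2 \<le> 1" "(1 - x)\<^sup>2 \<le> 1"
      using x by (auto intro!: power_le_one)
    ultimately have "x\<^sup>2 * (1 - x)\<^sup>2 \<le> x * 1" "x\<^sup>2 * (1 - x)\<^sup>2 \<le> 1 * (1 - x)"
      using x by (intro mult_mono; simp)+
    moreover have "norm (f x - 0) = x\<^sup>2 * (1 - x)\<^sup>2"
      unfolding f_def by (simp only: diff_0_right norm_of_real) simp
    ultimately show "norm (f x - 0) \<le> 1 * min x (1 - x)" by (simp add: min_def)
  qed
  moreover have "L2_ip unit_cell (fourier_mode k) f = - 24 / of_real ((2 * pi * of_int k) ^ 4)"
    if "k \<noteq> 0" for k
  proof -
    define w where "w = - (\<i> * of_real (2 * pi * of_int k))"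
    have w: "w \<noteq> 0" using that by (simp add: w_def)
    \<comment> \<open>The antiderivative of \<open>exp (w * x) * f x\<close> that repeated integration by parts produces.\<close>
    define G where "G z = (z^2 - 2*z^3 + z^4) / w - (2*z - 6*z^2 + 4*z^3) / w^2
      + (2 - 12*z + 12*z^2) / w^3 - (24*z - 12) / w^4 + 24 / w^5" for z :: complex
    define F :: "real \<Rightarrow> complex" where "F = (\<lambda>x. exp (w * of_real x) * G (of_real x))"
    have parts: "w * (p0 / w - p1 / w^2 + p2 / w^3 - p3 / w^4 + p4 / w^5)
        + (p1 / w - p2 / w^2 + p3 / w^3 - p4 / w^4) = p0" for p0 p1 p2 p3 p4
      using w by (simp add: ring_distribs eval_nat_numeral)
    have dG: "(G has_field_derivative (2*z - 6*z^2 + 4*z^3) / w - (2 - 12*z + 12*z^2) / w^2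
      + (24*z - 12) / w^3 - 24 / w^4) (at z)" for z
    proof -
      have "((\<lambda>z. z^2 - 2*z^3 + z^4) has_field_derivative 2*z - 6*z^2 + 4*z^3) (at z)"
        "((\<lambda>z. 2*z - 6*z^2 + 4*z^3) has_field_derivative 2 - 12*z + 12*z^2) (at z)"
        "((\<lambda>z. 2 - 12*z + 12*z^2) has_field_derivative 24*z - 12) (at z)"
        "((\<lambda>z. 24*z - 12) has_field_derivative 24) (at z)"
        by (auto intro!: derivative_eq_intros)
      from DERIV_add[OF DERIV_diff[OF DERIV_add[OF DERIV_diff[OF DERIV_cdivide[OF this(1), of w]
          DERIV_cdivide[OF this(2), of "w^2"]] DERIV_cdivide[OF this(3), of "w^3"]]
          DERIV_cdivide[OF this(4), of "w^4"]] DERIV_const[of "24 / w^5"]]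
      show ?thesis unfolding G_def by simp
    qed
    have "L2_ip unit_cell (fourier_mode k) f = (\<integral>x. exp (w * of_real x) * f x \<partial>unit_cell)"
      unfolding L2_ip_def cnj_fourier_mode by (simp add: fourier_mode_def w_def mult.assoc)
    also have "\<dots> = F 1 - F 0"
    proof (rule integral_unit_cell_FTC)
      show "continuous_on UNIV (\<lambda>x. exp (w * of_real x) * f x)"
        unfolding f_def by (intro continuous_intros)
      show "(F has_vector_derivative exp (w * of_real x) * f x) (at x)" for x
      proof -
        let ?z = "complex_of_real x"
        have "((\<lambda>z. exp (w * z) * G z) has_field_derivative exp (w * ?z) * (w * G ?z
          + ((2*?z - 6*?z^2 + 4*?z^3) / w - (2 - 12*?z + 12*?z^2) / w^2
          + (24*?z - 12) / w^3 - 24 / w^4))) (at ?z)"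
          by (rule derivative_eq_intros dG refl | simp)+ (simp add: algebra_simps)
        also have "w * G ?z + ((2*?z - 6*?z^2 + 4*?z^3) / w - (2 - 12*?z + 12*?z^2) / w^2
          + (24*?z - 12) / w^3 - 24 / w^4) = ?z^2 - 2*?z^3 + ?z^4"
          unfolding G_def by (rule parts)
        also have "\<dots> = f x"
          by (simp add: f_def power2_eq_square power3_eq_cube power4_eq_xxxx algebra_simps)
        finally show ?thesis unfolding F_def by (rule has_vector_derivative_real_field)
      qed
    qed
    also have "exp w = 1"
      using fourier_mode_at_int[of "-k" 1] by (simp add: fourier_mode_def w_def)
    then have "F 1 - F 0 = - 24 / w ^ 4"
      by (simp add: F_def G_def diff_divide_distrib)
    also have "w ^ 4 = of_real ((2 * pi * of_int k) ^ 4)"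
      by (simp add: w_def power_mult_distrib)
    finally show ?thesis .
  qed
  moreover have "L2_ip unit_cell (fourier_mode 0) f = 1 / 30"
  proof -
    have "L2_ip unit_cell (fourier_mode 0) f = (\<integral>x. f x \<partial>unit_cell)" by (simp add: L2_ip_def)
    also have "\<dots> = (\<lambda>x. of_real x^3/3 - of_real x^4/2 + of_real x^5/5) 1 -
      (\<lambda>x. of_real x^3/3 - of_real x^4/2 + of_real x^5/5) (0::real)"
    proof (rule integral_unit_cell_FTC)
      show "continuous_on UNIV f" unfolding f_def by (intro continuous_intros)
      show "((\<lambda>x. of_real x^3/3 - of_real x^4/2 + of_real x^5/5) has_vector_derivative f x) (at x)"
        for x
        by (rule has_vector_derivative_real_field)
          (rule derivative_eq_intros refl | (simp add: f_def power2_eq_square power3_eq_cube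
            power4_eq_xxxx algebra_simps; fail))+
    qed
    finally show ?thesis by simp
  qed
  ultimately have "(\<lambda>K. \<Sum>k\<in>{- int K..int K}. if k
    = 0 then 1/30 else complex_of_real (- 24 / (2 * pi * of_int k) ^ 4)) \<longlonglongrightarrow> 0"
    by (elim tendsto_cong[THEN iffD1, rotated]) (intro always_eventually allI sum.cong refl, auto)
  then have "(\<lambda>K. 1/30 + 2 * (\<Sum>n<K. complex_of_real (- 24 / (2 * pi * real (Suc n)) ^ 4))) \<longlonglongrightarrow> 0"
    by (subst (asm) sum_symmetric_even) (auto simp del: of_nat_Suc simp: power_mult_distrib)
  then have "(\<lambda>K. complex_of_real (1/30 + 2 * (\<Sum>n<K. - 24 / (2 * pi * real (Suc n)) ^ 4)))
    \<longlonglongrightarrow> of_real 0"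
    by simp
  then have "(\<lambda>K. 1/30 + 2 * (\<Sum>n<K. - 24 / (2 * pi * real (Suc n)) ^ 4)) \<longlonglongrightarrow> 0"
    by (simp only: tendsto_of_real_iff)
  then have "(\<lambda>K. (pi^4/3) * (1/30 - (1/30 + 2 * (\<Sum>n<K. - 24 / (2 * pi * real (Suc n)) ^ 4))))
    \<longlonglongrightarrow> (pi^4/3) * (1/30 - 0)"
    by (intro tendsto_intros)
  moreover have "(pi^4/3) * (1/30 - (1/30 + 2 * (\<Sum>n<K. - 24 / (2 * pi * real (Suc n)) ^ 4)))
      = (\<Sum>n<K. 1 / real (Suc n) ^ 4)" for K
    by (simp add: sum_distrib_left power_mult_distrib sum_negf del: of_nat_Suc)
  ultimately show ?thesis by (simp add: sums_def del: of_nat_Suc)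
qed

section \<open>The theta function and its transformation formula\<close>

text \<open>
  Jacobi's theta function: the sum of \<open>exp (- k\<^sup>2 * s)\<close> over all integers \<open>k\<close>, folded at \<open>0\<close>.
\<close>

definition theta :: "real \<Rightarrow> real" where
  "theta s = 1 + 2 * (\<Sum>n. exp (- (real (Suc n))\<^sup>2 * s))"

lemma exp_minus_le:
  fixes y :: real
  assumes "y > 0"
  shows "exp (- y) \<le> fact m / y ^ m"
proof -
  have "y ^ m / fact m \<le> exp y"
  proof -
    have "(\<Sum>n\<in>{m}. y ^ n /\<^sub>R fact n) \<le> (\<Sum>n. y ^ n /\<^sub>R fact n)"
      using assms summable_exp_generic[of y] by (intro sum_le_suminf) auto
    then show ?thesis by (simp add: exp_def divide_inverse mult.commute)
  qed
  then have "inverse (exp y) \<le> inverse (y ^ m / fact m)"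
    using assms by (intro le_imp_inverse_le) auto
  then show ?thesis by (simp add: exp_minus)
qed

lemma summable_inverse_Suc_power:
  assumes "p \<ge> 2"
  shows "summable (\<lambda>n. 1 / real (Suc n) ^ p)"
proof -
  have "summable (\<lambda>n. inverse (real (Suc n) ^ p))"
    using inverse_power_summable[OF assms, where 'a=real] by (subst summable_Suc_iff)
  then show ?thesis by (simp only: inverse_eq_divide)
qed

lemma summable_theta:
  assumes "s > 0"
  shows "summable (\<lambda>n. exp (- (real (Suc n))\<^sup>2 * s))"
proof (rule summable_comparison_test)
  show "summable (\<lambda>n. 1 / s * (1 / real (Suc n) ^ 2))"
    by (intro summable_mult summable_inverse_Suc_power) auto
  have "exp (- (real (Suc n))\<^sup>2 * s) \<le> 1 / s * (1 / real (Suc n) ^ 2)" for n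
    using exp_minus_le[of "(real (Suc n))\<^sup>2 * s" 1] assms by (simp add: field_simps del: of_nat_Suc)
  then show "\<exists>N. \<forall>n\<ge>N. norm (exp (- (real (Suc n))\<^sup>2 * s)) \<le> 1 / s * (1 / real (Suc n) ^ 2)"
    by auto
qed

lemma theta_ge_1: "s > 0 \<Longrightarrow> 1 \<le> theta s"
  unfolding theta_def using suminf_nonneg[OF summable_theta] by auto

lemma theta_antimono:
  assumes "0 < s" "s \<le> t"
  shows "theta t \<le> theta s"
  unfolding theta_def using assms
  by (intro add_left_mono mult_left_mono suminf_le summable_theta) (auto intro!: mult_left_mono_neg)

text \<open>
  Each exponential is bounded by an inverse power by \<open>exp_minus_le\<close>. After the transformation
  formula this becomes the smallness of the corrections to the heat trace at short times.
\<close>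

lemma theta_minus_1_le:
  assumes "m \<ge> 1"
  shows "\<exists>C>0. \<forall>s>0. theta s - 1 \<le> C / s ^ m"
proof -
  define Z where "Z = (\<Sum>n. 1 / real (Suc n) ^ (2 * m))"
  have sm: "summable (\<lambda>n. 1 / real (Suc n) ^ (2 * m))"
    using assms by (intro summable_inverse_Suc_power) auto
  have "Z > 0" unfolding Z_def by (rule suminf_pos[OF sm]) auto
  moreover have "theta s - 1 \<le> (2 * fact m * Z) / s ^ m" if "s > 0" for s
  proof -
    have "(\<Sum>n. exp (- (real (Suc n))\<^sup>2 * s)) \<le> (\<Sum>n. fact m / s ^ m * (1 / real (Suc n) ^ (2 * m)))"
    proof (intro suminf_le summable_theta that summable_mult sm)
      fix n
      have "exp (- ((real (Suc n))\<^sup>2 * s)) \<le> fact m / ((real (Suc n))\<^sup>2 * s) ^ m"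
        using that by (intro exp_minus_le) auto
      then show "exp (- (real (Suc n))\<^sup>2 * s) \<le> fact m / s ^ m * (1 / real (Suc n) ^ (2 * m))"
        by (simp add: power_mult_distrib power_mult[symmetric] mult.commute del: of_nat_Suc)
    qed
    also have "\<dots> = fact m / s ^ m * Z" unfolding Z_def by (rule suminf_mult[OF sm])
    finally show ?thesis by (simp add: theta_def)
  qed
  ultimately show ?thesis by (intro exI[of _ "2 * fact m * Z"]) auto
qed

lemma has_sum_int_even:
  fixes f :: "int \<Rightarrow> real"
  assumes "\<And>k. f (- k) = f k" "\<And>k. 0 \<le> f k" "summable (\<lambda>n. f (int (Suc n)))"
  shows "(f has_sum (f 0 + 2 * (\<Sum>n. f (int (Suc n))))) UNIV"
proof -
  define S where "S = (\<Sum>n. f (int (Suc n)))"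
  have S: "((\<lambda>n. f (int (Suc n))) has_sum S) UNIV"
    unfolding S_def using assms by (intro sums_nonneg_imp_has_sum summable_sums) auto
  have p: "(f has_sum S) {1..}"
  proof -
    have "bij_betw (\<lambda>n. int (Suc n)) UNIV {1..}"
      by (rule bij_betwI[where g="\<lambda>k. nat (k - 1)"]) auto
    from has_sum_reindex_bij_betw[OF this, of f S] S show ?thesis by simp
  qed
  have m: "(f has_sum S) {..-1}"
  proof -
    have "bij_betw uminus {1..} {..-1::int}"
      by (rule bij_betwI[where g=uminus]) auto
    from has_sum_reindex_bij_betw[OF this, of f S] p assms(1) show ?thesis by simp
  qed
  have "(f has_sum (f 0 + (S + S))) ({0} \<union> ({1..} \<union> {..-1}))"
    by (intro has_sum_Un_disjoint p m has_sum_finiteI) auto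
  also have "{0} \<union> ({1..} \<union> {..-1}) = (UNIV :: int set)" by auto
  finally show ?thesis by (simp add: S_def)
qed

lemma has_sum_theta:
  assumes "s > 0"
  shows "((\<lambda>k. exp (- (of_int k)\<^sup>2 * s)) has_sum theta s) (UNIV :: int set)"
  using has_sum_int_even[of "\<lambda>k. exp (- (of_int k)\<^sup>2 * s)"] summable_theta[OF assms]
  by (simp add: theta_def del: of_nat_Suc)

text \<open>
  A rescaling of the characteristic function of the standard normal distribution.
\<close>

lemma Gaussian_Fourier_transform:
  assumes "s > 0"
  shows "(\<integral>x. fourier_mode k x * of_real (exp (- x\<^sup>2 * s)) \<partial>lborel)
    = of_real (sqrt (pi / s) * exp (- pi\<^sup>2 * (of_int k)\<^sup>2 / s))"
proof -
  define r where "r = sqrt (2 * s)"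
  have r: "r > 0" "r\<^sup>2 = 2 * s" using assms by (auto simp: r_def)
  define t where "t = 2 * pi * of_int k / r"
  have "char std_normal_distribution t
      = (\<integral>x. std_normal_density x *\<^sub>R iexp (t * x) \<partial>lborel)"
    unfolding char_def by (subst integral_density) auto
  also have "\<dots> = \<bar>r\<bar> *\<^sub>R (\<integral>x. std_normal_density (0 + r * x) *\<^sub>R iexp (t * (0 + r * x)) \<partial>lborel)"
    using r by (subst lborel_integral_real_affine[where c=r and t=0]) auto
  also have "(\<lambda>x. std_normal_density (0 + r * x) *\<^sub>R iexp (t * (0 + r * x)))
      = (\<lambda>x. of_real (1 / sqrt (2 * pi)) * (fourier_mode k x * of_real (exp (- x\<^sup>2 * s))))"
    using r by (auto simp: fun_eq_iff std_normal_density_def fourier_mode_def t_def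
      power_mult_distrib
        scaleR_conv_of_real mult_ac exp_minus)
  also have "(\<integral>x. of_real (1 / sqrt (2 * pi)) * (fourier_mode k x * of_real (exp (- x\<^sup>2 * s)))
    \<partial>lborel)
      = of_real (1 / sqrt (2 * pi)) * (\<integral>x. fourier_mode k x * of_real (exp (- x\<^sup>2 * s)) \<partial>lborel)"
    by (rule Bochner_Integration.integral_mult_right_zero)
  finally have "of_real (exp (- t\<^sup>2 / 2)) = complex_of_real (r / sqrt (2 * pi)) *
    (\<integral>x. fourier_mode k x * of_real (exp (- x\<^sup>2 * s)) \<partial>lborel)"
    using r by (simp add: char_std_normal_distribution scaleR_conv_of_real)
  then have "(\<integral>x. fourier_mode k x * of_real (exp (- x\<^sup>2 * s)) \<partial>lborel)
      = of_real (sqrt (2 * pi) / r) * of_real (exp (- t\<^sup>2 / 2))"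
    using r by (simp add: field_simps)
  moreover have "sqrt (2 * pi) / r = sqrt (pi / s)"
    unfolding r_def by (simp add: real_sqrt_divide[symmetric])
  moreover have "- t\<^sup>2 / 2 = - pi\<^sup>2 * (of_int k)\<^sup>2 / s"
    unfolding t_def using r assms by (simp add: power_divide power_mult_distrib)
  ultimately show ?thesis by simp
qed

lemma integrable_Gaussian:
  assumes "s > 0"
  shows "integrable lborel (\<lambda>x::real. exp (- x\<^sup>2 * s))"
proof -
  have "integrable lborel (\<lambda>x. sqrt (pi / s) * normal_density 0 (1 / sqrt (2 * s)) x)"
    using assms by (intro integrable_mult_right integrable_normal_density) auto
  also have "(\<lambda>x. sqrt (pi / s) * normal_density 0 (1 / sqrt (2 * s)) x) = (\<lambda>x. exp (- x\<^sup>2 * s))"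
    using assms by (auto simp: fun_eq_iff normal_density_def power_divide real_sqrt_divide)
  finally show ?thesis .
qed

text \<open>
  A quantitative mean value bound, used for the Lipschitz estimate of the periodized Gaussian at
  \<open>0\<close>.
\<close>

lemma abs_exp_diff_le:
  fixes p q b :: real
  assumes "b \<le> p" "b \<le> q"
  shows "\<bar>exp (- p) - exp (- q)\<bar> \<le> \<bar>p - q\<bar> * exp (- b)"
proof -
  have *: "exp (- p) - exp (- q) \<le> (q - p) * exp (- b)" if "p \<le> q" "b \<le> p" for p q :: real
  proof -
    have "1 - exp (p - q) \<le> q - p" using exp_ge_add_one_self[of "p - q"] by linarith
    then have "exp (- p) * (1 - exp (p - q)) \<le> exp (- b) * (q - p)"
      using that by (intro mult_mono) auto
    then show ?thesis by (simp add: algebra_simps exp_add[symmetric])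
  qed
  show ?thesis
  proof (cases "p \<le> q")
    case True
    then show ?thesis using *[of p q] assms by simp
  next
    case False
    then show ?thesis using *[of q p] assms by simp
  qed
qed

text \<open>
  Poisson summation for the Gaussian \<open>g\<close>: its periodization \<open>f\<close> has the value \<open>theta s\<close> at \<open>0\<close>,
  its Fourier coefficients are the values of the Fourier transform of \<open>g\<close> at the integers, and
  its Fourier series converges at \<open>0\<close> because \<open>f\<close> is Lipschitz there.
\<close>

lemma theta_transformation:
  assumes s: "s > 0"
  shows "theta s = sqrt (pi / s) * theta (pi\<^sup>2 / s)"
proof -
  let ?q = "\<lambda>n. exp (- (real n)\<^sup>2 * s)"
  define g where "g x = exp (- x\<^sup>2 * s)" for x :: real
  \<comment> \<open>The translates by \<open>n\<close> and by \<open>- n - 1\<close> are paired, so that the periodization is a series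
    over the natural numbers that is symmetric under \<open>x \<mapsto> 1 - x\<close>.\<close>
  define p where "p n x = g (x + real n) + g (x - real (Suc n))" for n x
  have g_meas [measurable]: "g \<in> borel_measurable borel" unfolding g_def by measurable
  have p_meas [measurable]: "p n \<in> borel_measurable borel" for n unfolding p_def by measurable
  have g_nonneg: "0 \<le> g x" for x by (simp add: g_def)
  have sum_exp: "summable (\<lambda>n. (4 * real n + 3) * (?q n))"
  proof (subst summable_Suc_iff[symmetric], rule summable_comparison_test)
    show "summable (\<lambda>n. 14 / s\<^sup>2 * (1 / real (Suc n) ^ 3))"
      by (intro summable_mult summable_inverse_Suc_power) auto
    have "(4 * real (Suc n) + 3) * exp (- (real (Suc n))\<^sup>2 * s) \<le> 14 / s\<^sup>2 * (1 / real (Suc n) ^ 3)"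
      for n
    proof -
      let ?y = "real (Suc n)"
      have "exp (- (?y\<^sup>2 * s)) \<le> fact 2 / (?y\<^sup>2 * s)\<^sup>2" using s by (intro exp_minus_le) auto
      then have "(4 * ?y + 3) * exp (- (?y\<^sup>2 * s)) \<le> (7 * ?y) * (fact 2 / (?y\<^sup>2 * s)\<^sup>2)"
        by (intro mult_mono) auto
      also have "\<dots> = 14 / s\<^sup>2 * (1 / ?y ^ 3)"
        using s by (simp add: field_simps power2_eq_square power3_eq_cube del: of_nat_Suc)
      finally show ?thesis by simp
    qed
    then show "\<exists>N. \<forall>n\<ge>N. norm ((4 * real (Suc n) + 3) * exp (- (real (Suc n))\<^sup>2 * s))
      \<le> 14 / s\<^sup>2 * (1 / real (Suc n) ^ 3)"
      by (auto simp del: of_nat_Suc)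
  qed
  have sum_exp': "summable (\<lambda>n. (?q n))"
    using summable_theta[OF s] by (subst (asm) summable_Suc_iff)
  have p_bound: "\<bar>p n x\<bar> \<le> 2 * (?q n)" if "x \<in> {0..1}" for n x
  proof -
    have "(real n)\<^sup>2 \<le> (x + real n)\<^sup>2" "(real n)\<^sup>2 \<le> (real (Suc n) - x)\<^sup>2"
      using that by (intro power_mono; simp)+
    then have "g (x + real n) \<le> (?q n)" "g (x - real (Suc n)) \<le> (?q n)"
      unfolding g_def using s by (simp_all add: power2_commute)
    then show ?thesis using g_nonneg by (simp add: p_def)
  qed
  have p_summable: "summable (\<lambda>n. p n x)" if "x \<in> {0..1}" for x
    by (rule summable_comparison_test[OF _ summable_mult[OF sum_exp', of 2]])
      (use p_bound[OF that] in auto)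
  define f where "f x = (\<Sum>n. p n x)" for x
  have f0: "f 0 = theta s"
  proof -
    have "f 0 = (\<Sum>n. g (real n)) + (\<Sum>n. g (real (Suc n)))"
      unfolding f_def p_def using sum_exp' summable_theta[OF s]
      by (subst suminf_add) (auto simp: g_def simp del: of_nat_Suc)
    also have "(\<Sum>n. g (real n)) = (\<Sum>n. g (real (Suc n))) + g 0"
      using suminf_split_head[of "\<lambda>n. g (real n)"] sum_exp' by (simp add: g_def)
    finally show ?thesis by (simp add: theta_def g_def)
  qed
  define C where "C = s * (\<Sum>n. (4 * real n + 3) * (?q n))"
  have Lip: "\<bar>f x - f 0\<bar> \<le> C * x" if x: "x \<in> {0..1}" for x
  proof -
    have d: "\<bar>p n x - p n 0\<bar> \<le> (x * s) * ((4 * real n + 3) * (?q n))" for n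
    proof -
      have "(real n)\<^sup>2 \<le> (x + real n)\<^sup>2" "(real n)\<^sup>2 \<le> (real (Suc n) - x)\<^sup>2"
        "(real n)\<^sup>2 \<le> (real (Suc n))\<^sup>2"
        using x by (intro power_mono; simp)+
      then have "(real n)\<^sup>2 * s \<le> (x + real n)\<^sup>2 * s" "(real n)\<^sup>2 * s \<le> (x - real (Suc n))\<^sup>2 * s"
         "(real n)\<^sup>2 * s \<le> (real (Suc n))\<^sup>2 * s"
        using s by (simp_all add: power2_commute)
      then have "\<bar>exp (- ((x + real n)\<^sup>2 * s)) - exp (- ((real n)\<^sup>2 * s))\<bar>
            \<le> \<bar>(x + real n)\<^sup>2 * s - (real n)\<^sup>2 * s\<bar> * exp (- ((real n)\<^sup>2 * s))"
        and "\<bar>exp (- ((x - real (Suc n))\<^sup>2 * s)) - exp (- ((real (Suc n))\<^sup>2 * s))\<bar>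
            \<le> \<bar>(x - real (Suc n))\<^sup>2 * s - (real (Suc n))\<^sup>2 * s\<bar> * exp (- ((real n)\<^sup>2 * s))"
        by (intro abs_exp_diff_le; simp)+
      moreover have "\<bar>(x + real n)\<^sup>2 * s - (real n)\<^sup>2 * s\<bar> \<le> (x * s) * (2 * real n + 1)"
      proof -
        have "(x + real n)\<^sup>2 * s - (real n)\<^sup>2 * s = (x * s) * (2 * real n + x)"
          by (simp add: power2_eq_square algebra_simps)
        moreover have "0 \<le> (x * s) * (2 * real n + x)"
          "(x * s) * (2 * real n + x) \<le> (x * s) * (2 * real n + 1)"
          using x s by (auto intro!: mult_left_mono)
        ultimately show ?thesis by linarith
      qed
      moreover have "\<bar>(x - real (Suc n))\<^sup>2 * s - (real (Suc n))\<^sup>2 * s\<bar> \<le> (x * s) * (2 * real n + 2)"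
      proof -
        have "(x - real (Suc n))\<^sup>2 * s - (real (Suc n))\<^sup>2 * s = - ((x * s) * (2 * real n + 2 - x))"
          by (simp add: power2_eq_square algebra_simps)
        moreover have "0 \<le> (x * s) * (2 * real n + 2 - x)"
          "(x * s) * (2 * real n + 2 - x) \<le> (x * s) * (2 * real n + 2)"
          using x s by (auto intro!: mult_left_mono mult_nonneg_nonneg)
        ultimately show ?thesis by linarith
      qed
      ultimately have "\<bar>exp (- ((x + real n)\<^sup>2 * s)) - exp (- ((real n)\<^sup>2 * s))\<bar>
        \<le> (x * s) * (2 * real n + 1) * exp (- ((real n)\<^sup>2 * s))"
        and "\<bar>exp (- ((x - real (Suc n))\<^sup>2 * s)) - exp (- ((real (Suc n))\<^sup>2 * s))\<bar>
          \<le> (x * s) * (2 * real n + 2) * exp (- ((real n)\<^sup>2 * s))"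
        by (meson mult_right_mono exp_ge_zero order_trans)+
      moreover have "g (0 - real (Suc n)) = exp (- ((real (Suc n))\<^sup>2 * s))"
        "g (0 + real n) = exp (- ((real n)\<^sup>2 * s))"
        by (simp_all add: g_def del: of_nat_Suc)
      ultimately have "\<bar>p n x - p n 0\<bar> \<le> (x * s) * (2 * real n + 1) * exp (- ((real n)\<^sup>2 * s)) +
        (x * s) * (2 * real n + 2) * exp (- ((real n)\<^sup>2 * s))"
        unfolding p_def g_def[of "x + real n"] g_def[of "x - real (Suc n)"] mult_minus_left
          by linarith
      also have "\<dots> = (x * s) * ((4 * real n + 3) * (?q n))"
        by (simp add: algebra_simps)
      finally show ?thesis .
    qed
    have sd: "summable (\<lambda>n. \<bar>p n x - p n 0\<bar>)"
      by (rule summable_comparison_test[OF _ summable_mult[OF sum_exp, of "x * s"]]) (use d in auto)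
    have "\<bar>f x - f 0\<bar> = \<bar>\<Sum>n. p n x - p n 0\<bar>"
      unfolding f_def using p_summable x by (subst suminf_diff) auto
    also have "\<dots> \<le> (\<Sum>n. \<bar>p n x - p n 0\<bar>)" by (rule summable_rabs[OF sd])
    also have "\<dots> \<le> (\<Sum>n. (x * s) * ((4 * real n + 3) * (?q n)))"
      by (intro suminf_le d sd summable_mult sum_exp)
    also have "\<dots> = (x * s) * (\<Sum>n. (4 * real n + 3) * (?q n))" by (rule suminf_mult[OF sum_exp])
    also have "\<dots> = C * x" by (simp add: C_def)
    finally show ?thesis .
  qed
  have f_sym: "f (1 - x) = f x" for x
  proof -
    have "p n (1 - x) = p n x" for n
    proof -
      have "(1 - x + real n)\<^sup>2 = (x - real (Suc n))\<^sup>2" "(1 - x - real (Suc n))\<^sup>2 = (x + real n)\<^sup>2"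
        by (simp_all add: power2_eq_square algebra_simps)
      then show ?thesis by (simp add: p_def g_def)
    qed
    then show ?thesis by (simp add: f_def)
  qed
  have "(\<lambda>K. \<Sum>k\<in>{- int K..int K}. L2_ip unit_cell (fourier_mode k) (\<lambda>x. complex_of_real (f x)))
    \<longlonglongrightarrow> of_real (theta s)"
  proof (rule Fourier_series_at_0)
    show "(\<lambda>x. complex_of_real (f x)) \<in> borel_measurable borel"
      unfolding f_def by measurable
    fix x :: real assume x: "x \<in> {0..<1}"
    have "\<bar>f x - f 0\<bar> \<le> C * x" "\<bar>f x - f 0\<bar> \<le> C * (1 - x)"
      using Lip[of x] Lip[of "1 - x"] x f_sym by auto
    then have "\<bar>f x - theta s\<bar> \<le> C * min x (1 - x)"
      by (simp add: f0 min_def)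
    then show "norm (complex_of_real (f x) - complex_of_real (theta s)) \<le> C * min x (1 - x)"
      by (simp flip: of_real_diff)
  qed
  moreover have "L2_ip unit_cell (fourier_mode k) (\<lambda>x. complex_of_real (f x))
      = of_real (sqrt (pi / s) * exp (- (of_int k)\<^sup>2 * (pi\<^sup>2 / s)))" for k
  proof -
    \<comment> \<open>The part of the line that the pair \<open>p n\<close> moves into the unit cell.\<close>
    define A where "A n = {real n..<real n + 1} \<union> {- real n - 1..<- real n}" for n
    have A_disj: "A i \<inter> A j = {}" if "i \<noteq> j" for i j
    proof -
      have False if "x \<in> A i" "x \<in> A j" for x
        using that \<open>i \<noteq> j\<close> by (auto simp: A_def)
      then show ?thesis by blast
    qed
    have A_UN: "(\<Union>n. A n) = UNIV"
    proof -
      have "x \<in> A (nat \<lfloor>x\<rfloor>)" if "x \<ge> 0" for x using that by (simp add: A_def)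
      moreover have "x \<in> A (nat (- \<lfloor>x\<rfloor> - 1))" if "x < 0" for x
      proof -
        have "\<lfloor>x\<rfloor> \<le> -1" using that by linarith
        then have "real (nat (- \<lfloor>x\<rfloor> - 1)) = - of_int \<lfloor>x\<rfloor> - 1" by simp
        then show ?thesis by (simp add: A_def) linarith
      qed
      ultimately show ?thesis by (metis UNIV_eq_I UN_I UNIV_I linorder_not_le)
    qed
    let ?G = "\<lambda>x. fourier_mode (- k) x * of_real (g x)"
    have G_int: "integrable lborel ?G"
      by (rule Bochner_Integration.integrable_bound[OF integrable_Gaussian[OF s]])
        (auto simp: norm_mult g_def)
    have G_set: "set_integrable lborel B ?G" if "B \<in> sets borel" for B
      using that G_int unfolding set_integrable_def by (intro integrable_mult_indicator) auto
    have "(\<integral>x. ?G x \<partial>lborel) = (LINT x:(\<Union>n. A n)|lborel. ?G x)"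
      unfolding A_UN by (simp add: set_lebesgue_integral_def)
    also have "\<dots> = (\<Sum>n. (LINT x:A n|lborel. ?G x))"
      using A_disj G_set by (intro lebesgue_integral_countable_add) (auto simp: A_UN A_def)
    also have "\<dots> = (\<Sum>n. \<integral>x. fourier_mode (- k) x * of_real (p n x) \<partial>unit_cell)"
    proof (rule suminf_cong)
      fix n
      have shift: "(LINT x:{of_int m..<of_int m + 1}|lborel. ?G x)
        = (\<integral>x. fourier_mode (- k) x * of_real (g (x + of_int m)) \<partial>unit_cell)" for m :: int
      proof -
        have "(LINT x:{of_int m..<of_int m + 1}|lborel. ?G x)
          = (\<integral>x. indicator {of_int m..<of_int m + 1} (of_int m + 1 * x) *\<^sub>R ?G (of_int m + 1 * x)
            \<partial>lborel)"
          unfolding set_lebesgue_integral_def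
            by (subst lborel_integral_real_affine[where c=1 and t="of_int m"]) auto
        also have "\<dots> = (\<integral>x. indicator {0..<1} x *\<^sub>R
          (fourier_mode (- k) x * of_real (g (x + of_int m))) \<partial>lborel)"
          by (intro Bochner_Integration.integral_cong refl)
            (auto simp: indicator_def add.commute[of "of_int m"] fourier_mode_add_int)
        finally show ?thesis by (simp add: integral_unit_cell)
      qed
      have int: "integrable unit_cell (\<lambda>x. fourier_mode (- k) x * of_real (g (x + of_int m)))" for m
      proof -
        have "integrable lborel (\<lambda>x. ?G (of_int m + 1 * x))"
          by (rule lborel_integrable_real_affine[OF G_int]) auto
        then have "integrable lborel (\<lambda>x. fourier_mode (- k) x * of_real (g (x + of_int m)))"
          by (simp add: add.commute[of "of_int m"] fourier_mode_add_int)
        then show ?thesis unfolding integrable_unit_cell by (intro integrable_mult_indicator) auto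
      qed
      have "(LINT x:A n|lborel. ?G x)
          = (LINT x:{real n..<real n + 1}|lborel. ?G x) +
            (LINT x:{- real n - 1..<- real n}|lborel. ?G x)"
        unfolding A_def by (intro set_integral_Un G_set) auto
      also have "\<dots> = (\<integral>x. fourier_mode (- k) x * of_real (g (x + of_int (int n))) \<partial>unit_cell)
         + (\<integral>x. fourier_mode (- k) x * of_real (g (x + of_int (- int n - 1))) \<partial>unit_cell)"
        using shift[of "int n"] shift[of "- int n - 1"] by simp
      also have "\<dots> = (\<integral>x. fourier_mode (- k) x * of_real (p n x) \<partial>unit_cell)"
        by (subst Bochner_Integration.integral_add[OF int int, symmetric])
          (simp add: p_def algebra_simps diff_diff_eq2 add.commute)
      finally show "(LINT x:A n|lborel. ?G x)
        = (\<integral>x. fourier_mode (- k) x * of_real (p n x) \<partial>unit_cell)" .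
    qed
    also have "\<dots> = (\<integral>x. (\<Sum>n. fourier_mode (- k) x * of_real (p n x)) \<partial>unit_cell)"
    proof (rule integral_suminf[symmetric])
      interpret finite_measure unit_cell by (rule finite_measure_unit_cell)
      have b: "norm (fourier_mode (- k) x * of_real (p n x)) \<le> 2 * (?q n)" if "x \<in> space unit_cell"
        for n x
        using p_bound[of x n] that by (auto simp: norm_mult space_unit_cell)
      show i: "integrable unit_cell (\<lambda>x. fourier_mode (- k) x * of_real (p n x))" for n
      proof (rule integrable_const_bound)
        show "AE x in unit_cell. norm (fourier_mode (- k) x * of_real (p n x)) \<le> 2 * (?q n)"
          using b by (intro AE_I2)
        show "(\<lambda>x. fourier_mode (- k) x * of_real (p n x)) \<in> borel_measurable unit_cell"
          by (rule measurable_unit_cell) measurable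
      qed
      show "AE x in unit_cell. summable (\<lambda>n. norm (fourier_mode (- k) x * of_real (p n x)))"
        using b by (intro AE_I2 summable_comparison_test[OF _ summable_mult[OF sum_exp', of 2]])
          auto
      show "summable (\<lambda>n. \<integral>x. norm (fourier_mode (- k) x * of_real (p n x)) \<partial>unit_cell)"
      proof (rule summable_comparison_test[OF _ summable_mult[OF sum_exp', of 2]], intro exI allI
        impI)
        fix n
        have "(\<integral>x. norm (fourier_mode (- k) x * of_real (p n x)) \<partial>unit_cell)
          \<le> (\<integral>x. 2 * (?q n) \<partial>unit_cell)"
          using i b by (intro integral_mono integrable_norm) auto
        also have "\<dots> = 2 * (?q n)"
          by (simp add: integral_unit_cell)
        finally show "norm (\<integral>x. norm (fourier_mode (- k) x * of_real (p n x)) \<partial>unit_cell)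
          \<le> 2 * (?q n)"
          by (simp add: abs_of_nonneg)
      qed
    qed
    also have "\<dots> = (\<integral>x. fourier_mode (- k) x * of_real (f x) \<partial>unit_cell)"
    proof (intro Bochner_Integration.integral_cong refl)
      fix x assume "x \<in> space unit_cell"
      then have "summable (\<lambda>n. p n x)" by (intro p_summable) (auto simp: space_unit_cell)
      then show "(\<Sum>n. fourier_mode (- k) x * of_real (p n x))
        = fourier_mode (- k) x * of_real (f x)"
        unfolding f_def by (subst suminf_mult) (auto simp: suminf_of_real summable_of_real)
    qed
    finally have "(\<integral>x. ?G x \<partial>lborel) = L2_ip unit_cell (fourier_mode k) (\<lambda>x. complex_of_real (f x))"
      by (simp add: L2_ip_def cnj_fourier_mode)
    then show ?thesis
      using Gaussian_Fourier_transform[OF s, of "- k"] by (simp add: g_def mult.commute)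
  qed
  ultimately have "(\<lambda>K. complex_of_real (\<Sum>k\<in>{- int K..int K}. sqrt (pi / s) * exp
    (- (of_int k)\<^sup>2 * (pi\<^sup>2 / s)))) \<longlonglongrightarrow> of_real (theta s)"
    by simp
  then have lim: "(\<lambda>K. \<Sum>k\<in>{- int K..int K}. sqrt (pi / s) * exp (- (of_int k)\<^sup>2 * (pi\<^sup>2 / s)))
    \<longlonglongrightarrow> theta s"
    by (simp only: tendsto_of_real_iff)
  have eq: "(\<Sum>k\<in>{- int K..int K}. sqrt (pi / s) * exp (- (of_int k)\<^sup>2 * (pi\<^sup>2 / s)))
     = sqrt (pi / s) * (1 + 2 * (\<Sum>n<K. exp (- (real (Suc n))\<^sup>2 * (pi\<^sup>2 / s))))" for K
  proof -
    have "(\<Sum>k\<in>{- int K..int K}. exp (- (real_of_int k)\<^sup>2 * (pi\<^sup>2 / s)))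
        = 1 + 2 * (\<Sum>n<K. exp (- (real (Suc n))\<^sup>2 * (pi\<^sup>2 / s)))"
      by (subst sum_symmetric_even) (simp_all del: of_nat_Suc)
    then show ?thesis by (simp only: sum_distrib_left[symmetric])
  qed
  have "(\<lambda>K. sqrt (pi / s) * (1 + 2 * (\<Sum>n<K. exp (- (real (Suc n))\<^sup>2 * (pi\<^sup>2 / s)))))
    \<longlonglongrightarrow> sqrt (pi / s) * theta (pi\<^sup>2 / s)"
    unfolding theta_def using s by (intro tendsto_intros summable_LIMSEQ summable_theta) auto
  then show ?thesis using lim unfolding eq by (rule LIMSEQ_unique[symmetric])
qed

section \<open>The heat trace of the plates\<close>

lemma has_sum_product_nonneg:
  fixes f :: "'a \<Rightarrow> real" and g :: "'b \<Rightarrow> real"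
  assumes f: "(f has_sum S) A" "\<And>x. x \<in> A \<Longrightarrow> 0 \<le> f x"
    and g: "(g has_sum T) B" "\<And>y. y \<in> B \<Longrightarrow> 0 \<le> g y"
  shows "((\<lambda>(x, y). f x * g y) has_sum (S * T)) (A \<times> B)"
proof (rule has_sum_SigmaI)
  show "((\<lambda>y. case (x, y) of (x, y) \<Rightarrow> f x * g y) has_sum f x * T) B" for x
    using has_sum_cmult_right[OF g(1)] by simp
  show "((\<lambda>x. f x * T) has_sum S * T) A"
    using f(1) by (rule has_sum_cmult_left)
  show "(\<lambda>(x, y). f x * g y) summable_on A \<times> B"
  proof (rule nonneg_bdd_above_summable_on)
    have "sum (\<lambda>(x, y). f x * g y) F \<le> S * T" if F: "F \<subseteq> A \<times> B" "finite F" for F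
    proof -
      have "sum (\<lambda>(x, y). f x * g y) F \<le> sum (\<lambda>(x, y). f x * g y) (fst ` F \<times> snd ` F)"
        using F f g by (intro sum_mono2) (force intro!: mult_nonneg_nonneg)+
      also have "\<dots> = sum f (fst ` F) * sum g (snd ` F)"
        by (simp add: sum_product sum.cartesian_product)
      also have "\<dots> \<le> S * T"
      proof (rule mult_mono)
        show "sum f (fst ` F) \<le> S"
          by (rule finite_sum_le_has_sum[OF f(1)]) (use F f in \<open>auto simp: subset_iff\<close>)
        show "sum g (snd ` F) \<le> T"
          by (rule finite_sum_le_has_sum[OF g(1)]) (use F g in \<open>auto simp: subset_iff\<close>)
        show "0 \<le> S" using f by (rule has_sum_nonneg)
        show "0 \<le> sum g (snd ` F)" by (intro sum_nonneg) (use F g in \<open>auto simp: subset_iff\<close>)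
      qed
      finally show ?thesis .
    qed
    then show "bdd_above (sum (\<lambda>(x, y). f x * g y) ` {F. F \<subseteq> A \<times> B \<and> finite F})"
      by (intro bdd_aboveI[of _ "S * T"]) auto
  qed (use f g in auto)
qed

text \<open>
  The sum of \<open>exp (- t * \<lambda>)\<close> over the eigenvalues \<open>\<lambda>\<close> of the plate operator: one theta function
  for each periodic direction, and half of a theta function without its zero mode for the
  Dirichlet direction. \<open>heat_main\<close> is its singular part at short times, with the volume term and
  the plate term; powers of \<open>1 / sqrt t\<close> keep the half-integer exponents polynomial.
\<close>

definition heat_trace :: "real \<Rightarrow> real \<Rightarrow> real \<Rightarrow> real" where
  "heat_trace L a t = (theta ((2 * pi / L)\<^sup>2 * t))\<^sup>2 * ((theta ((pi / a)\<^sup>2 * t) - 1) / 2)"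

definition heat_main :: "real \<Rightarrow> real \<Rightarrow> real \<Rightarrow> real" where
  "heat_main L a t = L\<^sup>2 / (8 * pi) * (a / sqrt pi * (1 / sqrt t) ^ 3 - (1 / sqrt t)\<^sup>2)"

definition heat_error :: "real \<Rightarrow> real \<Rightarrow> real \<Rightarrow> real" where
  "heat_error L a t = heat_trace L a t - heat_main L a t"

lemma eigval_pos:
  assumes "L > 0" "a > 0" "j \<in> modes"
  shows "eigval L a j > 0"
  using assms by (cases j) (auto simp: modes_def eigval_def intro!: add_nonneg_pos)

lemma has_sum_heat_trace:
  assumes "L > 0" "a > 0" "t > 0"
  shows "((\<lambda>j. exp (- t * eigval L a j)) has_sum heat_trace L a t) modes"
proof -
  have m: "((\<lambda>m. exp (- (of_int m)\<^sup>2 * ((2 * pi / L)\<^sup>2 * t))) has_sum theta ((2 * pi / L)\<^sup>2 * t))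
    UNIV"
    using assms by (intro has_sum_theta) auto
  have r: "((\<lambda>r. exp (- (real r)\<^sup>2 * ((pi / a)\<^sup>2 * t))) has_sum (theta ((pi / a)\<^sup>2 * t) - 1) / 2)
    {1..}"
  proof -
    have "((\<lambda>n. exp (- (real (Suc n))\<^sup>2 * ((pi / a)\<^sup>2 * t)))
      has_sum (theta ((pi / a)\<^sup>2 * t) - 1) / 2) UNIV"
    proof (rule sums_nonneg_imp_has_sum)
      show "(\<lambda>n. exp (- (real (Suc n))\<^sup>2 * ((pi / a)\<^sup>2 * t)))
        sums ((theta ((pi / a)\<^sup>2 * t) - 1) / 2)"
        unfolding theta_def using summable_sums[OF summable_theta[of "(pi / a)\<^sup>2 * t"]] assms
        by (simp del: of_nat_Suc)
    qed simp
    moreover have "bij_betw Suc UNIV {1..}"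
      by (rule bij_betwI[where g="\<lambda>k. k - 1"]) auto
    ultimately show ?thesis
      using has_sum_reindex_bij_betw[of Suc UNIV "{1..}"
        "\<lambda>r. exp (- (real r)\<^sup>2 * ((pi / a)\<^sup>2 * t))"] by simp
  qed
  have "((\<lambda>(m, r). (case m of (m1, m2) \<Rightarrow> exp (- (of_int m1)\<^sup>2 * ((2 * pi / L)\<^sup>2 * t)) * exp
    (- (of_int m2)\<^sup>2 * ((2 * pi / L)\<^sup>2 * t)))
      * exp (- (real r)\<^sup>2 * ((pi / a)\<^sup>2 * t)))
      has_sum (theta ((2 * pi / L)\<^sup>2 * t) * theta ((2 * pi / L)\<^sup>2 * t)) *
        ((theta ((pi / a)\<^sup>2 * t) - 1) / 2)) ((UNIV \<times> UNIV) \<times> {1..})"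
    by (intro has_sum_product_nonneg m r) auto
  also have "?this \<longleftrightarrow> ?thesis"
    unfolding heat_trace_def modes_def
    by (rule has_sum_cong[THEN trans])
      (auto simp: eigval_def exp_add[symmetric] power_mult_distrib power_divide algebra_simps
        power2_eq_square add_divide_distrib)
  finally show ?thesis .
qed

lemma heat_trace_nonneg:
  assumes "L > 0" "a > 0" "t > 0"
  shows "0 \<le> heat_trace L a t"
  unfolding heat_trace_def using theta_ge_1[of "(pi / a)\<^sup>2 * t"] assms by auto

lemma heat_trace_antimono:
  assumes "L > 0" "a > 0" "0 < s" "s \<le> t"
  shows "heat_trace L a t \<le> heat_trace L a s"
  unfolding heat_trace_def
proof (rule mult_mono)
  have "theta ((2 * pi / L)\<^sup>2 * t) \<le> theta ((2 * pi / L)\<^sup>2 * s)"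
    "theta ((pi / a)\<^sup>2 * t) \<le> theta ((pi / a)\<^sup>2 * s)"
    using assms by (intro theta_antimono mult_left_mono; simp)+
  moreover have "1 \<le> theta ((2 * pi / L)\<^sup>2 * t)" "1 \<le> theta ((pi / a)\<^sup>2 * t)"
    using assms by (intro theta_ge_1; simp)+
  ultimately show "(theta ((2 * pi / L)\<^sup>2 * t))\<^sup>2 \<le> (theta ((2 * pi / L)\<^sup>2 * s))\<^sup>2"
    "(theta ((pi / a)\<^sup>2 * t) - 1) / 2 \<le> (theta ((pi / a)\<^sup>2 * s) - 1) / 2"
    "0 \<le> (theta ((pi / a)\<^sup>2 * t) - 1) / 2"
    by (auto intro!: power_mono)
qed auto

text \<open>
  The three theta functions are transformed. Replacing all of them by \<open>1\<close> on the right-hand side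
  gives \<open>heat_main\<close>.
\<close>

lemma heat_trace_dual:
  assumes "L > 0" "a > 0" "t > 0"
  shows "heat_trace L a t = L\<^sup>2 / (8 * pi) * ((1 / sqrt t)\<^sup>2 * (theta (L\<^sup>2 / (4 * t)))\<^sup>2
    * (a / sqrt pi * (1 / sqrt t) * theta (a\<^sup>2 / t) - 1))"
proof -
  have "theta ((2 * pi / L)\<^sup>2 * t) = sqrt (pi / ((2 * pi / L)\<^sup>2 * t)) * theta
    (pi\<^sup>2 / ((2 * pi / L)\<^sup>2 * t))"
    using assms by (intro theta_transformation) auto
  moreover have "pi\<^sup>2 / ((2 * pi / L)\<^sup>2 * t) = L\<^sup>2 / (4 * t)"
    using assms by (simp add: power_divide power_mult_distrib)
  moreover have "pi / ((2 * pi / L)\<^sup>2 * t) = L\<^sup>2 / (4 * pi * t)"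
    using assms by (simp add: power_divide power_mult_distrib power2_eq_square)
  ultimately have 1: "(theta ((2 * pi / L)\<^sup>2 * t))\<^sup>2
    = L\<^sup>2 / (4 * pi * t) * (theta (L\<^sup>2 / (4 * t)))\<^sup>2"
    using assms by (simp add: power_mult_distrib)
  have "theta ((pi / a)\<^sup>2 * t) = sqrt (pi / ((pi / a)\<^sup>2 * t)) * theta (pi\<^sup>2 / ((pi / a)\<^sup>2 * t))"
    using assms by (intro theta_transformation) auto
  moreover have "pi\<^sup>2 / ((pi / a)\<^sup>2 * t) = a\<^sup>2 / t"
    using assms by (simp add: power_divide)
  moreover have "pi / ((pi / a)\<^sup>2 * t) = a\<^sup>2 / (pi * t)"
    using assms by (simp add: power_divide power2_eq_square)
  ultimately have 2: "theta ((pi / a)\<^sup>2 * t) = a / sqrt pi * (1 / sqrt t) * theta (a\<^sup>2 / t)"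
    using assms by (simp add: real_sqrt_divide real_sqrt_mult)
  show ?thesis unfolding heat_trace_def 1 2 using assms by (simp add: power_divide)
qed

lemma heat_error_eq:
  assumes "L > 0" "a > 0" "t > 0"
  shows "heat_error L a t = L\<^sup>2 / (8 * pi) * (1 / sqrt t)\<^sup>2 *
    (a / sqrt pi * (1 / sqrt t) * ((theta (L\<^sup>2 / (4 * t)))\<^sup>2 * theta (a\<^sup>2 / t) - 1) -
      ((theta (L\<^sup>2 / (4 * t)))\<^sup>2 - 1))"
proof -
  define w where "w = 1 / sqrt t"
  define A where "A = theta (L\<^sup>2 / (4 * t))"
  define B where "B = theta (a\<^sup>2 / t)"
  show ?thesis
    unfolding heat_error_def heat_main_def heat_trace_dual[OF assms]
      w_def[symmetric] A_def[symmetric] B_def[symmetric]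
    by (simp add: algebra_simps power2_eq_square power3_eq_cube diff_divide_distrib
      add_divide_distrib)
qed

lemma area_coefficient_le: "L\<^sup>2 / (8 * pi) \<le> L\<^sup>2" for L :: real
proof -
  have "L\<^sup>2 * 1 \<le> L\<^sup>2 * (8 * pi)" using pi_ge_two by (intro mult_left_mono) auto
  then show ?thesis by (simp add: divide_le_eq)
qed

lemma heat_main_bound:
  assumes "a > 0" "0 < t" "t \<le> 1"
  shows "\<bar>heat_main L a t\<bar> \<le> L\<^sup>2 * (a + 1) / t\<^sup>2"
proof -
  define w where "w = 1 / sqrt t"
  have w: "w \<ge> 1" "w\<^sup>2 = 1 / t" using assms by (auto simp: w_def power_divide)
  have w4: "w ^ 4 = 1 / t\<^sup>2" using w(2) by (simp add: power2_eq_square power4_eq_xxxx)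
  have "\<bar>a / sqrt pi * w ^ 3 - w\<^sup>2\<bar> \<le> a / sqrt pi * w ^ 3 + w\<^sup>2"
    using assms w by (intro order_trans[OF abs_triangle_ineq4]) auto
  also have "\<dots> \<le> a * w ^ 4 + 1 * w ^ 4"
  proof (intro add_mono mult_mono)
    show "a / sqrt pi \<le> a" using assms pi_ge_two by (simp add: divide_le_eq)
    show "w ^ 3 \<le> w ^ 4" using w(1) by (auto intro: power_increasing)
    show "w\<^sup>2 \<le> 1 * w ^ 4" using w(1) power_increasing[of 2 4 w] by simp
  qed (use assms w in auto)
  finally have "\<bar>a / sqrt pi * w ^ 3 - w\<^sup>2\<bar> \<le> (a + 1) / t\<^sup>2"
    unfolding w4 by (simp add: add_divide_distrib)
  moreover have "L\<^sup>2 / (8 * pi) \<le> L\<^sup>2 * 1"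
    using area_coefficient_le by simp
  ultimately have "L\<^sup>2 / (8 * pi) * \<bar>a / sqrt pi * w ^ 3 - w\<^sup>2\<bar> \<le> (L\<^sup>2 * 1) * ((a + 1) / t\<^sup>2)"
    by (intro mult_mono) auto
  then show ?thesis unfolding heat_main_def w_def[symmetric] by (simp add: abs_mult)
qed

lemma heat_main_bound_large:
  assumes "a > 0" "1 \<le> t"
  shows "\<bar>heat_main L a t\<bar> \<le> L\<^sup>2 * (a + 1)"
proof -
  define w where "w = 1 / sqrt t"
  have w: "0 \<le> w" "w \<le> 1" using assms by (auto simp: w_def)
  have "\<bar>a / sqrt pi * w ^ 3 - w\<^sup>2\<bar> \<le> a / sqrt pi * w ^ 3 + w\<^sup>2"
    using assms w by (intro order_trans[OF abs_triangle_ineq4]) auto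
  also have "\<dots> \<le> a * 1 + 1"
  proof (intro add_mono mult_mono)
    show "a / sqrt pi \<le> a" using assms pi_ge_two by (simp add: divide_le_eq)
  qed (use assms w in \<open>auto intro: power_le_one\<close>)
  finally have "\<bar>a / sqrt pi * w ^ 3 - w\<^sup>2\<bar> \<le> a + 1" by simp
  moreover have "L\<^sup>2 / (8 * pi) \<le> L\<^sup>2 * 1"
    using area_coefficient_le by simp
  ultimately have "L\<^sup>2 / (8 * pi) * \<bar>a / sqrt pi * w ^ 3 - w\<^sup>2\<bar> \<le> (L\<^sup>2 * 1) * (a + 1)"
    by (intro mult_mono) auto
  then show ?thesis unfolding heat_main_def w_def[symmetric] by (simp add: abs_mult)
qed

text \<open>
  At short times the brackets in \<open>heat_error_eq\<close> are made of differences \<open>theta - 1\<close> at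
  arguments of at least \<open>a\<^sup>2 / (4 * t)\<close>, which are smaller than any power of \<open>t\<close>; the exponent
  \<open>11\<close> makes up for the singular prefactor \<open>1 / t\<^sup>2\<close>. At long times the heat trace decreases and
  the main part is bounded. The bound is uniform in \<open>L\<close> per unit area, which is what the
  large-area limit requires.
\<close>

lemma heat_error_bound:
  assumes a: "a > 0"
  shows "\<exists>C>0. \<forall>L\<ge>a. \<forall>t>0. \<bar>heat_error L a t\<bar> \<le> C * L\<^sup>2 * min (t ^ 9) 1"
proof -
  obtain C1 where C1: "C1 > 0" "\<And>s. s > 0 \<Longrightarrow> theta s - 1 \<le> C1 / s ^ 11"
    using theta_minus_1_le[of 11] by auto
  define c where "c = C1 * (4 / a\<^sup>2) ^ 11"
  have c: "c > 0" using C1 a by (simp add: c_def)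
  define c2 where "c2 = c * (2 + c) * (1 + c) + c"
  have c2: "c2 > 0" "c * (2 + c) \<le> c2" using c
    by (auto simp: c2_def field_simps intro!: add_pos_pos)
  define C where "C = (a + 1) * c2"
  have small: "\<bar>heat_error L a t\<bar> \<le> C * L\<^sup>2 * t ^ 9" if L: "L \<ge> a" and t: "0 < t" "t \<le> 1" for L t
  proof -
    have L0: "L > 0" using L a by simp
    define A where "A = theta (L\<^sup>2 / (4 * t))"
    define B where "B = theta (a\<^sup>2 / t)"
    have t11: "t ^ 11 \<le> 1" "0 < t ^ 11" using t by (auto intro: power_le_one)
    have base: "theta (a\<^sup>2 / (4 * t)) - 1 \<le> c * t ^ 11"
      using C1(2)[of "a\<^sup>2 / (4 * t)"] a t by (simp add: c_def power_divide power_mult_distrib)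
    have LA: "a\<^sup>2 / (4 * t) \<le> L\<^sup>2 / (4 * t)" using L a t
      by (intro divide_right_mono power_mono) auto
    have LB: "a\<^sup>2 / (4 * t) \<le> a\<^sup>2 / t" using a t by (intro divide_left_mono) auto
    have A: "1 \<le> A" "A \<le> 1 + c * t ^ 11"
      unfolding A_def using theta_ge_1[of "L\<^sup>2 / (4 * t)"] theta_antimono[OF _ LA] base a t L0
        by auto
    have B: "1 \<le> B" "B \<le> 1 + c * t ^ 11"
      unfolding B_def using theta_ge_1[of "a\<^sup>2 / t"] theta_antimono[OF _ LB] base a t by auto
    have ct: "c * t ^ 11 \<le> c" using c t11 by (simp add: mult_left_le)
    have Ac: "A \<le> 1 + c" and Bc: "B \<le> 1 + c" using A B ct by linarith+
    have A2: "A\<^sup>2 - 1 \<le> c * t ^ 11 * (2 + c)"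
    proof -
      have "A\<^sup>2 - 1 = (A - 1) * (A + 1)" by (simp add: power2_eq_square algebra_simps)
      also have "\<dots> \<le> (c * t ^ 11) * (2 + c)" using A Ac c t11 by (intro mult_mono) auto
      finally show ?thesis .
    qed
    have A2': "A\<^sup>2 \<ge> 1" using A by simp
    have AB: "A\<^sup>2 * B - 1 \<le> c2 * t ^ 11" "A\<^sup>2 * B - 1 \<ge> 0"
    proof -
      have "A\<^sup>2 * B - 1 = (A\<^sup>2 - 1) * B + (B - 1)" by (simp add: algebra_simps)
      also have "\<dots> \<le> (c * t ^ 11 * (2 + c)) * (1 + c) + c * t ^ 11"
        using A2 A2' B Bc c t11 by (intro add_mono mult_mono) auto
      also have "\<dots> = c2 * t ^ 11" by (simp add: c2_def algebra_simps)
      finally show "A\<^sup>2 * B - 1 \<le> c2 * t ^ 11" .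
      have "1 * 1 \<le> A\<^sup>2 * B" using A2' B by (intro mult_mono) auto
      then show "A\<^sup>2 * B - 1 \<ge> 0" by simp
    qed
    have A2'': "A\<^sup>2 - 1 \<le> c2 * t ^ 11"
    proof -
      have "c * t ^ 11 * (2 + c) = c * (2 + c) * t ^ 11" by simp
      then show ?thesis using A2 t11 mult_right_mono[OF c2(2), of "t ^ 11"] by linarith
    qed
    define w where "w = 1 / sqrt t"
    have w2: "w\<^sup>2 = 1 / t" and w1: "w \<ge> 1" using t by (auto simp: w_def power_divide)
    have "w \<le> w\<^sup>2" using w1 by (simp add: power2_eq_square)
    then have w3: "0 \<le> w" "w \<le> 1 / t" using w1 unfolding w2 by simp_all
    have api: "0 \<le> a / sqrt pi" "a / sqrt pi \<le> a" using a pi_ge_two by (auto simp: divide_le_eq)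
    have "\<bar>a / sqrt pi * w * (A\<^sup>2 * B - 1) - (A\<^sup>2 - 1)\<bar>
      \<le> a / sqrt pi * w * (A\<^sup>2 * B - 1) + (A\<^sup>2 - 1)"
      using AB A2' api w3 by (intro order_trans[OF abs_triangle_ineq4]) (simp add: abs_mult)
    also have "\<dots> \<le> a * (1 / t) * (c2 * t ^ 11) + 1 * (1 / t) * (c2 * t ^ 11)"
    proof (intro add_mono)
      show "a / sqrt pi * w * (A\<^sup>2 * B - 1) \<le> a * (1 / t) * (c2 * t ^ 11)"
        using api w3 AB a t by (intro mult_mono mult_nonneg_nonneg) auto
      have "1 * (c2 * t ^ 11) \<le> (1 / t) * (c2 * t ^ 11)"
        using t c2 by (intro mult_right_mono) auto
      then show "A\<^sup>2 - 1 \<le> 1 * (1 / t) * (c2 * t ^ 11)" using A2'' by linarith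
    qed
    also have "\<dots> = C * t ^ 10"
      using t by (simp add: C_def field_simps eval_nat_numeral)
    finally have X: "\<bar>a / sqrt pi * w * (A\<^sup>2 * B - 1) - (A\<^sup>2 - 1)\<bar> \<le> C * t ^ 10" .
    have Lw: "L\<^sup>2 / (8 * pi) * w\<^sup>2 \<le> L\<^sup>2 * (1 / t)"
      unfolding w2 using area_coefficient_le t by (intro mult_right_mono) auto
    have "(L\<^sup>2 / (8 * pi) * w\<^sup>2) * \<bar>a / sqrt pi * w * (A\<^sup>2 * B - 1) - (A\<^sup>2 - 1)\<bar>
      \<le> (L\<^sup>2 * (1 / t)) * (C * t ^ 10)"
      using t by (intro mult_mono[OF Lw X]) auto
    also have "\<dots> = C * L\<^sup>2 * t ^ 9" using t by (simp add: field_simps eval_nat_numeral)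
    finally show ?thesis
      unfolding heat_error_eq[OF L0 a t(1)] w_def[symmetric] A_def[symmetric] B_def[symmetric]
      by (simp add: abs_mult)
  qed
  define C' where "C' = C + 2 * (a + 1)"
  have C: "C > 0" "C \<le> C'" "C' > 0" using a c2 by (auto simp: C_def C'_def intro!: add_pos_pos)
  have "\<bar>heat_error L a t\<bar> \<le> C' * L\<^sup>2 * min (t ^ 9) 1" if L: "L \<ge> a" and t: "t > 0" for L t
  proof (cases "t \<le> 1")
    case True
    have "t ^ 9 \<le> 1" using t True by (intro power_le_one) auto
    moreover have "C * L\<^sup>2 * t ^ 9 \<le> C' * L\<^sup>2 * t ^ 9"
      using C t by (intro mult_right_mono) auto
    ultimately show ?thesis using small[OF L t True] by simp
  next
    case False
    have L0: "L > 0" using L a by simp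
    have "heat_trace L a t \<le> heat_trace L a 1"
      using False L0 a by (intro heat_trace_antimono) auto
    moreover have "0 \<le> heat_trace L a t" using L0 a t by (rule heat_trace_nonneg)
    moreover have "\<bar>heat_error L a 1\<bar> \<le> C * L\<^sup>2" using small[OF L, of 1] by simp
    moreover have "\<bar>heat_main L a 1\<bar> \<le> L\<^sup>2 * (a + 1)" "\<bar>heat_main L a t\<bar> \<le> L\<^sup>2 * (a + 1)"
      using a False by (auto intro!: heat_main_bound_large)
    moreover have "C' * L\<^sup>2 = C * L\<^sup>2 + 2 * (L\<^sup>2 * (a + 1))" by (simp add: C'_def algebra_simps)
    moreover have "1 \<le> t ^ 9" using False by (intro one_le_power) auto
    ultimately show ?thesis unfolding heat_error_def by (simp add: min_def)
  qed
  then show ?thesis using C by blast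
qed

text \<open>
  Each mode is Lipschitz with constant \<open>\<lambda> * exp (- \<tau> * \<lambda>)\<close>, and half of the exponential pays for
  the factor \<open>\<lambda>\<close>.
\<close>

lemma heat_trace_Lipschitz:
  assumes "L > 0" "a > 0" "\<tau> > 0" "t \<ge> 0"
  shows "0 \<le> heat_trace L a \<tau> - heat_trace L a (\<tau> + t)"
    "heat_trace L a \<tau> - heat_trace L a (\<tau> + t) \<le> 2 * t / \<tau> * heat_trace L a (\<tau> / 2)"
proof -
  have d: "((\<lambda>j. exp (- \<tau> * eigval L a j) - exp (- (\<tau> + t) * eigval L a j)) has_sum
      (heat_trace L a \<tau> - heat_trace L a (\<tau> + t))) modes"
    using has_sum_add[OF has_sum_heat_trace[of L a \<tau>]
      has_sum_uminusI[OF has_sum_heat_trace[of L a "\<tau> + t"]]] assms by simp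
  have u: "((\<lambda>j. 2 * t / \<tau> * exp (- (\<tau> / 2) * eigval L a j))
    has_sum (2 * t / \<tau> * heat_trace L a (\<tau> / 2))) modes"
    using assms by (intro has_sum_cmult_right has_sum_heat_trace) auto
  show "0 \<le> heat_trace L a \<tau> - heat_trace L a (\<tau> + t)"
    using heat_trace_antimono[of L a \<tau> "\<tau> + t"] assms by simp
  show "heat_trace L a \<tau> - heat_trace L a (\<tau> + t) \<le> 2 * t / \<tau> * heat_trace L a (\<tau> / 2)"
  proof (rule has_sum_mono[OF d u])
    fix j assume "j \<in> modes"
    then have l: "eigval L a j > 0" using assms by (intro eigval_pos)
    define l where "l = eigval L a j"
    have l: "l > 0" using l by (simp add: l_def)
    have "exp (- \<tau> * l) - exp (- (\<tau> + t) * l) = exp (- \<tau> * l) * (1 - exp (- t * l))"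
      by (simp add: algebra_simps exp_add[symmetric] exp_diff)
    also have "\<dots> \<le> exp (- \<tau> * l) * (t * l)"
      using exp_ge_add_one_self[of "- t * l"] by (intro mult_left_mono) auto
    also have "\<dots> = (exp (- (\<tau> / 2) * l) * (\<tau> / 2 * l)) * (2 * t / \<tau> * exp (- (\<tau> / 2) * l))"
      using assms by (simp add: field_simps exp_add[symmetric])
    also have "\<dots> \<le> 1 * (2 * t / \<tau> * exp (- (\<tau> / 2) * l))"
    proof (rule mult_right_mono)
      have "exp (- (\<tau> / 2 * l)) \<le> fact 1 / (\<tau> / 2 * l) ^ 1" using assms l
        by (intro exp_minus_le) auto
      then have "exp (- (\<tau> / 2 * l)) * (\<tau> / 2 * l) \<le> 1"
        using assms l by (simp add: pos_le_divide_eq)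
      then show "exp (- (\<tau> / 2) * l) * (\<tau> / 2 * l) \<le> 1" by simp
    qed (use assms in auto)
    finally show "exp (- \<tau> * eigval L a j) - exp (- (\<tau> + t) * eigval L a j)
      \<le> 2 * t / \<tau> * exp (- (\<tau> / 2) * eigval L a j)"
      by (simp add: l_def)
  qed
qed

lemma heat_main_Lipschitz:
  assumes "a > 0" "0 < \<tau>" "\<tau> \<le> 1" "t \<ge> 0"
  shows "\<bar>heat_main L a \<tau> - heat_main L a (\<tau> + t)\<bar> \<le> L\<^sup>2 * (3 * a + 1) * t / \<tau> ^ 3"
proof -
  define u where "u = 1 / sqrt \<tau>"
  define v where "v = 1 / sqrt (\<tau> + t)"
  have v: "0 < v" "v \<le> u" and u: "1 \<le> u" using assms
    by (auto simp: u_def v_def intro!: divide_left_mono)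
  have u2: "u\<^sup>2 = 1 / \<tau>" "v\<^sup>2 = 1 / (\<tau> + t)" using assms by (auto simp: u_def v_def power_divide)
  have q: "0 \<le> u\<^sup>2 - v\<^sup>2" "u\<^sup>2 - v\<^sup>2 \<le> t * u ^ 4"
  proof -
    show "0 \<le> u\<^sup>2 - v\<^sup>2" using v by (simp add: power_mono)
    have "u\<^sup>2 - v\<^sup>2 = t / (\<tau> * (\<tau> + t))" unfolding u2 using assms by (simp add: field_simps)
    also have "\<dots> \<le> t / (\<tau> * \<tau>)" using assms by (intro divide_left_mono mult_left_mono) auto
    also have "\<dots> = t * u ^ 4" using u2(1) by (simp add: power4_eq_xxxx power2_eq_square)
    finally show "u\<^sup>2 - v\<^sup>2 \<le> t * u ^ 4" .
  qed
  have c: "0 \<le> u ^ 3 - v ^ 3" "u ^ 3 - v ^ 3 \<le> 3 * (t * u ^ 6)"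
  proof -
    show "0 \<le> u ^ 3 - v ^ 3" using v by (simp add: power_mono)
    have "u * (u - v) \<le> (u + v) * (u - v)" using v by (intro mult_right_mono) auto
    then have "u * (u - v) \<le> u\<^sup>2 - v\<^sup>2" by (simp add: power2_eq_square algebra_simps)
    then have *: "u * (u - v) \<le> t * u ^ 4" using q by linarith
    have "u ^ 3 - v ^ 3 = (u - v) * (u * u + u * v + v * v)"
      by (simp add: power3_eq_cube algebra_simps)
    also have "\<dots> \<le> (u - v) * (u * u + u * u + u * u)" using v
      by (intro mult_left_mono add_mono mult_mono) auto
    also have "\<dots> = 3 * (u * (u * (u - v)))" by (simp add: algebra_simps)
    also have "\<dots> \<le> 3 * (u * (t * u ^ 4))" using * u by (intro mult_left_mono) auto
    also have "\<dots> = 3 * (t * u ^ 5)" by (simp add: eval_nat_numeral)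
    also have "\<dots> \<le> 3 * (t * u ^ 6)" using u assms by (intro mult_left_mono power_increasing) auto
    finally show "u ^ 3 - v ^ 3 \<le> 3 * (t * u ^ 6)" .
  qed
  have u46: "u ^ 4 \<le> u ^ 6" using u by (intro power_increasing) auto
  have u6: "u ^ 6 = 1 / \<tau> ^ 3"
  proof -
    have "u ^ 6 = (u\<^sup>2) ^ 3" by (simp add: power_mult[symmetric])
    then show ?thesis unfolding u2 by (simp add: power_divide)
  qed
  have api: "0 \<le> a / sqrt pi" "a / sqrt pi \<le> a" using assms pi_ge_two by (auto simp: divide_le_eq)
  have "\<bar>a / sqrt pi * (u ^ 3 - v ^ 3) - (u\<^sup>2 - v\<^sup>2)\<bar> \<le> a / sqrt pi * (u ^ 3 - v ^ 3) + (u\<^sup>2 - v\<^sup>2)"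
    using api c q by (intro order_trans[OF abs_triangle_ineq4]) (simp add: abs_mult)
  also have "\<dots> \<le> a * (3 * (t * u ^ 6)) + t * u ^ 6"
    using api c q assms mult_left_mono[OF u46, of t] by (intro add_mono mult_mono) auto
  also have "\<dots> = (3 * a + 1) * t / \<tau> ^ 3" unfolding u6
    by (simp add: algebra_simps add_divide_distrib)
  finally have X: "\<bar>a / sqrt pi * (u ^ 3 - v ^ 3) - (u\<^sup>2 - v\<^sup>2)\<bar> \<le> (3 * a + 1) * t / \<tau> ^ 3" .
  have "L\<^sup>2 / (8 * pi) \<le> L\<^sup>2" by (rule area_coefficient_le)
  then have "L\<^sup>2 / (8 * pi) * \<bar>a / sqrt pi * (u ^ 3 - v ^ 3) - (u\<^sup>2 - v\<^sup>2)\<bar>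
    \<le> L\<^sup>2 * ((3 * a + 1) * t / \<tau> ^ 3)"
    using X by (intro mult_mono) auto
  moreover have "heat_main L a \<tau> - heat_main L a (\<tau> + t)
    = L\<^sup>2 / (8 * pi) * (a / sqrt pi * (u ^ 3 - v ^ 3) - (u\<^sup>2 - v\<^sup>2))"
    unfolding heat_main_def u_def[symmetric] v_def[symmetric] by (simp add: algebra_simps)
  ultimately show ?thesis by (simp add: abs_mult)
qed

text \<open>
  For \<open>t \<ge> \<tau>\<close> both values are at most a multiple of \<open>t powr (3/4)\<close> by \<open>heat_error_bound\<close>. For
  \<open>t \<le> \<tau>\<close> the crude Lipschitz bound \<open>t / \<tau> ^ 3\<close> and the bound \<open>\<tau> ^ 9\<close> on the values are
  interpolated with weights \<open>3/4\<close> and \<open>1/4\<close>, which cancels the powers of \<open>\<tau>\<close>. The resulting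
  bound does not depend on \<open>\<tau>\<close>, and with \<open>t = 1 / x\<^sup>2\<close> it is integrable over \<open>x\<close> because
  \<open>2 * 3/4 > 1\<close>.
\<close>

lemma heat_error_increment:
  assumes a: "a > 0" and L: "L \<ge> a"
  shows "\<exists>C>0. \<forall>\<tau> t. 0 < \<tau> \<longrightarrow> \<tau> \<le> 1 \<longrightarrow> 0 \<le> t \<longrightarrow>
    \<bar>heat_error L a \<tau> - heat_error L a (\<tau> + t)\<bar> \<le> C * min (t powr (3/4)) 1"
proof -
  have L0: "L > 0" using a L by simp
  obtain c where c: "c > 0" "\<And>t. t > 0 \<Longrightarrow> \<bar>heat_error L a t\<bar> \<le> c * L\<^sup>2 * min (t ^ 9) 1"
    using heat_error_bound[OF a] L by blast
  define b where "b = c * L\<^sup>2"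
  have b: "b > 0" "\<And>t. t > 0 \<Longrightarrow> \<bar>heat_error L a t\<bar> \<le> b * t ^ 9" "\<And>t. t > 0 \<Longrightarrow> \<bar>heat_error L a t\<bar> \<le> b"
  proof -
    show b0: "b > 0" using c L0 by (simp add: b_def)
    fix t :: real assume "t > 0"
    then have "\<bar>heat_error L a t\<bar> \<le> b * min (t ^ 9) 1" using c by (simp add: b_def)
    moreover have "b * min (t ^ 9) 1 \<le> b * t ^ 9" "b * min (t ^ 9) 1 \<le> b * 1"
      using b0 by (intro mult_left_mono; simp)+
    ultimately show "\<bar>heat_error L a t\<bar> \<le> b * t ^ 9" "\<bar>heat_error L a t\<bar> \<le> b" by simp_all
  qed
  define p where "p = 2 * (4 * (L\<^sup>2 * (a + 1)) + b) + L\<^sup>2 * (3 * a + 1)"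
  define C where "C = max p (1024 * b)"
  have C: "C \<ge> p" "C \<ge> 1024 * b" "C > 0" using b by (auto simp: C_def)
  have p0: "p \<ge> 0" using a b by (simp add: p_def)
  have "\<bar>heat_error L a \<tau> - heat_error L a (\<tau> + t)\<bar> \<le> C * min (t powr (3/4)) 1"
    if \<tau>: "0 < \<tau>" "\<tau> \<le> 1" and t: "t \<ge> 0" for \<tau> t
  proof -
    define d where "d = \<bar>heat_error L a \<tau> - heat_error L a (\<tau> + t)\<bar>"
    have d0: "d \<ge> 0" by (simp add: d_def)
    have d_tri: "d \<le> \<bar>heat_error L a \<tau>\<bar> + \<bar>heat_error L a (\<tau> + t)\<bar>"
      unfolding d_def by (rule abs_triangle_ineq4)
    have d1: "d \<le> 2 * b" using d_tri b(3)[of \<tau>] b(3)[of "\<tau> + t"] \<tau> t by simp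
    have d2: "d \<le> C * t powr (3/4)"
    proof (cases "t \<le> \<tau>")
      case True
      have "heat_trace L a (\<tau> / 2) \<le> (4 * (L\<^sup>2 * (a + 1)) + b) / \<tau>\<^sup>2"
      proof -
        have "\<bar>heat_main L a (\<tau> / 2)\<bar> \<le> L\<^sup>2 * (a + 1) / (\<tau> / 2)\<^sup>2"
          using a \<tau> by (intro heat_main_bound) auto
        also have "\<dots> = 4 * (L\<^sup>2 * (a + 1)) / \<tau>\<^sup>2" by (simp add: power_divide)
        finally have "\<bar>heat_main L a (\<tau> / 2)\<bar> \<le> 4 * (L\<^sup>2 * (a + 1)) / \<tau>\<^sup>2" .
        moreover have "\<bar>heat_error L a (\<tau> / 2)\<bar> \<le> b" using b \<tau> by simp
        moreover have "b * \<tau>\<^sup>2 \<le> b" using b \<tau> by (simp add: mult_left_le power_le_one)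
        then have "b \<le> b / \<tau>\<^sup>2" using \<tau> by (simp add: pos_le_divide_eq)
        moreover have "heat_trace L a (\<tau> / 2) = heat_main L a (\<tau> / 2) + heat_error L a (\<tau> / 2)"
          by (simp add: heat_error_def)
        ultimately show ?thesis by (simp add: add_divide_distrib)
      qed
      then have K: "2 * t / \<tau> * heat_trace L a (\<tau> / 2)
        \<le> 2 * t / \<tau> * ((4 * (L\<^sup>2 * (a + 1)) + b) / \<tau>\<^sup>2)"
        using t \<tau> by (intro mult_left_mono) auto
      have "\<bar>heat_trace L a \<tau> - heat_trace L a (\<tau> + t)\<bar> \<le> 2 * (4 * (L\<^sup>2 * (a + 1)) + b) * t / \<tau> ^ 3"
      proof -
        have eq: "2 * t / \<tau> * (X / \<tau>\<^sup>2) = 2 * X * t / \<tau> ^ 3" for X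
          by (simp add: power2_eq_square power3_eq_cube mult_ac)
        show ?thesis
          using heat_trace_Lipschitz[OF L0 a \<tau>(1) t] K[unfolded eq] by linarith
      qed
      moreover have "\<bar>heat_main L a \<tau> - heat_main L a (\<tau> + t)\<bar> \<le> L\<^sup>2 * (3 * a + 1) * t / \<tau> ^ 3"
        using a \<tau> t by (rule heat_main_Lipschitz)
      moreover have "d \<le> \<bar>heat_trace L a \<tau> - heat_trace L a (\<tau> + t)\<bar> + \<bar>heat_main L a \<tau> - heat_main
        L a (\<tau> + t)\<bar>"
        unfolding d_def heat_error_def by linarith
      moreover have "p * t / \<tau> ^ 3 = 2 * (4 * (L\<^sup>2 * (a + 1)) + b) * t / \<tau> ^ 3 + L\<^sup>2 * (3 * a + 1) *
        t / \<tau> ^ 3"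
        by (simp add: p_def distrib_right add_divide_distrib)
      ultimately have "d \<le> p * t / \<tau> ^ 3" by linarith
      also have "\<dots> \<le> C * t / \<tau> ^ 3" using C t \<tau> by (intro divide_right_mono mult_right_mono) auto
      finally have e1: "d \<le> C * t / \<tau> ^ 3" .
      have "\<bar>heat_error L a \<tau>\<bar> \<le> b * \<tau> ^ 9" using b \<tau> by simp
      moreover have "\<bar>heat_error L a (\<tau> + t)\<bar> \<le> b * (\<tau> + t) ^ 9" using b \<tau> t by simp
      moreover have "b * (\<tau> + t) ^ 9 \<le> b * (2 * \<tau>) ^ 9"
        using b True \<tau> t by (intro mult_left_mono power_mono) auto
      moreover have "b * (2 * \<tau>) ^ 9 = 512 * b * \<tau> ^ 9" by (simp add: power_mult_distrib)
      moreover have "0 \<le> b * \<tau> ^ 9" using b \<tau> by simp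
      ultimately have "d \<le> 1024 * b * \<tau> ^ 9" using d_tri by linarith
      also have "\<dots> \<le> C * \<tau> ^ 9" using C \<tau> by (intro mult_right_mono) auto
      finally have e2: "d \<le> C * \<tau> ^ 9" .
      \<comment> \<open>The interpolation: three factors of the Lipschitz bound against one of the size bound.\<close>
      have "d ^ 4 = d ^ 3 * d" by (simp add: eval_nat_numeral)
      also have "\<dots> \<le> (C * t / \<tau> ^ 3) ^ 3 * (C * \<tau> ^ 9)"
        using e1 e2 d0 C t \<tau> by (intro mult_mono power_mono) auto
      also have "\<dots> = C ^ 4 * t ^ 3"
        using \<tau> by (simp add: power_divide power_mult_distrib power_mult[symmetric])
          (simp add: eval_nat_numeral)
      also have "t ^ 3 = (t powr (3/4)) ^ 4"
      proof (cases "t = 0")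
        case False
        then have "(t powr (3/4)) ^ 4 = t powr 3" using t by (simp add: powr_power)
        then show ?thesis using False t by (simp add: powr_numeral)
      qed simp
      also have "C ^ 4 * \<dots> = (C * t powr (3/4)) ^ 4" by (simp add: power_mult_distrib)
      finally show ?thesis using C by (intro power_le_imp_le_base[of d 3]) auto
    next
      case False
      then have t0: "t > 0" using \<tau> by simp
      have m: "min (x ^ 9) 1 \<le> x powr (3/4)" if "x > 0" for x :: real
      proof (cases "x \<le> 1")
        case True
        have "x powr 9 \<le> x powr (3/4)" using True that by (intro powr_mono') auto
        then show ?thesis using that by (simp add: powr_numeral)
      next
        case False
        then show ?thesis by (simp add: ge_one_powr_ge_zero)
      qed
      have "\<bar>heat_error L a \<tau>\<bar> \<le> b * \<tau> powr (3/4)"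
        using c(2)[OF \<tau>(1)] m[OF \<tau>(1)] b(1) unfolding b_def[symmetric]
        by (meson mult_left_mono less_imp_le order_trans)
      also have "\<dots> \<le> b * t powr (3/4)" using False \<tau> b by (intro mult_left_mono powr_mono2) auto
      finally have h1: "\<bar>heat_error L a \<tau>\<bar> \<le> b * t powr (3/4)" .
      have "\<bar>heat_error L a (\<tau> + t)\<bar> \<le> b * (\<tau> + t) powr (3/4)"
        using c(2)[of "\<tau> + t"] m[of "\<tau> + t"] b(1) \<tau> t unfolding b_def[symmetric]
        by (meson mult_left_mono less_imp_le order_trans add_pos_nonneg)
      also have "\<dots> \<le> b * (2 * t) powr (3/4)" using False \<tau> t b
        by (intro mult_left_mono powr_mono2) auto
      also have "\<dots> \<le> b * (2 * t powr (3/4))"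
      proof -
        have "2 powr (3/4) \<le> 2 powr (1::real)" by (intro powr_mono) auto
        then show ?thesis using b t by (intro mult_left_mono)
          (auto simp: powr_mult intro!: mult_right_mono)
      qed
      finally have h2: "\<bar>heat_error L a (\<tau> + t)\<bar> \<le> 2 * (b * t powr (3/4))" by simp
      have "3 * b \<le> C" using C b by linarith
      then have "3 * b * t powr (3/4) \<le> C * t powr (3/4)" by (rule mult_right_mono) auto
      then show ?thesis using d_tri h1 h2 by linarith
    qed
    have "d \<le> C * 1" using d1 C b by linarith
    then show ?thesis using d2 C unfolding d_def by (simp add: min_def)
  qed
  then show ?thesis using C by blast
qed

lemma continuous_on_theta:
  assumes "b > 0"
  shows "continuous_on {b..} theta"
proof -
  have "continuous_on {b..} (\<lambda>s. \<Sum>n. exp (- (real (Suc n))\<^sup>2 * s))"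
  proof (rule uniform_limit_theorem)
    show "uniform_limit {b..} (\<lambda>N s. \<Sum>n<N. exp (- (real (Suc n))\<^sup>2 * s))
      (\<lambda>s. \<Sum>n. exp (- (real (Suc n))\<^sup>2 * s)) sequentially"
      using assms by (intro Weierstrass_m_test[where M="\<lambda>n. exp (- (real (Suc n))\<^sup>2 * b)"]
        summable_theta)
        (auto intro!: mult_left_mono simp del: of_nat_Suc)
  qed (auto intro!: always_eventually continuous_intros)
  then show ?thesis unfolding theta_def by (intro continuous_intros)
qed

lemma isCont_theta:
  assumes "s > 0"
  shows "isCont theta s"
  using continuous_on_theta[of "s / 2"] assms
  by (intro continuous_on_interior[of "{s/2..}"]) auto

lemma theta_measurable [measurable]: "theta \<in> borel_measurable borel"
  unfolding theta_def by measurable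

lemma heat_trace_measurable [measurable]: "heat_trace L a \<in> borel_measurable borel"
  unfolding heat_trace_def by measurable

lemma heat_main_measurable [measurable]: "heat_main L a \<in> borel_measurable borel"
  unfolding heat_main_def by measurable

lemma heat_error_measurable [measurable]: "heat_error L a \<in> borel_measurable borel"
  unfolding heat_error_def by measurable

lemma isCont_heat_error:
  assumes "L > 0" "a > 0" "t > 0"
  shows "isCont (heat_error L a) t"
proof -
  have th: "isCont (\<lambda>t. theta (k * t)) t" if "k > 0" for k
  proof (rule isCont_o2[where f="\<lambda>t. k * t" and g=theta])
    show "isCont theta (k * t)" using that assms by (intro isCont_theta) auto
  qed (intro continuous_intros)
  show ?thesis
    unfolding heat_error_def heat_trace_def heat_main_def
    by (rule continuous_intros th isCont_real_sqrt | use assms in \<open>simp; fail\<close>)+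
qed

section \<open>Square roots by subordination\<close>

text \<open>
  The square root of \<open>l\<close> as an integral of \<open>1 - exp (- l * t)\<close> over \<open>t = 1 / x\<^sup>2\<close>. Writing
  \<open>1 - exp (- l / x\<^sup>2)\<close> as the integral of \<open>2 * u * exp (- u\<^sup>2)\<close> over \<open>0 \<le> u \<le> sqrt l / \<bar>x\<bar>\<close> and
  integrating over \<open>x\<close> first leaves a Gaussian integral. At \<open>x = 0\<close>, where \<open>1 / x\<^sup>2\<close> is \<open>0\<close>, the
  integrand is \<open>0\<close> instead of \<open>1\<close>, on a null set.
\<close>

lemma integral_one_minus_exp:
  assumes l: "l > 0"
  shows "has_bochner_integral lborel (\<lambda>x::real. 1 - exp (- (l * (1 / x\<^sup>2)))) (2 * sqrt pi * sqrt l)"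
proof (rule has_bochner_integral_nn_integral)
  define f where "f x u = ennreal (2 * u * exp (- u\<^sup>2)) * indicator {0..} u * indicator {..sqrt l}
    (u * \<bar>x\<bar>)" for x u :: real
  have [measurable]: "(\<lambda>(x, u). f x u) \<in> borel_measurable (borel \<Otimes>\<^sub>M borel)"
    unfolding f_def by measurable
  have inner: "ennreal (1 - exp (- (l * (1 / x\<^sup>2)))) = (\<integral>\<^sup>+u. f x u \<partial>lborel)" if x: "x \<noteq> 0" for x
  proof -
    have "(\<integral>\<^sup>+u. f x u \<partial>lborel) = (\<integral>\<^sup>+u. ennreal (2 * u * exp (- u\<^sup>2)) * indicator {0..sqrt l / \<bar>x\<bar>}
      u \<partial>lborel)"
      using x by (intro nn_integral_cong) (auto simp: f_def indicator_def pos_le_divide_eq)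
    also have "\<dots> = ennreal (- exp (- (sqrt l / \<bar>x\<bar>)\<^sup>2) - - exp (- 0\<^sup>2))"
      using l by (intro nn_integral_FTC_Icc) (auto intro!: derivative_eq_intros)
    also have "(sqrt l / \<bar>x\<bar>)\<^sup>2 = l * (1 / x\<^sup>2)" using l by (simp add: power_divide)
    finally show ?thesis by simp
  qed
  have outer: "(\<integral>\<^sup>+x. f x u \<partial>lborel) = ennreal (4 * sqrt l) *
    (ennreal (exp (- u\<^sup>2)) * indicator {0..} u)" if u: "u \<noteq> 0" for u
  proof (cases "u > 0")
    case True
    have iff: "u * \<bar>x\<bar> \<le> sqrt l \<longleftrightarrow> x \<in> {- (sqrt l / u)..sqrt l / u}" for x
    proof -
      have "u * \<bar>x\<bar> \<le> sqrt l \<longleftrightarrow> \<bar>x\<bar> \<le> sqrt l / u"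
        using True by (simp add: pos_le_divide_eq mult.commute)
      then show ?thesis unfolding atLeastAtMost_iff by linarith
    qed
    have "(\<integral>\<^sup>+x. f x u \<partial>lborel) = (\<integral>\<^sup>+x. ennreal (2 * u * exp (- u\<^sup>2)) * indicator
      {- (sqrt l / u)..sqrt l / u} x \<partial>lborel)"
      using True iff by (intro nn_integral_cong) (simp add: f_def indicator_def)
    also have "\<dots> = ennreal (2 * u * exp (- u\<^sup>2)) * ennreal (2 * (sqrt l / u))"
      using True l by (subst nn_integral_cmult_indicator) auto
    also have "\<dots> = ennreal (4 * sqrt l) * (ennreal (exp (- u\<^sup>2)) * indicator {0..} u)"
      using True l by (simp add: ennreal_mult[symmetric] mult_ac)
    finally show ?thesis .
  next
    case False
    then show ?thesis using u by (simp add: f_def)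
  qed
  have "(\<integral>\<^sup>+x. ennreal (1 - exp (- (l * (1 / x\<^sup>2)))) \<partial>lborel) = (\<integral>\<^sup>+x. \<integral>\<^sup>+u. f x u \<partial>lborel \<partial>lborel)"
  proof (rule nn_integral_cong_AE)
    show "AE x in lborel. ennreal (1 - exp (- (l * (1 / x\<^sup>2)))) = (\<integral>\<^sup>+u. f x u \<partial>lborel)"
      using AE_lborel_singleton[of "0::real"] by eventually_elim (rule inner)
  qed
  also have "\<dots> = (\<integral>\<^sup>+u. \<integral>\<^sup>+x. f x u \<partial>lborel \<partial>lborel)"
    by (rule lborel_pair.Fubini'[symmetric]) measurable
  also have "\<dots> = (\<integral>\<^sup>+u. ennreal (4 * sqrt l) * (ennreal (exp (- u\<^sup>2)) * indicator {0..} u) \<partial>lborel)"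
  proof (rule nn_integral_cong_AE)
    show "AE u in lborel. (\<integral>\<^sup>+x. f x u \<partial>lborel)
      = ennreal (4 * sqrt l) * (ennreal (exp (- u\<^sup>2)) * indicator {0..} u)"
      using AE_lborel_singleton[of "0::real"] by eventually_elim (rule outer)
  qed
  also have "\<dots> = ennreal (4 * sqrt l) * (\<integral>\<^sup>+u. ennreal (exp (- u\<^sup>2)) * indicator {0..} u \<partial>lborel)"
    by (rule nn_integral_cmult) measurable
  also have "(\<integral>\<^sup>+u. ennreal (exp (- u\<^sup>2)) * indicator {0..} u \<partial>lborel)
    = (\<integral>\<^sup>+u. ennreal (indicator {0..} u *\<^sub>R exp (- u\<^sup>2)) \<partial>lborel)"
    by (intro nn_integral_cong) (auto simp: indicator_def)
  also have "\<dots> = ennreal (sqrt pi / 2)"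
    using gaussian_moment_0 by (subst nn_integral_eq_integral) (auto simp: has_bochner_integral_iff)
  also have "ennreal (4 * sqrt l) * \<dots> = ennreal (2 * sqrt pi * sqrt l)"
    using l by (simp add: ennreal_mult[symmetric] mult_ac)
  finally show "(\<integral>\<^sup>+x. ennreal (1 - exp (- (l * (1 / x\<^sup>2)))) \<partial>lborel)
    = ennreal (2 * sqrt pi * sqrt l)" .
qed (use l in auto)

section \<open>Sums over modes and integrals\<close>

lemma countable_modes: "countable modes"
  by (rule countable_subset[OF subset_UNIV]) simp

lemma infinite_modes: "infinite modes"
proof
  assume "finite modes"
  then have "finite (snd ` modes)" by (rule finite_imageI)
  moreover have "{1..} \<subseteq> snd ` modes" by (auto simp: modes_def image_iff)
  ultimately show False using finite_subset infinite_Ici by blast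
qed

text \<open>
  Unordered summability of nonnegative terms, expressed by a series in the extended nonnegative
  reals along an enumeration. In this form it is visibly a measurable condition on random terms.
\<close>

lemma summable_on_enumeration:
  fixes g :: "'i \<Rightarrow> real"
  assumes e: "bij_betw e (UNIV :: nat set) J" and g: "\<And>j. j \<in> J \<Longrightarrow> 0 \<le> g j"
  shows "g summable_on J \<longleftrightarrow> (\<Sum>n. ennreal (g (e n))) \<noteq> \<infinity>"
    and "g summable_on J \<Longrightarrow> (\<Sum>n. ennreal (g (e n))) = ennreal (infsum g J)"
proof -
  have g': "0 \<le> g (e n)" for n using e g by (auto simp: bij_betw_def)
  have iff: "g summable_on J \<longleftrightarrow> summable (\<lambda>n. g (e n))"
  proof -
    have "g summable_on J \<longleftrightarrow> (\<lambda>n. g (e n)) summable_on UNIV"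
      using summable_on_reindex_bij_betw[OF e, of g] by simp
    also have "\<dots> \<longleftrightarrow> summable (\<lambda>n. g (e n))"
      using g' by (intro summable_on_UNIV_nonneg_real_iff)
    finally show ?thesis .
  qed
  show eq: "(\<Sum>n. ennreal (g (e n))) = ennreal (infsum g J)" if "g summable_on J"
  proof -
    have "(g has_sum infsum g J) J" using that by simp
    then have "((\<lambda>n. g (e n)) has_sum infsum g J) UNIV"
      using has_sum_reindex_bij_betw[OF e] by blast
    then have "(\<lambda>n. g (e n)) sums infsum g J" by (rule has_sum_imp_sums)
    then show ?thesis using g' by (intro suminf_ennreal_eq) auto
  qed
  show "g summable_on J \<longleftrightarrow> (\<Sum>n. ennreal (g (e n))) \<noteq> \<infinity>"
  proof
    assume "(\<Sum>n. ennreal (g (e n))) \<noteq> \<infinity>"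
    then have "summable (\<lambda>n. g (e n))" using g' by (intro summable_suminf_not_top) auto
    then show "g summable_on J" using iff by simp
  qed (use eq in auto)
qed

text \<open>
  Monotone convergence along an enumeration of the index set.
\<close>

lemma has_sum_integral_nonneg:
  fixes f :: "'i \<Rightarrow> 'a \<Rightarrow> real"
  assumes J: "countable J" "infinite J"
    and f: "\<And>j. j \<in> J \<Longrightarrow> integrable M (f j)" "\<And>j x. j \<in> J \<Longrightarrow> 0 \<le> f j x"
    and F: "integrable M F" "AE x in M. ((\<lambda>j. f j x) has_sum F x) J"
  shows "((\<lambda>j. \<integral>x. f j x \<partial>M) has_sum (\<integral>x. F x \<partial>M)) J"
proof -
  define e where "e = from_nat_into J"
  have e: "bij_betw e UNIV J" unfolding e_def using J by (rule bij_betw_from_nat_into)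
  have eJ: "e n \<in> J" for n using e by (auto simp: bij_betw_def)
  have F0: "AE x in M. 0 \<le> F x"
    using F(2) by eventually_elim (use f in \<open>auto intro: has_sum_nonneg\<close>)
  have [measurable]: "f (e n) \<in> borel_measurable M" for n using f(1)[OF eJ] by auto
  have "(\<Sum>n. ennreal (\<integral>x. f (e n) x \<partial>M)) = (\<Sum>n. \<integral>\<^sup>+x. ennreal (f (e n) x) \<partial>M)"
    using f eJ by (intro suminf_cong nn_integral_eq_integral[symmetric]) auto
  also have "\<dots> = (\<integral>\<^sup>+x. (\<Sum>n. ennreal (f (e n) x)) \<partial>M)"
    by (rule nn_integral_suminf[symmetric]) measurable
  also have "\<dots> = (\<integral>\<^sup>+x. ennreal (F x) \<partial>M)"
  proof (rule nn_integral_cong_AE, use F(2) in eventually_elim)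
    case (elim x)
    then show ?case
      using summable_on_enumeration(2)[OF e, of "\<lambda>j. f j x"] f
        by (simp add: has_sum_imp_summable infsumI)
  qed
  also have "\<dots> = ennreal (\<integral>x. F x \<partial>M)"
    using F(1) F0 by (rule nn_integral_eq_integral)
  finally have s: "(\<Sum>n. ennreal (\<integral>x. f (e n) x \<partial>M)) = ennreal (\<integral>x. F x \<partial>M)" .
  have nn: "0 \<le> (\<integral>x. f j x \<partial>M)" if "j \<in> J" for j using f that
    by (intro Bochner_Integration.integral_nonneg) auto
  have sm: "(\<lambda>j. \<integral>x. f j x \<partial>M) summable_on J"
    using s by (subst summable_on_enumeration(1)[OF e nn]) auto
  have "ennreal (\<Sum>\<^sub>\<infinity>j\<in>J. \<integral>x. f j x \<partial>M) = ennreal (\<integral>x. F x \<partial>M)"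
    using summable_on_enumeration(2)[OF e nn sm] s by simp
  then have "(\<Sum>\<^sub>\<infinity>j\<in>J. \<integral>x. f j x \<partial>M) = (\<integral>x. F x \<partial>M)"
    using infsum_nonneg[OF nn] integral_nonneg_AE[OF F0] by (subst (asm) ennreal_inj) auto
  then show ?thesis using sm by (simp add: has_sum_iff)
qed

section \<open>The regularized spectral sum and its finite part\<close>

text \<open>
  The sum of \<open>sqrt \<lambda> * exp (- \<tau> * \<lambda>)\<close> over the eigenvalues, written through the heat trace by
  subordination; see \<open>has_sum_spectral_sum\<close>.
\<close>

definition spectral_sum :: "real \<Rightarrow> real \<Rightarrow> real \<Rightarrow> real" where
  "spectral_sum L a \<tau> = (\<integral>x. heat_trace L a \<tau> - heat_trace L a (\<tau> + 1 / x\<^sup>2) \<partial>lborel) /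
    (2 * sqrt pi)"

text \<open>
  Near \<open>x = 0\<close> the difference is at most its first term; for large \<open>x\<close> it is of order \<open>1 / x\<^sup>2\<close>
  by the Lipschitz bound.
\<close>

lemma integrable_heat_trace_increment:
  assumes "L > 0" "a > 0" "\<tau> > 0"
  shows "integrable lborel (\<lambda>x. heat_trace L a \<tau> - heat_trace L a (\<tau> + 1 / x\<^sup>2))"
proof (rule Bochner_Integration.integrable_bound)
  define C where "C = max (heat_trace L a \<tau>) (2 / \<tau> * heat_trace L a (\<tau> / 2))"
  show "integrable lborel (\<lambda>x::real. (2 * C) * (1 / (1 + x\<^sup>2)))"
    by (intro integrable_mult_right integrable_inverse_1_plus_square_UNIV)
  show "AE x in lborel. norm (heat_trace L a \<tau> - heat_trace L a (\<tau> + 1 / x\<^sup>2))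
    \<le> norm ((2 * C) * (1 / (1 + x\<^sup>2)))"
  proof (intro AE_I2)
    fix x :: real
    let ?d = "heat_trace L a \<tau> - heat_trace L a (\<tau> + 1 / x\<^sup>2)"
    have tx: "0 \<le> 1 / x\<^sup>2" by simp
    have C0: "C \<ge> 0" using heat_trace_nonneg[OF assms] by (simp add: C_def)
    have d: "0 \<le> ?d" "?d \<le> 2 * (1 / x\<^sup>2) / \<tau> * heat_trace L a (\<tau> / 2)"
      using heat_trace_Lipschitz[OF assms tx] by blast+
    have "0 \<le> heat_trace L a (\<tau> + 1 / x\<^sup>2)" using assms tx
      by (intro heat_trace_nonneg) (auto intro: add_pos_nonneg)
    then have d1: "?d \<le> C" unfolding C_def by linarith
    have "?d \<le> (2 * C) * (1 / (1 + x\<^sup>2))"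
    proof (cases "\<bar>x\<bar> \<le> 1")
      case True
      then have "x\<^sup>2 \<le> 1" by (simp add: abs_square_le_1)
      then have "1 \<le> 2 * (1 / (1 + x\<^sup>2))" by (simp add: pos_le_divide_eq add_pos_nonneg)
      then have "C * 1 \<le> C * (2 * (1 / (1 + x\<^sup>2)))" using C0 by (rule mult_left_mono)
      then show ?thesis using d1 by (simp add: mult.commute)
    next
      case False
      then have x: "1 \<le> x\<^sup>2" "x \<noteq> 0" by (auto simp: abs_square_le_1[symmetric])
      have "?d \<le> (1 / x\<^sup>2) * (2 / \<tau> * heat_trace L a (\<tau> / 2))" using d(2) by (simp add: mult_ac)
      also have "\<dots> \<le> (1 / x\<^sup>2) * C" unfolding C_def by (intro mult_left_mono) auto
      also have "\<dots> \<le> (2 * (1 / (1 + x\<^sup>2))) * C"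
        using x C0 by (intro mult_right_mono) (auto simp: field_simps add_pos_nonneg)
      finally show ?thesis by (simp add: mult_ac)
    qed
    then show "norm ?d \<le> norm ((2 * C) * (1 / (1 + x\<^sup>2)))" using d C0 by simp
  qed
qed measurable

lemma has_sum_spectral_sum:
  assumes "L > 0" "a > 0" "\<tau> > 0"
  shows "((\<lambda>j. sqrt (eigval L a j) * exp (- \<tau> * eigval L a j)) has_sum spectral_sum L a \<tau>) modes"
proof -
  let ?d = "\<lambda>x. heat_trace L a \<tau> - heat_trace L a (\<tau> + 1 / x\<^sup>2)"
  define f where "f j x = exp (- \<tau> * eigval L a j) * (1 - exp (- (eigval L a j * (1 / x\<^sup>2))))" for j
    and x :: real
  have fi: "has_bochner_integral lborel (f j)
    (exp (- \<tau> * eigval L a j) * (2 * sqrt pi * sqrt (eigval L a j)))" if "j \<in> modes" for j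
    unfolding f_def using assms that
    by (intro has_bochner_integral_mult_right integral_one_minus_exp eigval_pos)
  have "((\<lambda>j. \<integral>x. f j x \<partial>lborel) has_sum (\<integral>x. (?d x) \<partial>lborel)) modes"
  proof (rule has_sum_integral_nonneg[OF countable_modes infinite_modes _ _
    integrable_heat_trace_increment[OF assms]])
    show "integrable lborel (f j)" if "j \<in> modes" for j
      using fi[OF that] by (simp add: has_bochner_integral_iff)
    show "0 \<le> f j x" if "j \<in> modes" for j x
      using eigval_pos[OF assms(1,2) that] by (simp add: f_def)
    show "AE x in lborel. ((\<lambda>j. f j x) has_sum (?d x)) modes"
    proof (intro AE_I2)
      fix x :: real
      have "((\<lambda>j. exp (- \<tau> * eigval L a j) + - exp (- (\<tau> + 1 / x\<^sup>2) * eigval L a j)) has_sum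
          (heat_trace L a \<tau> + - heat_trace L a (\<tau> + 1 / x\<^sup>2))) modes"
        using assms by (intro has_sum_add has_sum_uminusI has_sum_heat_trace)
          (auto intro: add_pos_nonneg)
      then show "((\<lambda>j. f j x) has_sum (?d x)) modes"
        by (simp add: f_def right_diff_distrib exp_add[symmetric] algebra_simps)
    qed
  qed
  then have "((\<lambda>j. (\<integral>x. f j x \<partial>lborel) * (1 / (2 * sqrt pi))) has_sum
      ((\<integral>x. (?d x) \<partial>lborel) * (1 / (2 * sqrt pi)))) modes"
    by (rule has_sum_cmult_left)
  also have "?this \<longleftrightarrow> ?thesis"
    unfolding spectral_sum_def
    by (rule has_sum_cong[THEN trans]) (use fi in \<open>auto simp: has_bochner_integral_iff\<close>)
  finally show ?thesis .
qed

text \<open>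
  With \<open>z = 1 / sqrt (1 + 1 / y\<^sup>2)\<close> one has \<open>1 - z\<^sup>2 = 1 / (1 + y\<^sup>2)\<close>, and \<open>1 - z ^ 3\<close> is at
  most twice that.
\<close>

lemma integrable_profile:
  assumes "k = 2 \<or> k = 3"
  shows "integrable lborel (\<lambda>y::real. 1 - (1 / sqrt (1 + 1 / y\<^sup>2)) ^ k)"
proof (rule Bochner_Integration.integrable_bound)
  show "integrable lborel (\<lambda>x::real. 2 * (1 / (1 + x\<^sup>2)))"
    by (intro integrable_mult_right integrable_inverse_1_plus_square_UNIV)
  show "AE y in lborel. norm (1 - (1 / sqrt (1 + 1 / y\<^sup>2)) ^ k) \<le> norm (2 * (1 / (1 + y\<^sup>2)))"
    using AE_lborel_singleton[of "0::real"]
  proof eventually_elim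
    case (elim y)
    define z where "z = 1 / sqrt (1 + 1 / y\<^sup>2)"
    have pos: "1 + 1 / y\<^sup>2 \<ge> 1" by simp
    have z: "0 \<le> z" "z \<le> 1" 
    proof -
      have "1 \<le> sqrt (1 + 1 / y\<^sup>2)" using pos by (rule real_sqrt_ge_one)
      moreover have "0 \<le> 1 / r \<and> 1 / r \<le> 1" if "1 \<le> r" for r :: real
        using that by (simp add: divide_le_eq)
      ultimately show "0 \<le> z" "z \<le> 1" unfolding z_def by blast+
    qed
    have sq: "(sqrt (1 + 1 / y\<^sup>2))\<^sup>2 = 1 + 1 / y\<^sup>2" using pos by (intro real_sqrt_pow2) linarith
    have "z\<^sup>2 = 1 / (1 + 1 / y\<^sup>2)" by (simp only: z_def power_divide power_one sq)
    also have "\<dots> = y\<^sup>2 / (1 + y\<^sup>2)" using elim by (simp add: field_simps)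
    finally have "z\<^sup>2 = y\<^sup>2 / (1 + y\<^sup>2)" .
    moreover have "1 + y\<^sup>2 \<noteq> 0" using zero_le_power2[of y] by linarith
    ultimately have z2: "1 - z\<^sup>2 = 1 / (1 + y\<^sup>2)" by (simp add: diff_divide_eq_iff)
    have "z ^ 3 \<ge> z ^ 4" "z\<^sup>2 \<ge> z ^ 4" using z by (auto intro: power_decreasing)
    then have "z ^ k \<ge> z ^ 4" using assms by auto
    moreover have "1 - z ^ 4 \<le> 2 * (1 - z\<^sup>2)"
    proof -
      have "0 \<le> (1 - z\<^sup>2)\<^sup>2" by simp
      then show ?thesis by (simp add: power2_eq_square power4_eq_xxxx algebra_simps)
    qed
    moreover have "z ^ k \<le> 1" using z by (intro power_le_one)
    ultimately show ?case unfolding z_def[symmetric] using z2 by (simp add: abs_of_nonneg)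
  qed
qed measurable

text \<open>
  The substitution \<open>y = sqrt \<tau> * x\<close> pulls all powers of \<open>\<tau>\<close> out of the integral:
  \<open>t powr (- 3/2)\<close> in the heat trace yields \<open>\<tau> powr (- 2)\<close>, and \<open>1 / t\<close> yields \<open>\<tau> powr (- 3/2)\<close>.
  So the main part accounts exactly for the two subtracted terms and leaves no finite remainder.
\<close>

lemma heat_main_increment_integral:
  assumes "a > 0"
  shows "\<exists>p q. \<forall>\<tau>>0. has_bochner_integral lborel (\<lambda>x. heat_main L a \<tau> - heat_main L a (\<tau> + 1 / x\<^sup>2))
    (p * \<tau> powr (- 2) + q * \<tau> powr (- 3/2))"
proof -
  define \<phi> where "\<phi> k y = 1 - (1 / sqrt (1 + 1 / y\<^sup>2)) ^ k" for k :: nat and y :: real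
  define p where "p = L\<^sup>2 / (8 * pi) * (a / sqrt pi * (\<integral>y. \<phi> 3 y \<partial>lborel))"
  define q where "q = - (L\<^sup>2 / (8 * pi) * (\<integral>y. \<phi> 2 y \<partial>lborel))"
  have "has_bochner_integral lborel (\<lambda>x. heat_main L a \<tau> - heat_main L a (\<tau> + 1 / x\<^sup>2))
    (p * \<tau> powr (- 2) + q * \<tau> powr (- 3/2))" if \<tau>: "\<tau> > 0" for \<tau>
  proof -
    have \<phi>_int: "has_bochner_integral lborel (\<lambda>x. \<phi> k (sqrt \<tau> * x))
      (\<tau> powr (- 1/2) * (\<integral>y. \<phi> k y \<partial>lborel))"
      if k: "k = 2 \<or> k = 3" for k
    proof -
      have i: "integrable lborel (\<phi> k)" unfolding \<phi>_def using k by (rule integrable_profile)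
      have "(\<integral>y. \<phi> k y \<partial>lborel) = \<bar>sqrt \<tau>\<bar> *\<^sub>R (\<integral>x. \<phi> k (0 + sqrt \<tau> * x) \<partial>lborel)"
        using \<tau> by (intro lborel_integral_real_affine) auto
      then have "(\<integral>x. \<phi> k (sqrt \<tau> * x) \<partial>lborel) = \<tau> powr (- 1/2) * (\<integral>y. \<phi> k y \<partial>lborel)"
        using \<tau> by (simp add: powr_minus powr_half_sqrt)
      moreover have "integrable lborel (\<lambda>x. \<phi> k (0 + sqrt \<tau> * x))"
        using \<tau> by (intro lborel_integrable_real_affine[OF i]) auto
      ultimately show ?thesis by (simp add: has_bochner_integral_iff)
    qed
    have "has_bochner_integral lborel (\<lambda>x. L\<^sup>2 / (8 * pi) *
      (a / sqrt pi * (\<tau> powr (- 3/2) * \<phi> 3 (sqrt \<tau> * x)) - \<tau> powr (- 1) * \<phi> 2 (sqrt \<tau> * x)))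
      (L\<^sup>2 / (8 * pi) * (a / sqrt pi * (\<tau> powr (- 3/2) * (\<tau> powr (- 1/2) * (\<integral>y. \<phi> 3 y \<partial>lborel))) - \<tau>
        powr (- 1) * (\<tau> powr (- 1/2) * (\<integral>y. \<phi> 2 y \<partial>lborel))))"
      by (intro has_bochner_integral_mult_right has_bochner_integral_diff \<phi>_int) auto
    also have "L\<^sup>2 / (8 * pi) * (a / sqrt pi *
      (\<tau> powr (- 3/2) * (\<tau> powr (- 1/2) * (\<integral>y. \<phi> 3 y \<partial>lborel))) - \<tau> powr (- 1) *
      (\<tau> powr (- 1/2) * (\<integral>y. \<phi> 2 y \<partial>lborel)))
      = p * \<tau> powr (- 2) + q * \<tau> powr (- 3/2)"
    proof -
      have e: "\<tau> powr (- 3/2) * \<tau> powr (- 1/2) = \<tau> powr (- 2)"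
        "\<tau> powr (- 1) * \<tau> powr (- 1/2) = \<tau> powr (- 3/2)"
        by (subst powr_add[symmetric], simp)+
      show ?thesis unfolding p_def q_def e[symmetric] by (simp add: algebra_simps)
    qed
    also have "(\<lambda>x. L\<^sup>2 / (8 * pi) * (a / sqrt pi * (\<tau> powr (- 3/2) * \<phi> 3 (sqrt \<tau> * x)) - \<tau> powr
      (- 1) * \<phi> 2 (sqrt \<tau> * x)))
      = (\<lambda>x. heat_main L a \<tau> - heat_main L a (\<tau> + 1 / x\<^sup>2))"
    proof
      fix x :: real
      have "\<tau> + 1 / x\<^sup>2 = \<tau> * (1 + 1 / (sqrt \<tau> * x)\<^sup>2)"
        using \<tau> by (simp add: power_mult_distrib algebra_simps)
      then have w: "1 / sqrt (\<tau> + 1 / x\<^sup>2) = (1 / sqrt \<tau>) * (1 / sqrt (1 + 1 / (sqrt \<tau> * x)\<^sup>2))"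
        by (simp add: real_sqrt_mult)
      have t3: "\<tau> powr (- 3/2) = (1 / sqrt \<tau>) ^ 3"
      proof -
        have "(1 / sqrt \<tau>) ^ 3 = (\<tau> powr (- 1/2)) ^ 3" using \<tau>
          by (simp add: powr_minus powr_half_sqrt inverse_eq_divide)
        also have "\<dots> = \<tau> powr (- 3/2)" using \<tau> by (simp add: powr_power)
        finally show ?thesis by simp
      qed
      have t1: "\<tau> powr (- 1) = (1 / sqrt \<tau>)\<^sup>2" using \<tau>
        by (simp add: powr_minus power_divide inverse_eq_divide)
      show "L\<^sup>2 / (8 * pi) * (a / sqrt pi * (\<tau> powr (- 3/2) * \<phi> 3 (sqrt \<tau> * x)) - \<tau> powr (- 1) * \<phi> 2
        (sqrt \<tau> * x))
        = heat_main L a \<tau> - heat_main L a (\<tau> + 1 / x\<^sup>2)"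
        unfolding heat_main_def w t3 t1 \<phi>_def power_mult_distrib
        by (simp only: right_diff_distrib left_diff_distrib)
    qed
    finally show ?thesis .
  qed
  then show ?thesis by blast
qed

text \<open>
  Up to constant factors, this function dominates the integrands in both passages to the limit
  that follow, small regularization and large area.
\<close>

lemma integrable_damping: "integrable lborel (\<lambda>x::real. min ((1 / x\<^sup>2) powr (3/4)) 1)"
proof -
  let ?f = "\<lambda>x. min ((1 / x\<^sup>2) powr (3/4)) 1"
  let ?h = "\<lambda>x::real. indicator {1..} x * x powr (- 3/2)"
  have "(\<integral>\<^sup>+x. ennreal (?h x) \<partial>lborel) = ennreal (- (1 powr (- 3/2 + 1)) / (- 3/2 + 1))"
    by (rule nn_integral_has_integral_lebesgue[OF _ has_integral_powr_to_inf]) auto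
  then have h: "integrable lborel ?h"
    by (intro integrableI_bounded) auto
  have h': "integrable lborel (\<lambda>x. ?h (0 + (- 1) * x))"
    by (rule lborel_integrable_real_affine[OF h]) auto
  have i: "integrable lborel (\<lambda>x. indicator {- 1..1::real} x :: real)"
    by (rule integrable_real_indicator) auto
  show ?thesis
  proof (rule Bochner_Integration.integrable_bound)
    show "integrable lborel (\<lambda>x. indicator {- 1..1} x + (?h x + ?h (0 + (- 1) * x)))"
      by (intro Bochner_Integration.integrable_add i h h')
    show "AE x in lborel. norm (?f x) \<le> norm (indicator {- 1..1} x + (?h x + ?h (0 + (- 1) * x)))"
    proof (intro AE_I2)
      fix x :: real
      have p: "(1 / x\<^sup>2) powr (3/4) = \<bar>x\<bar> powr (- 3/2)" if "x \<noteq> 0"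
      proof -
        have "(1 / x\<^sup>2) powr (3/4) = (\<bar>x\<bar> powr (- 2)) powr (3/4)"
          using that by (simp add: powr_minus powr_numeral inverse_eq_divide)
        also have "\<dots> = \<bar>x\<bar> powr (- 3/2)" by (simp only: powr_powr) simp
        finally show ?thesis .
      qed
      have nn: "0 \<le> ?h x" "0 \<le> ?h (0 + (- 1) * x)" by auto
      show "norm (?f x) \<le> norm (indicator {- 1..1} x + (?h x + ?h (0 + (- 1) * x)))"
      proof (cases "\<bar>x\<bar> \<le> 1")
        case True
        then have "indicator {- 1..1} x = (1::real)" by (auto simp: indicator_def abs_le_iff)
        moreover have "0 \<le> (?f x)" "(?f x) \<le> 1" by simp_all
        ultimately show ?thesis using nn unfolding real_norm_def by linarith
      next
        case False
        then have "x > 1 \<or> x < - 1" by auto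
        then show ?thesis
        proof
          assume "x > 1"
          then show ?thesis using p by (simp add: indicator_def)
        next
          assume "x < - 1"
          then show ?thesis using p by (simp add: indicator_def)
        qed
      qed
    qed
  qed measurable
qed

lemma heat_error_tendsto_0:
  assumes "a > 0" "L \<ge> a"
  shows "(heat_error L a \<longlongrightarrow> 0) (at_right 0)"
proof -
  obtain C where C: "\<And>t. t > 0 \<Longrightarrow> \<bar>heat_error L a t\<bar> \<le> C * L\<^sup>2 * min (t ^ 9) 1" "C > 0"
    using heat_error_bound[OF assms(1)] assms(2) by blast
  have "((\<lambda>t. C * L\<^sup>2 * min (t ^ 9) 1) \<longlongrightarrow> C * L\<^sup>2 * min (0 ^ 9) 1) (at_right 0)"
    by (intro tendsto_intros)
  then have lim: "((\<lambda>t. C * L\<^sup>2 * min (t ^ 9) 1) \<longlongrightarrow> 0) (at_right 0)"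
    by simp
  have ev: "\<forall>\<^sub>F t in at_right 0. \<bar>heat_error L a t\<bar> \<le> C * L\<^sup>2 * min (t ^ 9) 1"
    using C by (auto simp: eventually_at_right_less eventually_at_topological intro!:
      eventually_at_rightI[of 0 1])
  have "((\<lambda>t. \<bar>heat_error L a t\<bar>) \<longlongrightarrow> 0) (at_right 0)"
    by (rule tendsto_sandwich[OF _ ev tendsto_const lim]) simp
  then show ?thesis by (rule tendsto_rabs_zero_cancel)
qed

text \<open>
  The main part of the heat trace produces the two divergent powers. In the rest, the dominated
  convergence theorem applies by \<open>heat_error_increment\<close>: as \<open>\<tau>\<close> tends to \<open>0\<close>, \<open>heat_error L a \<tau>\<close>
  vanishes and \<open>heat_error L a (\<tau> + t)\<close> tends to \<open>heat_error L a t\<close>.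
\<close>

lemma spectral_sum_finite_part:
  assumes a: "a > 0" and L: "L \<ge> a"
  shows "\<exists>p q. ((\<lambda>\<tau>. spectral_sum L a \<tau> - p * \<tau> powr (- 2) - q * \<tau> powr (- 3/2)) \<longlongrightarrow>
     - (\<integral>x. heat_error L a (1 / x\<^sup>2) \<partial>lborel) / (2 * sqrt pi)) (at_right 0)"
proof -
  have L0: "L > 0" using a L by simp
  obtain p q where pq: "\<And>\<tau>. \<tau> > 0 \<Longrightarrow> has_bochner_integral lborel
    (\<lambda>x. heat_main L a \<tau> - heat_main L a (\<tau> + 1 / x\<^sup>2))
    (p * \<tau> powr (- 2) + q * \<tau> powr (- 3/2))"
    using heat_main_increment_integral[OF a] by blast
  obtain C where C: "C > 0" "\<And>\<tau> t. 0 < \<tau> \<Longrightarrow> \<tau> \<le> 1 \<Longrightarrow> 0 \<le> t \<Longrightarrow>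
      \<bar>heat_error L a \<tau> - heat_error L a (\<tau> + t)\<bar> \<le> C * min (t powr (3/4)) 1"
    using heat_error_increment[OF a L] by blast
  define D where "D \<tau> x = heat_error L a \<tau> - heat_error L a (\<tau> + 1 / x\<^sup>2)" for \<tau> x :: real
  have [measurable]: "D \<tau> \<in> borel_measurable borel" for \<tau> unfolding D_def by measurable
  have eq: "spectral_sum L a \<tau> - p / (2 * sqrt pi) * \<tau> powr (- 2) - q / (2 * sqrt pi) * \<tau> powr
    (- 3/2)
      = (\<integral>x. D \<tau> x \<partial>lborel) / (2 * sqrt pi)" if "\<tau> > 0" for \<tau>
  proof -
    have "(\<integral>x. D \<tau> x \<partial>lborel) = (\<integral>x. (heat_trace L a \<tau> - heat_trace L a (\<tau> + 1 / x\<^sup>2)) -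
      (heat_main L a \<tau> - heat_main L a (\<tau> + 1 / x\<^sup>2)) \<partial>lborel)"
      by (intro Bochner_Integration.integral_cong) (auto simp: D_def heat_error_def)
    also have "\<dots> = (\<integral>x. heat_trace L a \<tau> - heat_trace L a (\<tau> + 1 / x\<^sup>2) \<partial>lborel) -
      (p * \<tau> powr (- 2) + q * \<tau> powr (- 3/2))"
      using integrable_heat_trace_increment[OF L0 a that] pq[OF that]
      by (subst Bochner_Integration.integral_diff) (auto simp: has_bochner_integral_iff)
    finally show ?thesis unfolding spectral_sum_def
      by (simp add: diff_divide_distrib add_divide_distrib)
  qed
  have "((\<lambda>\<tau>. \<integral>x. D \<tau> x \<partial>lborel) \<longlongrightarrow> (\<integral>x. - heat_error L a (1 / x\<^sup>2) \<partial>lborel)) (at_right 0)"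
  proof (rule tendsto_at_right_sequentially[of 0 1])
    fix S :: "nat \<Rightarrow> real"
    assume S: "\<And>n. 0 < S n" "\<And>n. S n < 1" "S \<longlonglongrightarrow> 0"
    show "(\<lambda>n. \<integral>x. D (S n) x \<partial>lborel) \<longlonglongrightarrow> (\<integral>x. - heat_error L a (1 / x\<^sup>2) \<partial>lborel)"
    proof (rule integral_dominated_convergence)
      show "integrable lborel (\<lambda>x. C * min ((1 / x\<^sup>2) powr (3/4)) 1)"
        by (intro integrable_mult_right integrable_damping)
      show "AE x in lborel. norm (D (S n) x) \<le> C * min ((1 / x\<^sup>2) powr (3/4)) 1" for n
        unfolding D_def using S(1,2)[of n] by (intro AE_I2) (auto intro!: C(2))
      show "AE x in lborel. (\<lambda>n. D (S n) x) \<longlonglongrightarrow> - heat_error L a (1 / x\<^sup>2)"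
        using AE_lborel_singleton[of "0::real"]
      proof eventually_elim
        case (elim x)
        then have t: "0 < 1 / x\<^sup>2" by simp
        have SR: "filterlim S (at_right 0) sequentially"
          by (rule tendsto_imp_filterlim_at_right[OF S(3)]) (simp add: S(1))
        have "(\<lambda>n. heat_error L a (S n)) \<longlonglongrightarrow> 0"
          by (rule filterlim_compose[OF heat_error_tendsto_0[OF a L] SR])
        moreover have "(\<lambda>n. heat_error L a (S n + 1 / x\<^sup>2)) \<longlonglongrightarrow> heat_error L a (0 + 1 / x\<^sup>2)"
          using isCont_heat_error[OF L0 a t] S(3)
            by (intro isCont_tendsto_compose[where g="heat_error L a"] tendsto_intros) auto
        ultimately have "(\<lambda>n. D (S n) x) \<longlonglongrightarrow> 0 - heat_error L a (0 + 1 / x\<^sup>2)"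
          unfolding D_def by (rule tendsto_diff)
        then show ?case by simp
      qed
    qed measurable
  qed simp
  then have "((\<lambda>\<tau>. (\<integral>x. D \<tau> x \<partial>lborel) / (2 * sqrt pi))
    \<longlongrightarrow> (\<integral>x. - heat_error L a (1 / x\<^sup>2) \<partial>lborel) / (2 * sqrt pi)) (at_right 0)"
    by (intro tendsto_intros) auto
  then have "((\<lambda>\<tau>. spectral_sum L a \<tau> - p / (2 * sqrt pi) * \<tau> powr (- 2) - q / (2 * sqrt pi) * \<tau>
    powr (- 3/2))
      \<longlongrightarrow> (\<integral>x. - heat_error L a (1 / x\<^sup>2) \<partial>lborel) / (2 * sqrt pi)) (at_right 0)"
    by (rule Lim_transform_eventually) (rule eventually_at_rightI[of 0 1], rule eq[symmetric], auto)
  then show ?thesis by (intro exI[of _ "p / (2 * sqrt pi)"] exI[of _ "q / (2 * sqrt pi)"]) simp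
qed

section \<open>The large-area limit\<close>

lemma has_bochner_integral_abs_cubed_Gaussian:
  fixes b :: real
  assumes b: "b > 0"
  shows "has_bochner_integral lborel (\<lambda>x::real. \<bar>x\<bar> ^ 3 * exp (- (b\<^sup>2 * x\<^sup>2))) (1 / b ^ 4)"
proof -
  have "has_bochner_integral lborel (\<lambda>x::real. indicator {0..} x *\<^sub>R (exp (- x\<^sup>2) * \<bar>x\<bar> ^ 3))
    (1 / 2)"
    using gaussian_moment_odd_pos[of 1]
    by (rule has_bochner_integral_cong[THEN iffD1, rotated -1]) (auto simp: indicator_def)
  then have g: "has_bochner_integral lborel (\<lambda>x::real. exp (- x\<^sup>2) * \<bar>x\<bar> ^ 3) (2 *\<^sub>R (1 / 2))"
    by (rule has_bochner_integral_even_function) auto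
  have "has_bochner_integral lborel (\<lambda>x. exp (- (0 + b * x)\<^sup>2) * \<bar>0 + b * x\<bar> ^ 3) (1 / b)"
    using g b lborel_integral_real_affine[of b "\<lambda>x. exp (- x\<^sup>2) * \<bar>x\<bar> ^ 3" 0]
      lborel_integrable_real_affine[of "\<lambda>x. exp (- x\<^sup>2) * \<bar>x\<bar> ^ 3" b 0]
    by (simp add: has_bochner_integral_iff field_simps)
  then have "has_bochner_integral lborel (\<lambda>x. (1 / b ^ 3) *
    (exp (- (0 + b * x)\<^sup>2) * \<bar>0 + b * x\<bar> ^ 3)) ((1 / b ^ 3) * (1 / b))"
    by (rule has_bochner_integral_mult_right)
  also have "(\<lambda>x. (1 / b ^ 3) * (exp (- (0 + b * x)\<^sup>2) * \<bar>0 + b * x\<bar> ^ 3))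
    = (\<lambda>x. \<bar>x\<bar> ^ 3 * exp (- (b\<^sup>2 * x\<^sup>2)))"
    using b by (auto simp: fun_eq_iff power_mult_distrib abs_mult)
  also have "(1 / b ^ 3) * (1 / b) = 1 / b ^ 4" by (simp add: eval_nat_numeral)
  finally show ?thesis .
qed

text \<open>
  Integrated term by term: the \<open>k\<close>-th Gaussian contributes a multiple of \<open>1 / k ^ 4\<close>.
\<close>

lemma integral_abs_cubed_theta:
  assumes a: "a > 0"
  shows "(\<integral>x. \<bar>x\<bar> ^ 3 * (theta (a\<^sup>2 * x\<^sup>2) - 1) \<partial>lborel) = pi ^ 4 / (45 * a ^ 4)"
proof -
  define g where "g n x = 2 * (\<bar>x\<bar> ^ 3 * exp (- ((real (Suc n) * a)\<^sup>2 * x\<^sup>2)))" for n and x :: real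
  have g: "has_bochner_integral lborel (g n) (2 * (1 / (real (Suc n) * a) ^ 4))" for n
    unfolding g_def using a by (intro has_bochner_integral_mult_right
      has_bochner_integral_abs_cubed_Gaussian) auto
  have g0: "0 \<le> g n x" for n x by (simp add: g_def)
  have s: "(\<lambda>n. 2 * (1 / (real (Suc n) * a) ^ 4)) sums (pi ^ 4 / (45 * a ^ 4))"
    using sums_mult[OF sums_inverse_fourth_powers, of "2 / a ^ 4"]
      by (simp add: power_mult_distrib mult_ac del: of_nat_Suc)
  have pt: "(\<Sum>n. ennreal (g n x)) = ennreal (\<bar>x\<bar> ^ 3 * (theta (a\<^sup>2 * x\<^sup>2) - 1))" if "x \<noteq> 0" for x
  proof -
    have "(\<lambda>n. exp (- (real (Suc n))\<^sup>2 * (a\<^sup>2 * x\<^sup>2))) sums ((theta (a\<^sup>2 * x\<^sup>2) - 1) / 2)"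
      unfolding theta_def using summable_sums[OF summable_theta[of "a\<^sup>2 * x\<^sup>2"]] a that
      by (simp del: of_nat_Suc)
    from sums_mult[OF this, of "2 * \<bar>x\<bar> ^ 3"]
    have "(\<lambda>n. g n x) sums (\<bar>x\<bar> ^ 3 * (theta (a\<^sup>2 * x\<^sup>2) - 1))"
      by (simp add: g_def power_mult_distrib mult_ac del: of_nat_Suc)
    then show ?thesis using g0 by (intro suminf_ennreal_eq) auto
  qed
  have gm [measurable]: "g n \<in> borel_measurable borel" for n unfolding g_def by measurable
  have "(\<integral>\<^sup>+x. ennreal (\<bar>x\<bar> ^ 3 * (theta (a\<^sup>2 * x\<^sup>2) - 1)) \<partial>lborel)
    = (\<integral>\<^sup>+x. (\<Sum>n. ennreal (g n x)) \<partial>lborel)"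
  proof (rule nn_integral_cong_AE)
    show "AE x in lborel. ennreal (\<bar>x\<bar> ^ 3 * (theta (a\<^sup>2 * x\<^sup>2) - 1)) = (\<Sum>n. ennreal (g n x))"
      using AE_lborel_singleton[of "0::real"] by eventually_elim (rule pt[symmetric])
  qed
  also have "\<dots> = (\<Sum>n. \<integral>\<^sup>+x. ennreal (g n x) \<partial>lborel)"
    by (rule nn_integral_suminf) measurable
  also have "\<dots> = (\<Sum>n. ennreal (2 * (1 / (real (Suc n) * a) ^ 4)))"
    using g g0 by (intro suminf_cong) (subst nn_integral_eq_integral, auto simp:
      has_bochner_integral_iff)
  also have "\<dots> = ennreal (pi ^ 4 / (45 * a ^ 4))"
    using s a by (intro suminf_ennreal_eq) auto
  finally have "(\<integral>\<^sup>+x. ennreal (\<bar>x\<bar> ^ 3 * (theta (a\<^sup>2 * x\<^sup>2) - 1)) \<partial>lborel)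
    = ennreal (pi ^ 4 / (45 * a ^ 4))" .
  moreover have "AE x in lborel. 0 \<le> \<bar>x\<bar> ^ 3 * (theta (a\<^sup>2 * x\<^sup>2) - 1)"
    using AE_lborel_singleton[of "0::real"]
  proof eventually_elim
    case (elim x)
    then have "1 \<le> theta (a\<^sup>2 * x\<^sup>2)" using a by (intro theta_ge_1) auto
    then show ?case by simp
  qed
  ultimately show ?thesis
    using a by (subst integral_eq_nn_integral) (auto simp: enn2real_ennreal)
qed

lemma theta_tendsto_1: "(theta \<longlongrightarrow> 1) at_top"
proof -
  obtain C where C: "C > 0" "\<And>s. s > 0 \<Longrightarrow> theta s - 1 \<le> C / s ^ 1"
    using theta_minus_1_le[of 1] by auto
  have "((\<lambda>s::real. C / s) \<longlongrightarrow> 0) at_top"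
    by (intro real_tendsto_divide_at_top[of _ C] tendsto_const filterlim_ident)
  then have "((\<lambda>s. theta s - 1) \<longlongrightarrow> 0) at_top"
  proof (rule tendsto_sandwich[OF _ _ tendsto_const, rotated 2])
    show "\<forall>\<^sub>F s in at_top. 0 \<le> theta s - 1"
      using eventually_gt_at_top[of 0] by eventually_elim (simp add: theta_ge_1)
    show "\<forall>\<^sub>F s in at_top. theta s - 1 \<le> C / s"
      using eventually_gt_at_top[of 0] by eventually_elim (use C(2) in force)
  qed
  then show ?thesis by (simp add: LIM_zero_iff)
qed

text \<open>
  As \<open>n\<close> grows, the theta functions of the periodic directions tend to \<open>1\<close>, and per unit area
  only the images across the plates survive. Domination comes from \<open>heat_error_bound\<close>, which is
  uniform in the area.
\<close>

lemma heat_error_integral_limit: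
  assumes a: "a > 0"
  shows "(\<lambda>n. (\<integral>x. heat_error (real n * a) a (1 / x\<^sup>2) \<partial>lborel) / (real n)\<^sup>2)
    \<longlonglongrightarrow> pi\<^sup>2 * sqrt pi / (360 * a)"
proof -
  obtain C where C: "C > 0" "\<And>L t. L \<ge> a \<Longrightarrow> t > 0 \<Longrightarrow> \<bar>heat_error L a t\<bar> \<le> C * L\<^sup>2 * min (t ^ 9) 1"
    using heat_error_bound[OF a] by blast
  \<comment> \<open>The pointwise limit of \<open>heat_error (n * a) a (1 / x\<^sup>2) / n\<^sup>2\<close>, with \<open>1 / sqrt t = \<bar>x\<bar>\<close>.\<close>
  define G where "G x = a\<^sup>2 / (8 * pi) * x\<^sup>2 * (a / sqrt pi * \<bar>x\<bar> * (theta (a\<^sup>2 * x\<^sup>2) - 1))" for x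
  have [measurable]: "G \<in> borel_measurable borel" unfolding G_def by measurable
  have "(\<lambda>n. \<integral>x. heat_error (real (Suc n) * a) a (1 / x\<^sup>2) / (real (Suc n))\<^sup>2 \<partial>lborel)
    \<longlonglongrightarrow> (\<integral>x. G x \<partial>lborel)"
  proof (rule integral_dominated_convergence)
    show "integrable lborel (\<lambda>x. C * a\<^sup>2 * min ((1 / x\<^sup>2) powr (3/4)) 1)"
      by (intro integrable_mult_right integrable_damping)
    show "AE x in lborel. norm (heat_error (real (Suc n) * a) a (1 / x\<^sup>2) / (real (Suc n))\<^sup>2)
      \<le> C * a\<^sup>2 * min ((1 / x\<^sup>2) powr (3/4)) 1" for n
      using AE_lborel_singleton[of "0::real"]
    proof eventually_elim
      case (elim x)
      define t where "t = 1 / x\<^sup>2"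
      have t: "t > 0" using elim by (simp add: t_def)
      have La: "a \<le> real (Suc n) * a" using a by simp
      have m: "min (t ^ 9) 1 \<le> min (t powr (3/4)) 1"
      proof (cases "t \<le> 1")
        case True
        have "t powr 9 \<le> t powr (3/4)" using True t by (intro powr_mono') auto
        then show ?thesis using t by (simp add: powr_numeral)
      next
        case False
        then show ?thesis by (simp add: ge_one_powr_ge_zero)
      qed
      have "\<bar>heat_error (real (Suc n) * a) a t\<bar> \<le> C * (real (Suc n) * a)\<^sup>2 * min (t ^ 9) 1"
        using C(2)[OF La t] .
      also have "\<dots> \<le> C * (real (Suc n) * a)\<^sup>2 * min (t powr (3/4)) 1"
        using C m by (intro mult_left_mono) auto
      also have "\<dots> = (real (Suc n))\<^sup>2 * (C * a\<^sup>2 * min (t powr (3/4)) 1)"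
        by (simp add: power_mult_distrib mult_ac)
      finally show ?case unfolding t_def[symmetric] by (simp add: pos_divide_le_eq mult.commute)
    qed
    show "AE x in lborel. (\<lambda>n. heat_error (real (Suc n) * a) a (1 / x\<^sup>2) / (real (Suc n))\<^sup>2) \<longlonglongrightarrow> G x"
      using AE_lborel_singleton[of "0::real"]
    proof eventually_elim
      case (elim x)
      have t: "0 < 1 / x\<^sup>2" using elim by simp
      define A where "A n = theta ((real (Suc n) * a)\<^sup>2 / (4 * (1 / x\<^sup>2)))" for n
      define B where "B = theta (a\<^sup>2 / (1 / x\<^sup>2))"
      have w: "1 / sqrt (1 / x\<^sup>2) = \<bar>x\<bar>" by (simp add: real_sqrt_divide)
      have "filterlim (\<lambda>n. real (Suc n)) at_top sequentially"
        by (intro filterlim_compose[OF filterlim_real_sequentially] filterlim_Suc)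
      then have fl: "filterlim (\<lambda>n. (a\<^sup>2 * x\<^sup>2 / 4) * (real (Suc n) * real (Suc n))) at_top
        sequentially"
        using a elim by (intro filterlim_tendsto_pos_mult_at_top[OF tendsto_const]
          filterlim_at_top_mult_at_top) auto
      have eq: "(a\<^sup>2 * x\<^sup>2 / 4) * (real (Suc n) * real (Suc n))
        = (real (Suc n) * a)\<^sup>2 / (4 * (1 / x\<^sup>2))" for n
        by (simp add: power_mult_distrib power2_eq_square)
      have Alim: "A \<longlonglongrightarrow> 1"
        unfolding A_def by (rule filterlim_compose[OF theta_tendsto_1 fl[unfolded eq]])
      have "heat_error (real (Suc n) * a) a (1 / x\<^sup>2) / (real (Suc n))\<^sup>2 = a\<^sup>2 / (8 * pi) * \<bar>x\<bar>\<^sup>2 *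
         (a / sqrt pi * \<bar>x\<bar> * ((A n)\<^sup>2 * B - 1) - ((A n)\<^sup>2 - 1))" for n
      proof -
        have "0 < real (Suc n) * a" using a by simp
        then have "heat_error (real (Suc n) * a) a (1 / x\<^sup>2)
          = (real (Suc n) * a)\<^sup>2 / (8 * pi) * \<bar>x\<bar>\<^sup>2 *
         (a / sqrt pi * \<bar>x\<bar> * ((A n)\<^sup>2 * B - 1) - ((A n)\<^sup>2 - 1))"
          using heat_error_eq[OF _ a t, of "real (Suc n) * a"] unfolding w A_def B_def by simp
        then show ?thesis by (simp add: power_mult_distrib del: of_nat_Suc)
      qed
      moreover have "(\<lambda>n. a\<^sup>2 / (8 * pi) * \<bar>x\<bar>\<^sup>2 *
        (a / sqrt pi * \<bar>x\<bar> * ((A n)\<^sup>2 * B - 1) - ((A n)\<^sup>2 - 1)))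
         \<longlonglongrightarrow> a\<^sup>2 / (8 * pi) * \<bar>x\<bar>\<^sup>2 * (a / sqrt pi * \<bar>x\<bar> * (1\<^sup>2 * B - 1) - (1\<^sup>2 - 1))"
        by (intro tendsto_intros Alim)
      ultimately show ?case by (simp add: G_def B_def)
    qed
  qed measurable
  moreover have "(\<integral>x. G x \<partial>lborel) = pi\<^sup>2 * sqrt pi / (360 * a)"
  proof -
    have "(\<integral>x. G x \<partial>lborel) = (\<integral>x. (a ^ 3 / (8 * pi * sqrt pi)) *
      (\<bar>x\<bar> ^ 3 * (theta (a\<^sup>2 * x\<^sup>2) - 1)) \<partial>lborel)"
      by (intro Bochner_Integration.integral_cong refl)
        (simp add: G_def power3_eq_cube power2_eq_square abs_mult[symmetric] mult_ac)
    also have "\<dots> = (a ^ 3 / (8 * pi * sqrt pi)) * (pi ^ 4 / (45 * a ^ 4))"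
      using integral_abs_cubed_theta[OF a] by simp
    also have "\<dots> = pi\<^sup>2 * sqrt pi / (360 * a)"
    proof -
      have "sqrt pi * sqrt pi = pi" by simp
      then have "pi ^ 4 = pi\<^sup>2 * sqrt pi * (pi * sqrt pi)"
        by (simp add: power4_eq_xxxx power2_eq_square)
      then show ?thesis using a by (simp add: field_simps eval_nat_numeral)
    qed
    finally show ?thesis .
  qed
  ultimately have "(\<lambda>n. (\<integral>x. heat_error (real (Suc n) * a) a (1 / x\<^sup>2) \<partial>lborel) / (real (Suc n))\<^sup>2)
    \<longlonglongrightarrow> pi\<^sup>2 * sqrt pi / (360 * a)"
    by simp
  then show ?thesis by (rule LIMSEQ_offset[of _ 1, unfolded add_Suc_right add_0_right One_nat_def])
qed

section \<open>The stochastic energy\<close>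

text \<open>
  Square integrability follows from the normalization: the Bochner integral of a function that
  is not integrable is \<open>0\<close>, not \<open>1\<close>.
\<close>

lemma orthonormal_eigenbasis_imp_orthonormal:
  assumes "orthonormal_eigenbasis L a u"
  shows "orthonormal (vol L a) u modes"
proof -
  have ip1: "L2_ip (vol L a) (u i) (u j) = of_bool (i = j)" if "i \<in> modes" "j \<in> modes" for i j
    using assms that unfolding orthonormal_eigenbasis_def L2_inner_def L2_ip_def by blast
  have "L2_function (vol L a) (u j)" if j: "j \<in> modes" for j
    unfolding L2_function_def
  proof
    have "continuous_on (slab a) (u j)"
      using assms j by (auto simp: orthonormal_eigenbasis_def LB_eigenfunction_def)
    then have "continuous_on (cell L a) (u j)"
      by (rule continuous_on_subset) (auto simp: cell_def slab_def)
    then have "u j \<in> borel_measurable (restrict_space borel (cell L a))"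
      by (rule borel_measurable_continuous_on_restrict)
    then show "u j \<in> borel_measurable (vol L a)"
      by (simp add: measurable_def sets_restrict_space space_restrict_space)
    have "complex_of_real (sqnorm (vol L a) (u j)) = 1"
      by (subst L2_ip_self[symmetric]) (simp add: ip1[OF j j])
    then have "sqnorm (vol L a) (u j) = 1" by (simp only: of_real_eq_1_iff)
    then show "integrable (vol L a) (\<lambda>x. (norm (u j x))\<^sup>2)"
      using not_integrable_integral_eq by fastforce
  qed
  then show ?thesis using ip1 by (simp add: orthonormal_def)
qed

lemma L2_sum_eq: "L2_sum L a u b = (SOME f. L2_series (vol L a) u modes b f)"
  by (simp add: L2_sum_def L2_series_def L2_function_def square_integrable_def)

text \<open>
  The function of the plate operator that maps white noise to the field.
\<close>

definition sigma_symbol :: "real \<Rightarrow> real \<Rightarrow> real \<Rightarrow> real \<Rightarrow> real \<Rightarrow> real" where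
  "sigma_symbol hbar c g \<tau> = (\<lambda>\<mu>. (hbar * c / g) powr (1/2) * (\<mu> powr (3/4) * exp (- \<tau> * \<mu> / 2)))"

lemma sigma_symbol_square:
  assumes "hbar > 0" "c > 0" "g > 0" "\<mu> > 0"
  shows "(sigma_symbol hbar c g \<tau> \<mu>)\<^sup>2 = (hbar * c / g) * (\<mu> * (sqrt \<mu> * exp (- \<tau> * \<mu>)))"
proof -
  have "((hbar * c / g) powr (1/2))\<^sup>2 = hbar * c / g"
    using assms by (simp add: powr_half_sqrt)
  moreover have "(\<mu> powr (3/4))\<^sup>2 = \<mu> * sqrt \<mu>"
  proof -
    have "(\<mu> powr (3/4))\<^sup>2 = \<mu> powr (1 + 1/2)" using assms by (simp add: powr_power)
    also have "\<dots> = \<mu> * sqrt \<mu>" using assms by (simp only: powr_add powr_half_sqrt less_imp_le) simp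
    finally show ?thesis .
  qed
  moreover have "(exp (- \<tau> * \<mu> / 2))\<^sup>2 = exp (- \<tau> * \<mu>)"
    by (simp add: power2_eq_square exp_add[symmetric])
  ultimately show ?thesis by (simp add: sigma_symbol_def power_mult_distrib)
qed

lemma eigval_lower_bound:
  assumes "a > 0" "j \<in> modes"
  shows "(pi / a)\<^sup>2 \<le> eigval L a j"
proof -
  obtain m1 m2 r where j: "j = ((m1, m2), r)" by (metis surj_pair)
  have "r \<ge> 1" using assms j by (simp add: modes_def)
  then have "pi / a * 1 \<le> pi / a * real r" using assms by (intro mult_left_mono) auto
  then have "(pi / a)\<^sup>2 \<le> (pi * real r / a)\<^sup>2" using assms by (intro power_mono) auto
  moreover have "0 \<le> (2 * pi / L)\<^sup>2 * ((of_int m1)\<^sup>2 + (of_int m2)\<^sup>2)" by simp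
  ultimately show ?thesis unfolding j eigval_def prod.case by linarith
qed

text \<open>
  Parseval's identity for the field and its image under the inverse operator, whose coefficients
  are those of the field divided by the eigenvalues. Both series converge by \<open>Riesz_Fischer\<close>,
  the second one because the eigenvalues are bounded away from \<open>0\<close>.
\<close>

lemma channel_energy_has_sum:
  assumes "hbar > 0" "c > 0" "g > 0" and L: "L > 0" "a > 0"
    and on: "orthonormal (vol L a) u modes"
    and b: "(\<lambda>j. eigval L a j * (sqrt (eigval L a j) * exp (- \<tau> * eigval L a j)) * (norm (b j))\<^sup>2)
      summable_on modes"
  shows "((\<lambda>j. sqrt (eigval L a j) * exp (- \<tau> * eigval L a j) * (norm (b j))\<^sup>2) has_sum
     (2 / (hbar * c) * channel_energy hbar c g L a u \<tau> b)) modes"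
proof -
  let ?M = "vol L a" and ?l = "eigval L a"
  define \<beta> where "\<beta> j = complex_of_real (sigma_symbol hbar c g \<tau> (?l j)) * b j" for j
  define \<sigma> where "\<sigma> = sigma_field hbar c g L a u \<tau> b"
  define \<rho> where "\<rho> = LB_inverse L a u \<sigma>"
  have l: "?l j > 0" if "j \<in> modes" for j using L that by (rule eigval_pos)
  have \<beta>2: "(norm (\<beta> j))\<^sup>2 = (hbar * c / g) *
    (?l j * (sqrt (?l j) * exp (- \<tau> * ?l j)) * (norm (b j))\<^sup>2)" if "j \<in> modes" for j
    unfolding \<beta>_def norm_mult power_mult_distrib norm_of_real power2_abs
    using sigma_symbol_square[OF assms(1-3) l[OF that]] by simp
  have s\<beta>: "(\<lambda>j. (norm (\<beta> j))\<^sup>2) summable_on modes"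
  proof -
    have "(\<lambda>j. (hbar * c / g) * (?l j * (sqrt (?l j) * exp (- \<tau> * ?l j)) * (norm (b j))\<^sup>2))
      summable_on modes"
      using b by (rule summable_on_cmult_right)
    then show ?thesis by (rule summable_on_cong[THEN iffD1, rotated]) (simp add: \<beta>2)
  qed
  have \<sigma>: "L2_series ?M u modes \<beta> \<sigma>"
    using someI_ex[OF Riesz_Fischer[OF on s\<beta>]]
    by (simp add: \<sigma>_def sigma_field_def LB_apply_def L2_sum_eq \<beta>_def[abs_def] sigma_symbol_def)
  define \<gamma> where "\<gamma> j = complex_of_real (inverse (?l j)) * L2_inner L a (u j) \<sigma>" for j
  have \<gamma>: "\<gamma> j = complex_of_real (inverse (?l j)) * \<beta> j" if "j \<in> modes" for j
    using L2_series_coefficient[OF on \<sigma> that] by (simp add: \<gamma>_def L2_inner_def L2_ip_def)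
  have s\<gamma>: "(\<lambda>j. (norm (\<gamma> j))\<^sup>2) summable_on modes"
  proof (rule summable_on_comparison_test)
    show "(\<lambda>j. (inverse ((pi / a)\<^sup>2))\<^sup>2 * (norm (\<beta> j))\<^sup>2) summable_on modes"
      using s\<beta> by (rule summable_on_cmult_right)
    fix j assume j: "j \<in> modes"
    have "inverse (?l j) \<le> inverse ((pi / a)\<^sup>2)"
      using eigval_lower_bound[OF L(2) j] L by (intro le_imp_inverse_le) auto
    then have "(inverse (?l j))\<^sup>2 \<le> (inverse ((pi / a)\<^sup>2))\<^sup>2"
      using l[OF j] by (intro power_mono) auto
    then show "(norm (\<gamma> j))\<^sup>2 \<le> (inverse ((pi / a)\<^sup>2))\<^sup>2 * (norm (\<beta> j))\<^sup>2"
      unfolding \<gamma>[OF j] norm_mult power_mult_distrib norm_of_real power2_abs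
        by (rule mult_right_mono) simp
  qed simp
  have \<rho>: "L2_series ?M u modes \<gamma> \<rho>"
    using someI_ex[OF Riesz_Fischer[OF on s\<gamma>]]
    by (simp add: \<rho>_def LB_inverse_def LB_apply_def L2_sum_eq \<gamma>_def[abs_def])
  have "((\<lambda>j. cnj (\<beta> j) * L2_ip ?M (u j) \<rho>) has_sum L2_ip ?M \<sigma> \<rho>) modes"
    using \<rho> by (intro L2_series_ip[OF on \<sigma>]) (simp add: L2_series_def)
  then have "((\<lambda>j. Re (cnj (\<beta> j) * L2_ip ?M (u j) \<rho>)) has_sum Re (L2_ip ?M \<sigma> \<rho>)) modes"
    by (rule has_sum_Re)
  then have "((\<lambda>j. g / (hbar * c) * Re (cnj (\<beta> j) * L2_ip ?M (u j) \<rho>))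
    has_sum (g / (hbar * c) * Re (L2_ip ?M \<sigma> \<rho>))) modes"
    by (rule has_sum_cmult_right)
  also have "?this \<longleftrightarrow> ((\<lambda>j. sqrt (?l j) * exp (- \<tau> * ?l j) * (norm (b j))\<^sup>2)
    has_sum (g / (hbar * c) * Re (L2_ip ?M \<sigma> \<rho>))) modes"
  proof (rule has_sum_cong)
    fix j assume j: "j \<in> modes"
    have "Re (cnj (\<beta> j) * L2_ip ?M (u j) \<rho>) = inverse (?l j) * Re (cnj (\<beta> j) * \<beta> j)"
    proof -
      have "Re (complex_of_real r * z) = r * Re z" for r z by simp
      then show ?thesis
        unfolding L2_series_coefficient[OF on \<rho> j] \<gamma>[OF j]
          by (simp only: mult.left_commute[of "cnj (\<beta> j)"])
    qed
    also have "Re (cnj (\<beta> j) * \<beta> j) = (norm (\<beta> j))\<^sup>2"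
      by (simp only: cmod_power2) (simp add: power2_eq_square)
    finally show "g / (hbar * c) * Re (cnj (\<beta> j) * L2_ip ?M (u j) \<rho>)
      = sqrt (?l j) * exp (- \<tau> * ?l j) * (norm (b j))\<^sup>2"
      unfolding \<beta>2[OF j] using l[OF j] assms(1-3) by simp
  qed
  also have "g / (hbar * c) * Re (L2_ip ?M \<sigma> \<rho>)
    = 2 / (hbar * c) * channel_energy hbar c g L a u \<tau> b"
  proof -
    have "L2_inner L a \<sigma> (\<lambda>x. of_real g * \<rho> x) = of_real g * L2_ip ?M \<sigma> \<rho>"
      using L2_ip_scale_right[of ?M \<sigma> "of_real g" \<rho>] by (simp add: L2_inner_def L2_ip_def)
    then have "channel_energy hbar c g L a u \<tau> b = 1/2 * (g * Re (L2_ip ?M \<sigma> \<rho>))"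
      by (simp add: channel_energy_def Let_def \<sigma>_def[symmetric] \<rho>_def[symmetric])
    then show ?thesis by simp
  qed
  finally show ?thesis .
qed

text \<open>
  At sample points where the coefficients of the field are not square summable, no function
  satisfies the condition in \<open>L2_sum\<close>, and the choice operator returns one and the same value.
  Hence the energy is constant on this null set, and so it is measurable even if the probability
  space is not complete.
\<close>

lemma channel_energy_default:
  assumes "hbar > 0" "c > 0" "g > 0" and L: "L > 0" "a > 0"
    and on: "orthonormal (vol L a) u modes"
  shows "\<exists>E. \<forall>b. \<not> (\<lambda>j. eigval L a j * (sqrt (eigval L a j) * exp (- \<tau> * eigval L a j)) *
    (norm (b j))\<^sup>2) summable_on modes
    \<longrightarrow> channel_energy hbar c g L a u \<tau> b = E"
proof -
  let ?l = "eigval L a"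
  define f0 :: "real ^ 3 \<Rightarrow> complex" where "f0 = (SOME f. False)"
  have "sigma_field hbar c g L a u \<tau> b = f0"
    if "\<not> (\<lambda>j. ?l j * (sqrt (?l j) * exp (- \<tau> * ?l j)) * (norm (b j))\<^sup>2) summable_on modes" for b
  proof -
    define \<beta> where "\<beta> j = complex_of_real (sigma_symbol hbar c g \<tau> (?l j)) * b j" for j
    have \<beta>2: "(norm (\<beta> j))\<^sup>2 = (hbar * c / g) *
      (?l j * (sqrt (?l j) * exp (- \<tau> * ?l j)) * (norm (b j))\<^sup>2)" if "j \<in> modes" for j
      unfolding \<beta>_def norm_mult power_mult_distrib norm_of_real power2_abs
      using sigma_symbol_square[OF assms(1-3) eigval_pos[OF L that]] by simp
    have "\<not> L2_series (vol L a) u modes \<beta> f" for f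
    proof
      assume "L2_series (vol L a) u modes \<beta> f"
      then have "(\<lambda>j. (norm (\<beta> j))\<^sup>2) summable_on modes" by (rule L2_series_square_summable[OF on])
      then have "(\<lambda>j. (g / (hbar * c)) * (norm (\<beta> j))\<^sup>2) summable_on modes"
        by (rule summable_on_cmult_right)
      then have "(\<lambda>j. ?l j * (sqrt (?l j) * exp (- \<tau> * ?l j)) * (norm (b j))\<^sup>2) summable_on modes"
        by (rule summable_on_cong[THEN iffD1, rotated]) (use assms(1-3) in \<open>simp add: \<beta>2\<close>)
      then show False using that by simp
    qed
    then show ?thesis
      by (simp add: sigma_field_def LB_apply_def L2_sum_eq \<beta>_def[abs_def] sigma_symbol_def f0_def)
  qed
  then show ?thesis
    by (intro exI[of _ "1/2 * Re (L2_inner L a f0 (\<lambda>x. of_real g * LB_inverse L a u f0 x))"])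
      (simp add: channel_energy_def Let_def)
qed

text \<open>
  Monotone convergence with \<open>E (norm (\<xi> j))\<^sup>2 = 1\<close>, once with the weights \<open>v\<close> of the energy and
  once with the weights \<open>w\<close> of the squared norm of the field. The latter shows that the field
  exists almost surely.
\<close>

lemma channel_energy_expectation:
  fixes \<xi> :: "mode \<Rightarrow> 'w \<Rightarrow> complex"
  assumes h: "hbar > 0" "c > 0" "g > 0" and L: "L > 0" "a > 0" and \<tau>: "\<tau> > 0"
    and on: "orthonormal (vol L a) u modes"
    and \<xi>_meas: "\<And>j. j \<in> modes \<Longrightarrow> \<xi> j \<in> borel_measurable M"
    and \<xi>_var: "\<And>j. j \<in> modes \<Longrightarrow> (\<integral>\<omega>. \<xi> j \<omega> * cnj (\<xi> j \<omega>) \<partial>M) = 1"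
  shows "has_bochner_integral M (\<lambda>\<omega>. channel_energy hbar c g L a u \<tau> (\<lambda>j. \<xi> j \<omega>))
    (hbar * c / 2 * spectral_sum L a \<tau>)"
proof -
  let ?X = "\<lambda>\<omega>. channel_energy hbar c g L a u \<tau> (\<lambda>j. \<xi> j \<omega>)"
  let ?l = "eigval L a"
  define v where "v j = sqrt (?l j) * exp (- \<tau> * ?l j)" for j
  define w where "w j = ?l j * v j" for j
  have l: "?l j > 0" if "j \<in> modes" for j using L that by (rule eigval_pos)
  have v: "(v has_sum spectral_sum L a \<tau>) modes"
    unfolding v_def using L \<tau> by (rule has_sum_spectral_sum)
  have v0: "0 \<le> v j" and w0: "0 \<le> w j" if "j \<in> modes" for j
    using l[OF that] by (simp_all add: v_def w_def)
  have w: "w summable_on modes"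
  proof (rule summable_on_comparison_test)
    have "(\<lambda>j. sqrt (?l j) * exp (- (\<tau> / 2) * ?l j)) summable_on modes"
      using has_sum_spectral_sum[OF L, of "\<tau> / 2"] \<tau> by (intro has_sum_imp_summable) auto
    then show "(\<lambda>j. 2 / \<tau> * (sqrt (?l j) * exp (- (\<tau> / 2) * ?l j))) summable_on modes"
      by (rule summable_on_cmult_right)
    fix j assume j: "j \<in> modes"
    have "exp (- (\<tau> / 2 * ?l j)) \<le> fact 1 / (\<tau> / 2 * ?l j) ^ 1"
      using \<tau> l[OF j] by (intro exp_minus_le) auto
    then have e: "?l j * exp (- (\<tau> / 2) * ?l j) \<le> 2 / \<tau>"
      using \<tau> l[OF j] by (simp add: field_simps)
    have "w j = (?l j * exp (- (\<tau> / 2) * ?l j)) * (sqrt (?l j) * exp (- (\<tau> / 2) * ?l j))"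
      by (simp add: w_def v_def exp_add[symmetric] mult_ac)
    also have "\<dots> \<le> 2 / \<tau> * (sqrt (?l j) * exp (- (\<tau> / 2) * ?l j))"
      using l[OF j] by (intro mult_right_mono e) auto
    finally show "w j \<le> 2 / \<tau> * (sqrt (?l j) * exp (- (\<tau> / 2) * ?l j))" .
  qed (rule w0)
  define e where "e = from_nat_into modes"
  have e: "bij_betw e UNIV modes" unfolding e_def
    using countable_modes infinite_modes by (rule bij_betw_from_nat_into)
  have eJ: "e n \<in> modes" for n using e by (auto simp: bij_betw_def)
  have [measurable]: "\<xi> (e n) \<in> borel_measurable M" for n using \<xi>_meas[OF eJ] .
  have Y: "(\<integral>\<^sup>+\<omega>. ennreal ((norm (\<xi> j \<omega>))\<^sup>2) \<partial>M) = 1" if j: "j \<in> modes" for j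
  proof -
    have "complex_of_real (\<integral>\<omega>. (norm (\<xi> j \<omega>))\<^sup>2 \<partial>M) = (\<integral>\<omega>. \<xi> j \<omega> * cnj (\<xi> j \<omega>) \<partial>M)"
      unfolding integral_complex_of_real[symmetric] complex_norm_square by simp
    then have 1: "(\<integral>\<omega>. (norm (\<xi> j \<omega>))\<^sup>2 \<partial>M) = 1" using \<xi>_var[OF j] by (simp only: of_real_eq_1_iff)
    then have "integrable M (\<lambda>\<omega>. (norm (\<xi> j \<omega>))\<^sup>2)" using not_integrable_integral_eq by fastforce
    then show ?thesis using 1 by (subst nn_integral_eq_integral) auto
  qed
  define T where "T x \<omega> = (\<Sum>n. ennreal (x (e n) * (norm (\<xi> (e n) \<omega>))\<^sup>2))" for x :: "mode \<Rightarrow> real"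
    and \<omega>
  have T_meas [measurable]: "T x \<in> borel_measurable M" for x unfolding T_def by measurable
  have T_int: "(\<integral>\<^sup>+\<omega>. T x \<omega> \<partial>M) = ennreal (infsum x modes)"
    if x: "x summable_on modes" "\<And>j. j \<in> modes \<Longrightarrow> 0 \<le> x j" for x
  proof -
    have "(\<integral>\<^sup>+\<omega>. T x \<omega> \<partial>M) = (\<Sum>n. \<integral>\<^sup>+\<omega>. ennreal (x (e n) * (norm (\<xi> (e n) \<omega>))\<^sup>2) \<partial>M)"
      unfolding T_def by (rule nn_integral_suminf) measurable
    also have "\<dots> = (\<Sum>n. ennreal (x (e n)))"
    proof (rule suminf_cong)
      fix n
      have "(\<integral>\<^sup>+\<omega>. ennreal (x (e n) * (norm (\<xi> (e n) \<omega>))\<^sup>2) \<partial>M)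
        = (\<integral>\<^sup>+\<omega>. ennreal (x (e n)) * ennreal ((norm (\<xi> (e n) \<omega>))\<^sup>2) \<partial>M)"
        using x(2)[OF eJ] by (intro nn_integral_cong) (simp add: ennreal_mult)
      also have "\<dots> = ennreal (x (e n)) * (\<integral>\<^sup>+\<omega>. ennreal ((norm (\<xi> (e n) \<omega>))\<^sup>2) \<partial>M)"
        by (rule nn_integral_cmult) measurable
      also have "\<dots> = ennreal (x (e n))" by (simp add: Y[OF eJ])
      finally show "(\<integral>\<^sup>+\<omega>. ennreal (x (e n) * (norm (\<xi> (e n) \<omega>))\<^sup>2) \<partial>M) = ennreal (x (e n))" .
    qed
    also have "\<dots> = ennreal (infsum x modes)"
      using summable_on_enumeration(2)[OF e x(2) x(1)] by simp
    finally show ?thesis .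
  qed
  have T_sum: "(\<lambda>j. x j * (norm (\<xi> j \<omega>))\<^sup>2) summable_on modes \<longleftrightarrow> T x \<omega> \<noteq> \<infinity>"
    "(\<lambda>j. x j * (norm (\<xi> j \<omega>))\<^sup>2) summable_on modes \<Longrightarrow> T x \<omega>
      = ennreal (\<Sum>\<^sub>\<infinity>j\<in>modes. x j * (norm (\<xi> j \<omega>))\<^sup>2)"
    if "\<And>j. j \<in> modes \<Longrightarrow> 0 \<le> x j" for x \<omega>
    unfolding T_def using that
    by (intro summable_on_enumeration[OF e, of "\<lambda>j. x j * (norm (\<xi> j \<omega>))\<^sup>2"]; simp)+
  \<comment> \<open>The energy is the series with weights \<open>v\<close> where the field exists, and a constant
    elsewhere.\<close>
  obtain E where E: "\<And>b. \<not> (\<lambda>j. w j * (norm (b j))\<^sup>2) summable_on modes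
    \<Longrightarrow> channel_energy hbar c g L a u \<tau> b = E"
    using channel_energy_default[OF h L on, of \<tau>] unfolding w_def v_def by blast
  have X: "(?X \<omega>) = (if T w \<omega> \<noteq> \<infinity> then hbar * c / 2 * enn2real (T v \<omega>) else E)" for \<omega>
  proof (cases "T w \<omega> = \<infinity>")
    case True
    then show ?thesis using T_sum(1)[of w \<omega>, OF w0] E by simp
  next
    case False
    then have sw: "(\<lambda>j. w j * (norm (\<xi> j \<omega>))\<^sup>2) summable_on modes" using T_sum(1)[of w \<omega>, OF w0]
      by simp
    have s: "((\<lambda>j. v j * (norm (\<xi> j \<omega>))\<^sup>2) has_sum (2 / (hbar * c) * (?X \<omega>))) modes"
      using channel_energy_has_sum[OF h L on sw[unfolded w_def v_def]] unfolding v_def .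
    have "T v \<omega> = ennreal (2 / (hbar * c) * (?X \<omega>))"
      using T_sum(2)[of v \<omega>, OF v0 has_sum_imp_summable[OF s]] infsumI[OF s] by simp
    moreover have "0 \<le> 2 / (hbar * c) * (?X \<omega>)"
      using s by (rule has_sum_nonneg) (use v0 in auto)
    ultimately have "enn2real (T v \<omega>) = 2 / (hbar * c) * (?X \<omega>)"
      by (simp only: enn2real_ennreal)
    then show ?thesis using False h by simp
  qed
  have v_eq: "infsum v modes = spectral_sum L a \<tau>" using v by (rule infsumI)
  have S0: "0 \<le> spectral_sum L a \<tau>" using v v0 by (rule has_sum_nonneg)
  have Tv: "(\<integral>\<^sup>+\<omega>. T v \<omega> \<partial>M) = ennreal (spectral_sum L a \<tau>)"
    using T_int[OF has_sum_imp_summable[OF v] v0] by (simp add: v_eq)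
  have "AE \<omega> in M. T v \<omega> \<noteq> \<infinity>" by (rule nn_integral_PInf_AE) (simp_all add: Tv)
  then have "(\<integral>\<^sup>+\<omega>. ennreal (enn2real (T v \<omega>)) \<partial>M) = ennreal (spectral_sum L a \<tau>)"
    unfolding Tv[symmetric] by (intro nn_integral_cong_AE)
      (auto elim!: eventually_mono simp: top.not_eq_extremum)
  then have "has_bochner_integral M (\<lambda>\<omega>. enn2real (T v \<omega>)) (spectral_sum L a \<tau>)"
    using S0 by (intro has_bochner_integral_nn_integral) auto
  then have main: "has_bochner_integral M (\<lambda>\<omega>. hbar * c / 2 * enn2real (T v \<omega>))
    (hbar * c / 2 * spectral_sum L a \<tau>)"
    by (rule has_bochner_integral_mult_right)
  have "AE \<omega> in M. T w \<omega> \<noteq> \<infinity>"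
    by (rule nn_integral_PInf_AE) (simp_all add: T_int[OF w w0])
  then have ae: "AE \<omega> in M. hbar * c / 2 * enn2real (T v \<omega>) = (?X \<omega>)"
    unfolding X by eventually_elim simp
  have meas: "(\<lambda>\<omega>. (?X \<omega>)) \<in> borel_measurable M"
    unfolding X by measurable
  show ?thesis
    using has_bochner_integral_cong_AE[THEN iffD1, OF borel_measurable_has_bochner_integral[OF main]
      meas ae main] .
qed

lemma stochastic_energy_expectation:
  fixes \<xi> :: "nat \<Rightarrow> mode \<Rightarrow> 'w \<Rightarrow> complex"
  assumes h: "hbar > 0" "c > 0" "g > 0" and L: "L > 0" "a > 0" and \<tau>: "\<tau> > 0"
    and u: "orthonormal_eigenbasis L a u" and \<xi>: "white_noise_channels M N \<xi>"
  shows "has_bochner_integral M (stochastic_energy hbar c g L a N u \<xi> \<tau>)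
    (of_nat N * (hbar * c / 2 * spectral_sum L a \<tau>))"
proof -
  have "has_bochner_integral M (\<lambda>\<omega>. \<Sum>k<N. channel_energy hbar c g L a u \<tau> (\<lambda>j. \<xi> k j \<omega>))
    (\<Sum>k<N. hbar * c / 2 * spectral_sum L a \<tau>)"
  proof (rule has_bochner_integral_sum)
    fix k assume k: "k \<in> {..<N}"
    show "has_bochner_integral M (\<lambda>\<omega>. channel_energy hbar c g L a u \<tau> (\<lambda>j. \<xi> k j \<omega>))
      (hbar * c / 2 * spectral_sum L a \<tau>)"
    proof (rule channel_energy_expectation[OF h L \<tau> orthonormal_eigenbasis_imp_orthonormal[OF u]])
      show "\<xi> k j \<in> borel_measurable M" if "j \<in> modes" for j
        using \<xi> k that by (auto simp: white_noise_channels_def centered_gaussian_def)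
      show "(\<integral>\<omega>. \<xi> k j \<omega> * cnj (\<xi> k j \<omega>) \<partial>M) = 1" if "j \<in> modes" for j
        using \<xi> k that by (auto simp: white_noise_channels_def)
    qed
  qed
  then show ?thesis unfolding stochastic_energy_def[abs_def] by simp
qed

section \<open>Uniqueness of finite parts and the comparison coefficient\<close>

text \<open>
  After multiplication by \<open>\<tau> powr 2\<close> the limit is \<open>0\<close> on the one hand and \<open>P\<close> on the other; then
  multiplication by \<open>\<tau> powr (3/2)\<close> shows in the same way that \<open>Q\<close> vanishes.
\<close>

lemma divergent_powers_unique:
  fixes P Q G :: real
  assumes "((\<lambda>\<tau>. P * \<tau> powr (- 2) + Q * \<tau> powr (- 3/2)) \<longlongrightarrow> G) (at_right 0)"
  shows "G = 0"
proof -
  have z: "((\<lambda>\<tau>::real. \<tau> powr r) \<longlongrightarrow> 0) (at_right 0)" if "r > 0" for r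
  proof -
    have "((\<lambda>\<tau>::real. \<tau> powr r) \<longlongrightarrow> 0 powr r) (at_right 0)"
      using that by (intro tendsto_powr' tendsto_intros) (auto simp: eventually_at_filter)
    then show ?thesis by simp
  qed
  have "((\<lambda>\<tau>. (P * \<tau> powr (- 2) + Q * \<tau> powr (- 3/2)) * \<tau> powr 2) \<longlongrightarrow> G * 0) (at_right 0)"
    by (intro tendsto_mult assms z) auto
  moreover have "\<forall>\<^sub>F \<tau> in at_right 0. (P * \<tau> powr (- 2) + Q * \<tau> powr (- 3/2)) * \<tau> powr 2
    = P + Q * \<tau> powr (1/2)"
  proof (rule eventually_at_rightI[of 0 1])
    fix \<tau> :: real assume "\<tau> \<in> {0<..<1}"
    then have "\<tau> powr (- 2) * \<tau> powr 2 = 1" "\<tau> powr (- 3/2) * \<tau> powr 2 = \<tau> powr (1/2)"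
      using powr_add[of \<tau> "- 2" 2] powr_add[of \<tau> "- 3/2" 2] by simp_all
    then show "(P * \<tau> powr (- 2) + Q * \<tau> powr (- 3/2)) * \<tau> powr 2 = P + Q * \<tau> powr (1/2)"
      by (simp only: distrib_right mult.assoc mult_1_right)
  qed simp
  ultimately have "((\<lambda>\<tau>. P + Q * \<tau> powr (1/2)) \<longlongrightarrow> G * 0) (at_right 0)"
    by (rule Lim_transform_eventually)
  moreover have "((\<lambda>\<tau>. P + Q * \<tau> powr (1/2)) \<longlongrightarrow> P + Q * 0) (at_right 0)"
    by (intro tendsto_intros z) auto
  ultimately have P: "P = 0"
    using tendsto_unique[OF trivial_limit_at_right_real] by fastforce
  have "((\<lambda>\<tau>. (P * \<tau> powr (- 2) + Q * \<tau> powr (- 3/2)) * \<tau> powr (3/2)) \<longlongrightarrow> G * 0) (at_right 0)"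
    by (intro tendsto_mult assms z) auto
  moreover have "\<forall>\<^sub>F \<tau> in at_right 0. (P * \<tau> powr (- 2) + Q * \<tau> powr (- 3/2)) * \<tau> powr (3/2) = Q"
  proof (rule eventually_at_rightI[of 0 1])
    fix \<tau> :: real assume "\<tau> \<in> {0<..<1}"
    then have "\<tau> powr (- 3/2) * \<tau> powr (3/2) = 1"
      using powr_add[of \<tau> "- 3/2" "3/2"] by simp
    then show "(P * \<tau> powr (- 2) + Q * \<tau> powr (- 3/2)) * \<tau> powr (3/2) = Q"
      by (simp only: P mult_zero_left add_0 mult.assoc mult_1_right)
  qed simp
  ultimately have "((\<lambda>\<tau>::real. Q) \<longlongrightarrow> G * 0) (at_right 0)"
    by (rule Lim_transform_eventually)
  then have Q: "Q = 0"
    using tendsto_unique[OF trivial_limit_at_right_real _ tendsto_const] by fastforce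
  show "G = 0"
    using assms tendsto_unique[OF trivial_limit_at_right_real _ tendsto_const] unfolding P Q
      by fastforce
qed

lemma has_finite_part_unique:
  assumes "has_finite_part V A f F" "has_finite_part V A f F'"
  shows "F = F'"
proof -
  obtain p q where 1: "((\<lambda>\<tau>. f \<tau> - p * V * \<tau> powr (- 2) - q * A * \<tau> powr (- 3/2)) \<longlongrightarrow> F) (at_right 0)"
    using assms(1) by (auto simp: has_finite_part_def)
  obtain p' q' where 2: "((\<lambda>\<tau>. f \<tau> - p' * V * \<tau> powr (- 2) - q' * A * \<tau> powr (- 3/2)) \<longlongrightarrow> F')
    (at_right 0)"
    using assms(2) by (auto simp: has_finite_part_def)
  have "((\<lambda>\<tau>. ((p' - p) * V) * \<tau> powr (- 2) + ((q' - q) * A) * \<tau> powr (- 3/2)) \<longlongrightarrow> F - F')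
    (at_right 0)"
    using tendsto_diff[OF 1 2] by (simp add: algebra_simps)
  then have "F - F' = 0" by (rule divergent_powers_unique)
  then show ?thesis by simp
qed

lemma finite_part_eqI: "has_finite_part V A f F \<Longrightarrow> finite_part V A f = F"
  unfolding finite_part_def using has_finite_part_unique by (intro the_equality)

theorem proposition8p8:
  fixes hbar c g a :: real and N :: nat
    and M :: "nat \<Rightarrow> 'w measure"
    and u :: "nat \<Rightarrow> mode \<Rightarrow> real ^ 3 \<Rightarrow> complex"
    and \<xi> :: "nat \<Rightarrow> nat \<Rightarrow> mode \<Rightarrow> 'w \<Rightarrow> complex"
  assumes "hbar > 0" and "c > 0" and "g > 0" and "a > 0" and "N \<ge> 1"
    and "\<And>n. n \<ge> 1 \<Longrightarrow> orthonormal_eigenbasis (of_nat n * a) a (u n)"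
    and "\<And>n. n \<ge> 1 \<Longrightarrow> white_noise_channels (M n) N (\<xi> n)"
  shows
    "(\<forall>\<alpha>>0. (\<forall>n\<ge>1.
         (\<forall>\<tau>>0. integrable (M n) (Theta hbar c g a N u \<xi> \<alpha> n \<tau>)) \<and>
         (\<exists>F. has_finite_part (plate_area n a * a) (plate_area n a)
                (mean_Theta hbar c g a N M u \<xi> \<alpha> n) F)) \<and>
       convergent (finite_mean_Theta hbar c g a N M u \<xi> \<alpha>) \<and>
       Theta_bar hbar c g a N M u \<xi> \<alpha> = of_nat N * pi\<^sup>2 / (1440 * Delta \<alpha>)) \<and>
     (\<forall>\<alpha>>0. Theta_bar hbar c g a N M u \<xi> \<alpha> \<ge> Theta_bar hbar c g a N M u \<xi> 1 \<and>
       (Theta_bar hbar c g a N M u \<xi> \<alpha> = Theta_bar hbar c g a N M u \<xi> 1 \<longleftrightarrow> \<alpha> = 1)) \<and>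
     Theta_bar hbar c g a N M u \<xi> 1 = of_nat N * pi\<^sup>2 / (1440 * Delta 1) \<and>
     (N = 2 \<longrightarrow> Theta_bar hbar c g a N M u \<xi> 1 = pi\<^sup>2 / (720 * Delta 1))"
proof -
  let ?TB = "Theta_bar hbar c g a N M u \<xi>"
  let ?m = "\<lambda>\<alpha> n. mean_Theta hbar c g a N M u \<xi> \<alpha> n"
  note h = assms(1-3) and a = assms(4)
  define I where "I n = (\<integral>x. heat_error (real n * a) a (1 / x\<^sup>2) \<partial>lborel)" for n
  have Theta_int: "has_bochner_integral (M n) (Theta hbar c g a N u \<xi> \<alpha> n \<tau>)
      (- (a * real N / (2 * (real n)\<^sup>2 * Delta \<alpha>)) * spectral_sum (real n * a) a \<tau>)"
    if \<alpha>: "\<alpha> > 0" and n: "n \<ge> 1" and \<tau>: "\<tau> > 0" for \<alpha> n \<tau>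
  proof -
    have "0 < real n * a" using a n by simp
    from has_bochner_integral_divide_zero[OF stochastic_energy_expectation[OF h this a \<tau>
      assms(6)[OF n] assms(7)[OF n]]]
    have "has_bochner_integral (M n) (\<lambda>\<omega>. stochastic_energy hbar c g (real n * a) a N (u n) (\<xi> n) \<tau>
      \<omega> / reference_energy \<alpha> (hbar * c) n a)
      (real N * (hbar * c / 2 * spectral_sum (real n * a) a \<tau>) / reference_energy \<alpha> (hbar * c) n a)"
        .
    also have "real N * (hbar * c / 2 * spectral_sum (real n * a) a \<tau>) / reference_energy \<alpha>
      (hbar * c) n a
      = - (a * real N / (2 * (real n)\<^sup>2 * Delta \<alpha>)) * spectral_sum (real n * a) a \<tau>"
      unfolding reference_energy_def using h a n Delta_pos[OF \<alpha>] by (simp add: field_simps)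
    finally show ?thesis unfolding Theta_def[abs_def] .
  qed
  have fp: "has_finite_part (plate_area n a * a) (plate_area n a) ((?m \<alpha> n))
      (a * real N / (4 * Delta \<alpha> * sqrt pi) * (I n / (real n)\<^sup>2))"
    if \<alpha>: "\<alpha> > 0" and n: "n \<ge> 1" for \<alpha> n
  proof -
    \<comment> \<open>The expectation is \<open>\<kappa>\<close> times the spectral sum, so its finite part is \<open>\<kappa>\<close> times that of
      the spectral sum.\<close>
    define \<kappa> where "\<kappa> = - (a * real N / (2 * (real n)\<^sup>2 * Delta \<alpha>))"
    have "real n * a \<ge> a" using a n by simp
    then obtain p q where pq: "((\<lambda>\<tau>. spectral_sum (real n * a) a \<tau> - p * \<tau> powr (- 2) - q * \<tau> powr
      (- 3/2)) \<longlongrightarrow>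
       - I n / (2 * sqrt pi)) (at_right 0)"
      using spectral_sum_finite_part[OF a] unfolding I_def by blast
    have A: "plate_area n a \<noteq> 0" using a n by simp
    have "((\<lambda>\<tau>. \<kappa> * (spectral_sum (real n * a) a \<tau> - p * \<tau> powr (- 2) - q * \<tau> powr (- 3/2))) \<longlongrightarrow>
       \<kappa> * (- I n / (2 * sqrt pi))) (at_right 0)"
      by (intro tendsto_mult tendsto_const pq)
    moreover have "\<forall>\<^sub>F \<tau> in at_right 0. \<kappa> * (spectral_sum (real n * a) a \<tau> - p * \<tau> powr (- 2) - q *
      \<tau> powr (- 3/2))
       = (?m \<alpha> n) \<tau> - (\<kappa> * p / (plate_area n a * a)) * (plate_area n a * a) * \<tau> powr (- 2)
           - (\<kappa> * q / plate_area n a) * plate_area n a * \<tau> powr (- 3/2)"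
    proof (rule eventually_at_rightI[of 0 1])
      fix \<tau> :: real assume "\<tau> \<in> {0<..<1}"
      then have "(?m \<alpha> n) \<tau> = \<kappa> * spectral_sum (real n * a) a \<tau>"
        using Theta_int[OF \<alpha> n, of \<tau>] by (simp add: mean_Theta_def has_bochner_integral_iff \<kappa>_def)
      moreover have "(\<kappa> * p / (plate_area n a * a)) * (plate_area n a * a) = \<kappa> * p"
        "(\<kappa> * q / plate_area n a) * plate_area n a = \<kappa> * q"
        using A a by simp_all
      ultimately show "\<kappa> * (spectral_sum (real n * a) a \<tau> - p * \<tau> powr (- 2) - q * \<tau> powr (- 3/2))
       = (?m \<alpha> n) \<tau> - (\<kappa> * p / (plate_area n a * a)) * (plate_area n a * a) * \<tau> powr (- 2)
           - (\<kappa> * q / plate_area n a) * plate_area n a * \<tau> powr (- 3/2)"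
        by (simp only: right_diff_distrib mult.assoc)
    qed simp
    ultimately have "((\<lambda>\<tau>. (?m \<alpha> n) \<tau> - (\<kappa> * p / (plate_area n a * a)) * (plate_area n a * a) * \<tau>
      powr (- 2)
           - (\<kappa> * q / plate_area n a) * plate_area n a * \<tau> powr (- 3/2)) \<longlongrightarrow> \<kappa> *
             (- I n / (2 * sqrt pi))) (at_right 0)"
      by (rule Lim_transform_eventually)
    moreover have "\<kappa> * (- I n / (2 * sqrt pi))
      = a * real N / (4 * Delta \<alpha> * sqrt pi) * (I n / (real n)\<^sup>2)"
      by (simp add: \<kappa>_def)
    ultimately show ?thesis unfolding has_finite_part_def by metis
  qed
  have lim: "finite_mean_Theta hbar c g a N M u \<xi> \<alpha> \<longlonglongrightarrow> of_nat N * pi\<^sup>2 / (1440 * Delta \<alpha>)"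
    if \<alpha>: "\<alpha> > 0" for \<alpha>
  proof -
    have L1: "(\<lambda>n. a * real N / (4 * Delta \<alpha> * sqrt pi) * (I n / (real n)\<^sup>2))
      \<longlonglongrightarrow> a * real N / (4 * Delta \<alpha> * sqrt pi) * (pi\<^sup>2 * sqrt pi / (360 * a))"
      unfolding I_def by (intro tendsto_mult tendsto_const heat_error_integral_limit[OF a])
    have ev: "\<forall>\<^sub>F n in sequentially. a * real N / (4 * Delta \<alpha> * sqrt pi) * (I n / (real n)\<^sup>2)
      = finite_mean_Theta hbar c g a N M u \<xi> \<alpha> n"
      using eventually_ge_at_top[of 1]
      by eventually_elim (simp only: finite_mean_Theta_def finite_part_eqI[OF fp[OF \<alpha>]])
    have eq: "a * real N / (4 * Delta \<alpha> * sqrt pi) * (pi\<^sup>2 * sqrt pi / (360 * a))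
      = of_nat N * pi\<^sup>2 / (1440 * Delta \<alpha>)"
      using a Delta_pos[OF \<alpha>] by (simp add: field_simps)
    show ?thesis using Lim_transform_eventually[OF L1 ev] unfolding eq .
  qed
  have val: "?TB \<alpha> = of_nat N * pi\<^sup>2 / (1440 * Delta \<alpha>)" if "\<alpha> > 0" for \<alpha>
    unfolding Theta_bar_def using lim[OF that] by (rule limI)
  have less: "?TB 1 < ?TB \<alpha>" if "\<alpha> > 0" "\<alpha> \<noteq> 1" for \<alpha>
    unfolding val[OF that(1)] val[OF zero_less_one]
    using Delta_less_cube[OF that] Delta_pos[OF that(1)] assms(5)
    by (intro divide_strict_left_mono) auto
  show ?thesis
  proof (intro conjI allI impI)
    fix \<alpha> :: real assume \<alpha>: "\<alpha> > 0"
    show "convergent (finite_mean_Theta hbar c g a N M u \<xi> \<alpha>)" using lim[OF \<alpha>] by (rule convergentI)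
    show "?TB \<alpha> = of_nat N * pi\<^sup>2 / (1440 * Delta \<alpha>)" by (rule val[OF \<alpha>])
    show "?TB 1 \<le> ?TB \<alpha>"
      using less[OF \<alpha>] by (cases "\<alpha> = 1") auto
    show "?TB \<alpha> = ?TB 1 \<longleftrightarrow> \<alpha> = 1"
      using less[OF \<alpha>] by (cases "\<alpha> = 1") auto
    fix n :: nat assume n: "n \<ge> 1"
    show "integrable (M n) (Theta hbar c g a N u \<xi> \<alpha> n \<tau>)" if "\<tau> > 0" for \<tau>
      using Theta_int[OF \<alpha> n that] by (simp add: has_bochner_integral_iff)
    show "\<exists>F. has_finite_part (plate_area n a * a) (plate_area n a) ((?m \<alpha> n)) F"
      using fp[OF \<alpha> n] by blast
  next
    show "?TB 1 = of_nat N * pi\<^sup>2 / (1440 * Delta 1)" by (rule val) simp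
    show "?TB 1 = pi\<^sup>2 / (720 * Delta 1)" if "N = 2"
      using val[of 1] that by simp
  qed
qed

end
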